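(* Let $0<\Lambda<1$ and let $f\in C^{0,1}_{loc}[0,+\infty)$ satisfy $f(0)=0$ and $-\frac1\Lambda\le f'(t)\le-\Lambda$ for a.e. $t\ge0$. Let $R>0$ and let $u$ be a $C^2$ function on $B_R^c\subset\mathbb{R}^2$ whose upward-oriented graph satisfies $\kappa_2=f(\kappa_1)$, where $\kappa_1\ge\kappa_2$ are its principal curvatures, and has limit unit normal $N_\infty=(0,0,1)$ at infinity. Then, up to a vertical translation (that is, after adding a suitable constant to $u$), either $$u(x)>0\ \text{ for all }x\in B_R^c,\qquad\text{or}\qquad u(x)<0\ \text{ for all }x\in B_R^c.$$ Moreover, $u_\infty:=\lim_{x\to\infty}u(x)$ exists in $\mathbb{R}\cup\{\pm\infty\}$.
   Context: $B_R=\{x\in\mathbb{R}^2:|x|<R\}$ and $B_R^c=\mathbb{R}^2\setminus B_R$. For a $C^2$ function $u$ on a planar region, its graph $\{(x,u(x))\}\subset\mathbb{R}^3$ is oriented by the upward unit normal $N=(-Du,1)/\sqrt{1+|Du|^2}$. Its principal curvatures $\kappa_1\ge\kappa_2$ are determined by $$\frac{\kappa_1+\kappa_2}{2}=\frac{(1+u_2^2)u_{11}-2u_1u_2u_{12}+(1+u_1^2)u_{22}}{2(1+|Du|^2)^{3/2}},\qquad \kappa_1\kappa_2=\frac{\det D^2u}{(1+|Du|^2)^2}.$$ Limit unit normal $N_\infty=(0,0,1)$ means $N(x)\to(0,0,1)$ as $x\to\infty$; equivalently $\lim_{x\to\infty}|Du(x)|=0$. *)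

theory Defs
  imports "HOL-Analysis.Analysis"
begin

text \<open>
  All derivatives are taken within the domain \<^term>\<open>S\<close>. For the closed exterior domain
  \<^term>\<open>- ball 0 R\<close> this gives the ordinary derivatives in the interior and, on the boundary
  circle, their one-sided (up to the boundary) versions; lemma \<open>partial_within_eqI\<close> below shows
  that they are uniquely determined there. The values of a function outside \<^term>\<open>S\<close> are
  irrelevant.
\<close>

definition partial_within :: "(real ^ 'n) set \<Rightarrow> 'n \<Rightarrow> (real ^ 'n \<Rightarrow> real) \<Rightarrow> real ^ 'n \<Rightarrow> real" where
  "partial_within S i u x = frechet_derivative u (at x within S) (axis i 1)"

definition gradient_within :: "(real ^ 'n) set \<Rightarrow> (real ^ 'n \<Rightarrow> real) \<Rightarrow> real ^ 'n \<Rightarrow> real ^ 'n" where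
  "gradient_within S u x = (\<chi> i. partial_within S i u x)"

definition hessian_within :: "(real ^ 'n) set \<Rightarrow> (real ^ 'n \<Rightarrow> real) \<Rightarrow> real ^ 'n \<Rightarrow> real ^ 'n ^ 'n" where
  "hessian_within S u x = (\<chi> i j. partial_within S j (partial_within S i u) x)"

definition C2_on :: "(real ^ 'n) set \<Rightarrow> (real ^ 'n \<Rightarrow> real) \<Rightarrow> bool" where
  "C2_on S u \<longleftrightarrow>
     u differentiable_on S \<and>
     (\<forall>i. partial_within S i u differentiable_on S) \<and>
     continuous_on S (hessian_within S u)"

definition upward_normal :: "(real ^ 2) set \<Rightarrow> (real ^ 2 \<Rightarrow> real) \<Rightarrow> real ^ 2 \<Rightarrow> real ^ 3" where
  "upward_normal S u x =
     (let p = gradient_within S u x in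
      (1 / sqrt (1 + (norm p)\<^sup>2)) *\<^sub>R vector [- (p $ 1), - (p $ 2), 1])"

definition graph_mean_curvature :: "(real ^ 2) set \<Rightarrow> (real ^ 2 \<Rightarrow> real) \<Rightarrow> real ^ 2 \<Rightarrow> real" where
  "graph_mean_curvature S u x =
     (let p = gradient_within S u x; H = hessian_within S u x in
      ((1 + (p $ 2)\<^sup>2) * H $ 1 $ 1 - 2 * p $ 1 * p $ 2 * H $ 1 $ 2 + (1 + (p $ 1)\<^sup>2) * H $ 2 $ 2)
        / (2 * (1 + (norm p)\<^sup>2) powr (3 / 2)))"

definition graph_gauss_curvature :: "(real ^ 2) set \<Rightarrow> (real ^ 2 \<Rightarrow> real) \<Rightarrow> real ^ 2 \<Rightarrow> real" where
  "graph_gauss_curvature S u x =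
     det (hessian_within S u x) / (1 + (norm (gradient_within S u x))\<^sup>2)\<^sup>2"

definition principal_curvatures ::
    "(real ^ 2) set \<Rightarrow> (real ^ 2 \<Rightarrow> real) \<Rightarrow> real ^ 2 \<Rightarrow> real \<Rightarrow> real \<Rightarrow> bool" where
  "principal_curvatures S u x k1 k2 \<longleftrightarrow>
     k2 \<le> k1 \<and>
     (k1 + k2) / 2 = graph_mean_curvature S u x \<and>
     k1 * k2 = graph_gauss_curvature S u x"

definition locally_lipschitz_on :: "real set \<Rightarrow> (real \<Rightarrow> real) \<Rightarrow> bool" where
  "locally_lipschitz_on I f \<longleftrightarrow> (\<forall>K. compact K \<and> K \<subseteq> I \<longrightarrow> (\<exists>L. L-lipschitz_on K f))"

lemma partial_within_eqI:
  fixes u :: "real ^ 'n \<Rightarrow> real"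
  assumes "x \<in> - ball 0 R" and D: "(u has_derivative D) (at x within - ball 0 R)"
  shows "partial_within (- ball 0 R) i u x = D (axis i 1)"
proof -
  have dir: "\<exists>d. 0 < \<bar>d\<bar> \<and> \<bar>d\<bar> < e \<and> x + d *\<^sub>R b \<in> - ball 0 R" if "b \<in> Basis" "e > 0" for b and e :: real
  proof -
    define d where "d = (if 0 \<le> x \<bullet> b then e / 2 else - (e / 2))"
    have "0 \<le> d * (x \<bullet> b)"
      using \<open>e > 0\<close> by (auto simp: d_def mult_nonpos_nonneg mult_nonneg_nonpos)
    then have "x \<bullet> x \<le> (x + d *\<^sub>R b) \<bullet> (x + d *\<^sub>R b)"
      using \<open>b \<in> Basis\<close> by (simp add: inner_add_left inner_add_right inner_commute inner_same_Basis)
    then have "norm x \<le> norm (x + d *\<^sub>R b)"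
      by (simp add: norm_le)
    then show ?thesis
      using assms(1) \<open>e > 0\<close> by (intro exI[of _ d]) (auto simp: d_def)
  qed
  have "(u has_derivative frechet_derivative u (at x within - ball 0 R)) (at x within - ball 0 R)"
    using D frechet_derivative_works differentiableI by blast
  then have "frechet_derivative u (at x within - ball 0 R) = D"
    by (rule frechet_derivative_unique_within[OF _ D]) (use dir in blast)
  then show ?thesis
    by (simp add: partial_within_def)
qed

end

theory Submission
  imports Defs
begin

text \<open>
  The two-sided bound on \<open>f'\<close> makes \<open>D\<^sup>2u\<close> indefinite with comparable eigenvalues wherever
  \<open>|Du| \<le> 1\<close>, and this survives subtraction of an affine function.

  One-sided boundedness: let \<open>Du(p) = a \<noteq> 0\<close> with \<open>p\<close> far out and \<open>D\<^sup>2u(p) \<noteq> 0\<close>. Then \<open>v = u - a \<bullet> x\<close> has a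
  saddle at \<open>p\<close>. Since \<open>Du \<rightarrow> 0\<close>, near infinity \<open>v\<close> looks like \<open>- a \<bullet> x\<close>, so each set \<open>{v > c}\<close> and
  \<open>{v < c}\<close> has exactly one unbounded component, and the maximum principle leaves no bounded ones away
  from the inner circle. If \<open>u\<close> falls below its minimum on that circle and \<open>v(p)\<close> were too large, then
  \<open>{v > v(p)}\<close> and \<open>{v < v(p)}\<close> would both be connected, and two loops in them through \<open>p\<close> would cross
  only once. Hence \<open>u - x \<bullet> Du = - r\<^sup>2 (u / r)\<^sub>r\<close> is bounded above, and integrating from infinity, where
  \<open>u / r \<rightarrow> 0\<close>, bounds \<open>u\<close> above.

  Limit: for nonnegative \<open>u\<close>, comparison with \<open>|x - z| powr (- 2 n)\<close> joins a point where \<open>u\<close> is very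
  small to every nearby small disc inside \<open>{u < \<tau>}\<close>. Chains of such discs around a circle block every
  path in \<open>{u \<ge> \<tau>}\<close> that crosses an annulus. This gives a Harnack inequality on large circles, whence
  the lower and upper limits of \<open>u\<close> at infinity agree.
\<close>

text \<open>The curvature equation enters only through a two-sided eigenvalue inequality, so
  comparison and the topology of level sets in the plane replace a linear equation or an expansion
  at infinity. A sign after translation amounts to a bound from one side, since \<open>u\<close> is
  bounded on compact rings.

  If \<open>u\<close> stays above its minimum on the inner circle, it is bounded below; so the
  saddle argument may assume a point \<open>q\<close> with a smaller value. For a level
  \<open>c\<close> above all values of \<open>v\<close> near that circle, \<open>{v > c}\<close>
  cannot touch the circle, while \<open>{v < c}\<close> contains a whole ring, so every component of
  it that reaches the circle is that of \<open>q\<close>.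

  Tangent heights are bounded only where \<open>Du\<close> and \<open>D^2 u\<close> do not vanish.
  This suffices because along a ray the height \<open>u - r * u_r\<close> has derivative
  \<open>- r * u_rr\<close>: where \<open>u_rr = 0\<close> it does not move.

  In the limit argument each disc of a chain costs a fixed factor. The number of discs around a
  circle does not depend on its radius, hence neither does the Harnack constant. The smaller
  \<open>\<theta>\<close> is, the higher the power needed in the barrier.\<close>

section \<open>Functions with indefinite Hessian\<close>

text \<open>For symmetric \<open>H\<close> this says that the extreme eigenvalues satisfy \<open>\<lambda>\<^sub>m\<^sub>i\<^sub>n \<le> - \<theta> \<lambda>\<^sub>m\<^sub>a\<^sub>x\<close> and
  \<open>- \<theta> \<lambda>\<^sub>m\<^sub>i\<^sub>n \<le> \<lambda>\<^sub>m\<^sub>a\<^sub>x\<close>, a condition invariant under \<open>H \<mapsto> - H\<close>.\<close>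

definition elliptic_matrix :: "real \<Rightarrow> real ^ 'n ^ 'n \<Rightarrow> bool" where
  "elliptic_matrix \<theta> H \<longleftrightarrow>
     (\<exists>\<xi>. norm \<xi> = 1 \<and> (\<forall>e. norm e = 1 \<longrightarrow> \<xi> \<bullet> (H *v \<xi>) \<le> - \<theta> * (e \<bullet> (H *v e)))) \<and>
     (\<exists>\<xi>. norm \<xi> = 1 \<and> (\<forall>e. norm e = 1 \<longrightarrow> - \<theta> * (e \<bullet> (H *v e)) \<le> \<xi> \<bullet> (H *v \<xi>)))"

text \<open>Gradient and Hessian are carried along as functions, so that negation and subtraction of
  an affine function act on them pointwise. The derivatives are full ones at every point of
  \<open>S\<close>, also when \<open>S\<close> is closed; hence the theorem applies this only beyond
  a radius larger than \<open>R\<close>.\<close>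

definition saddle_on ::
    "real \<Rightarrow> (real ^ 'n) set \<Rightarrow> (real ^ 'n \<Rightarrow> real) \<Rightarrow> (real ^ 'n \<Rightarrow> real ^ 'n) \<Rightarrow> (real ^ 'n \<Rightarrow> real ^ 'n ^ 'n) \<Rightarrow> bool" where
  "saddle_on \<theta> S u g H \<longleftrightarrow> 0 < \<theta> \<and>
     (\<forall>x\<in>S. (u has_derivative (\<lambda>h. g x \<bullet> h)) (at x) \<and>
            (g has_derivative (\<lambda>h. H x *v h)) (at x) \<and> elliptic_matrix \<theta> (H x))"

lemma saddle_onD:
  assumes "saddle_on \<theta> S u g H" "x \<in> S"
  shows "(u has_derivative (\<lambda>h. g x \<bullet> h)) (at x)" "(g has_derivative (\<lambda>h. H x *v h)) (at x)"
    "elliptic_matrix \<theta> (H x)"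
  using assms by (auto simp: saddle_on_def)

lemma saddle_on_pos: "saddle_on \<theta> S u g H \<Longrightarrow> 0 < \<theta>"
  by (simp add: saddle_on_def)

lemma saddle_on_subset: "saddle_on \<theta> S u g H \<Longrightarrow> T \<subseteq> S \<Longrightarrow> saddle_on \<theta> T u g H"
  by (auto simp: saddle_on_def)

lemma saddle_on_continuous: "saddle_on \<theta> S u g H \<Longrightarrow> continuous_on S u"
  by (meson continuous_at_imp_continuous_on has_derivative_continuous saddle_onD(1))

lemma uminus_matrix_vector: "(- A) *v (x :: real ^ 'n) = - (A *v x)"
  by (simp add: matrix_vector_mult_def vec_eq_iff sum_negf)

lemma elliptic_matrix_uminus: "elliptic_matrix \<theta> H \<Longrightarrow> elliptic_matrix \<theta> (- H)"
  unfolding elliptic_matrix_def uminus_matrix_vector by force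

lemma saddle_on_uminus:
  assumes "saddle_on \<theta> S u g H"
  shows "saddle_on \<theta> S (\<lambda>x. - u x) (\<lambda>x. - g x) (\<lambda>x. - H x)"
  unfolding saddle_on_def
proof (intro conjI ballI)
  fix x assume x: "x \<in> S"
  note D = saddle_onD[OF assms x]
  show "((\<lambda>x. - u x) has_derivative (\<lambda>h. - g x \<bullet> h)) (at x)"
    using has_derivative_minus[OF D(1)] by simp
  show "((\<lambda>x. - g x) has_derivative (\<lambda>h. - H x *v h)) (at x)"
    using has_derivative_minus[OF D(2)] by (simp add: uminus_matrix_vector)
  show "elliptic_matrix \<theta> (- H x)" using D(3) by (rule elliptic_matrix_uminus)
qed (use assms in \<open>simp add: saddle_on_def\<close>)

lemma saddle_on_minus_affine:
  assumes "saddle_on \<theta> S u g H"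
  shows "saddle_on \<theta> S (\<lambda>x. u x - a \<bullet> x - c) (\<lambda>x. g x - a) H"
  unfolding saddle_on_def
proof (intro conjI ballI)
  fix x assume x: "x \<in> S"
  note D = saddle_onD[OF assms x]
  show "((\<lambda>x. u x - a \<bullet> x - c) has_derivative (\<lambda>h. (g x - a) \<bullet> h)) (at x)"
    by (rule derivative_eq_intros D(1) refl)+ (simp add: inner_diff_left)
  show "((\<lambda>x. g x - a) has_derivative (\<lambda>h. H x *v h)) (at x)"
    by (rule derivative_eq_intros D(2) refl)+ simp
qed (use assms in \<open>auto simp: saddle_on_def\<close>)

section \<open>Second derivatives along lines and the maximum principle\<close>

lemma has_real_derivative_along_line:
  fixes u :: "'a::real_inner \<Rightarrow> real"
  assumes "(u has_derivative (\<lambda>h. d \<bullet> h)) (at (x + t *\<^sub>R e))"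
  shows "((\<lambda>t. u (x + t *\<^sub>R e)) has_real_derivative d \<bullet> e) (at t)"
proof -
  have "((\<lambda>t. x + t *\<^sub>R e) has_derivative (\<lambda>h. h *\<^sub>R e)) (at t)"
    by (auto intro!: derivative_eq_intros)
  from has_derivative_compose[OF this assms] show ?thesis
    by (simp add: has_field_derivative_def mult.commute[of _ "d \<bullet> e"] cong: if_cong)
qed

lemma has_real_derivative_gradient_along_line:
  fixes g :: "real ^ 'n \<Rightarrow> real ^ 'n"
  assumes "(g has_derivative (\<lambda>h. A *v h)) (at (x + t *\<^sub>R e))"
  shows "((\<lambda>t. g (x + t *\<^sub>R e) \<bullet> e') has_real_derivative (e' \<bullet> (A *v e))) (at t)"
proof -
  have "((\<lambda>t. x + t *\<^sub>R e) has_derivative (\<lambda>h. h *\<^sub>R e)) (at t)"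
    by (auto intro!: derivative_eq_intros)
  from has_derivative_inner_left[OF has_derivative_compose[OF this assms], of e'] show ?thesis
    by (simp add: has_field_derivative_def matrix_vector_mult_scaleR inner_commute[of e']
        mult.commute[of _ "(A *v e) \<bullet> e'"])
qed

text \<open>\<open>G\<close> is assumed differentiable only at 0, so signs take the place of a
  Taylor expansion: \<open>c > 0\<close> makes \<open>G\<close> negative just before and positive
  just after 0, and the mean value theorem passes this on to \<open>F\<close>.\<close>

lemma second_derivative_strict_local_min:
  fixes F G :: "real \<Rightarrow> real"
  assumes F: "\<forall>\<^sub>F t in nhds 0. (F has_real_derivative G t) (at t)"
    and G: "(G has_real_derivative c) (at 0)" and "G 0 = 0" "0 < c"
  obtains \<delta> where "\<delta> > 0" "\<And>t. t \<noteq> 0 \<Longrightarrow> \<bar>t\<bar> < \<delta> \<Longrightarrow> F 0 < F t"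
proof -
  obtain d1 where d1: "d1 > 0" "\<And>t. \<bar>t\<bar> < d1 \<Longrightarrow> (F has_real_derivative G t) (at t)"
    using F by (auto simp: eventually_nhds_metric dist_real_def)
  obtain d2 where d2: "d2 > 0" "\<And>h. 0 < h \<Longrightarrow> h < d2 \<Longrightarrow> G 0 < G (0 + h)"
    using DERIV_pos_inc_right[OF G \<open>0 < c\<close>] by auto
  obtain d3 where d3: "d3 > 0" "\<And>h. 0 < h \<Longrightarrow> h < d3 \<Longrightarrow> G (0 - h) < G 0"
    using DERIV_pos_inc_left[OF G \<open>0 < c\<close>] by auto
  define \<delta> where "\<delta> = min d1 (min d2 d3)"
  have d: "\<delta> > 0" "\<delta> \<le> d1" "\<delta> \<le> d2" "\<delta> \<le> d3" using d1 d2 d3 by (auto simp: \<delta>_def)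
  show ?thesis
  proof (rule that[OF d(1)])
    fix t :: real assume t: "t \<noteq> 0" "\<bar>t\<bar> < \<delta>"
    show "F 0 < F t"
    proof (cases "t > 0")
      case True
      have "\<exists>z. 0 < z \<and> z < t \<and> F t - F 0 = (t - 0) * G z"
        by (rule MVT2[OF True]) (use t d in \<open>auto intro!: d1\<close>)
      then obtain z where z: "0 < z" "z < t" "F t - F 0 = t * G z" by auto
      have "G z > 0" using d2(2)[of z] z t d True \<open>G 0 = 0\<close> by auto
      then show ?thesis using z True mult_pos_pos[of t "G z"] by linarith
    next
      case False
      then have t0: "t < 0" using t by auto
      have "\<exists>z. t < z \<and> z < 0 \<and> F 0 - F t = (0 - t) * G z"
        by (rule MVT2[OF t0]) (use t d in \<open>auto intro!: d1\<close>)
      then obtain z where z: "t < z" "z < 0" "F 0 - F t = (0 - t) * G z" by auto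
      have "G z < 0" using d3(2)[of "-z"] z t d t0 \<open>G 0 = 0\<close> by auto
      have "(0 - t) * G z < 0" using \<open>G z < 0\<close> t0 by (intro mult_pos_neg) auto
      then show ?thesis using z by linarith
    qed
  qed
qed

lemma second_derivative_local_min_nonneg:
  fixes F G :: "real \<Rightarrow> real"
  assumes F: "\<forall>\<^sub>F t in nhds 0. (F has_real_derivative G t) (at t)"
    and G: "(G has_real_derivative c) (at 0)"
    and mn: "\<forall>\<^sub>F t in nhds 0. F 0 \<le> F t"
  shows "0 \<le> c"
proof (rule ccontr)
  assume "\<not> 0 \<le> c"
  then have c: "- c > 0" by auto
  have "(F has_real_derivative G 0) (at 0)" using F by (rule eventually_nhds_x_imp_x)
  obtain d where d: "d > 0" "\<And>t. \<bar>t\<bar> < d \<Longrightarrow> F 0 \<le> F t"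
    using mn by (auto simp: eventually_nhds_metric dist_real_def)
  have G0: "G 0 = 0"
    by (rule DERIV_local_min[OF \<open>(F has_real_derivative G 0) (at 0)\<close> d(1)]) (use d(2) in auto)
  obtain \<delta> where \<delta>: "\<delta> > 0" "\<And>t. t \<noteq> 0 \<Longrightarrow> \<bar>t\<bar> < \<delta> \<Longrightarrow> - F 0 < - F t"
  proof (rule second_derivative_strict_local_min[where F = "\<lambda>t. - F t" and G = "\<lambda>t. - G t" and c = "- c"])
    show "\<forall>\<^sub>F t in nhds 0. ((\<lambda>t. - F t) has_real_derivative - G t) (at t)"
      using F by eventually_elim (auto intro: DERIV_minus)
    show "((\<lambda>t. - G t) has_real_derivative - c) (at 0)" using G by (auto intro: DERIV_minus)
  qed (use G0 c in auto)
  define s where "s = min \<delta> d / 2"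
  have "0 < s" "s < \<delta>" "s < d" using \<delta>(1) d(1) by (auto simp: s_def)
  with \<delta>(2)[of s] d(2)[of s] show False by auto
qed

lemma eventually_line_in_open:
  fixes x :: "'a::real_normed_vector"
  assumes "open S" "x \<in> S"
  shows "\<forall>\<^sub>F t in nhds (0::real). x + t *\<^sub>R e \<in> S"
proof -
  have "((\<lambda>t. x + t *\<^sub>R e) \<longlongrightarrow> x + 0 *\<^sub>R e) (nhds (0::real))"
    by (intro tendsto_intros filterlim_ident)
  then show ?thesis using assms by (auto dest: topological_tendstoD)
qed

lemma saddle_on_line:
  assumes sad: "saddle_on \<theta> S u g H" and "open S" "x \<in> S"
  shows "\<forall>\<^sub>F t in nhds 0. ((\<lambda>t. u (x + t *\<^sub>R e)) has_real_derivative g (x + t *\<^sub>R e) \<bullet> e) (at t)"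
    and "((\<lambda>t. g (x + t *\<^sub>R e) \<bullet> e) has_real_derivative e \<bullet> (H x *v e)) (at 0)"
proof -
  show "\<forall>\<^sub>F t in nhds 0. ((\<lambda>t. u (x + t *\<^sub>R e)) has_real_derivative g (x + t *\<^sub>R e) \<bullet> e) (at t)"
    using eventually_line_in_open[OF assms(2,3)]
    by eventually_elim (intro has_real_derivative_along_line saddle_onD(1)[OF sad])
  show "((\<lambda>t. g (x + t *\<^sub>R e) \<bullet> e) has_real_derivative e \<bullet> (H x *v e)) (at 0)"
    by (rule has_real_derivative_gradient_along_line) (use saddle_onD(2)[OF sad \<open>x \<in> S\<close>] in simp)
qed

text \<open>Adding a small multiple of \<open>|y - x|^2\<close> to \<open>u\<close> keeps the
  maximum off the frontier. At an interior maximum every second directional derivative of the sum is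
  at most 0, whereas an elliptic Hessian has a direction in which its form is nonnegative.\<close>

lemma saddle_on_max_principle:
  fixes u :: "real ^ 'n \<Rightarrow> real"
  assumes sad: "saddle_on \<theta> S u g H" and C: "open C" "bounded C" "closure C \<subseteq> S"
    and fr: "\<And>x. x \<in> frontier C \<Longrightarrow> u x \<le> M" and "x \<in> C"
  shows "u x \<le> M"
proof (rule ccontr)
  assume "\<not> u x \<le> M"
  then have ux: "u x > M" by simp
  obtain B where B: "B > 0" "\<And>y. y \<in> closure C \<Longrightarrow> norm (y - x) \<le> B"
  proof -
    have "bounded ((\<lambda>y. y - x) ` closure C)" using C(2) by (intro bounded_translation_minus bounded_closure)
    then obtain B where "B > 0" "\<forall>z\<in>(\<lambda>y. y - x) ` closure C. norm z \<le> B" using bounded_pos by blast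
    then show ?thesis using that by auto
  qed
  \<comment> \<open>The perturbation adds at most \<open>(u x - M) / 2\<close> on the closure, too
    little to lift the frontier values up to \<open>u x\<close>.\<close>
  define \<epsilon> where "\<epsilon> = (u x - M) / (2 * B\<^sup>2)"
  have e: "\<epsilon> > 0" using ux B by (auto simp: \<epsilon>_def)
  have eB: "\<epsilon> * B\<^sup>2 < u x - M" using ux B by (simp add: \<epsilon>_def)
  define v where "v = (\<lambda>y. u y + \<epsilon> * ((y - x) \<bullet> (y - x)))"
  have cont: "continuous_on (closure C) v"
    unfolding v_def
    by (intro continuous_intros continuous_on_subset[OF saddle_on_continuous[OF sad] C(3)])
  have "compact (closure C)" using C(2) by simp
  have xcl: "x \<in> closure C" using closure_subset \<open>x \<in> C\<close> by (rule subsetD)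
  obtain z where z: "z \<in> closure C" "\<And>y. y \<in> closure C \<Longrightarrow> v y \<le> v z"
    using continuous_attains_sup[OF \<open>compact (closure C)\<close> _ cont] \<open>x \<in> C\<close> by auto
  have vx: "v x = u x" by (simp add: v_def)
  have "z \<notin> frontier C"
  proof
    assume zf: "z \<in> frontier C"
    have "(z - x) \<bullet> (z - x) \<le> B\<^sup>2" using power_mono[OF B(2)[OF z(1)], of 2] by (simp add: power2_norm_eq_inner)
    then have "v z \<le> M + \<epsilon> * B\<^sup>2" unfolding v_def using fr[OF zf] e by (simp add: add_mono)
    then have "v z < v x" using eB vx by linarith
    then show False using z(2)[OF xcl] by simp
  qed
  then have zC: "z \<in> C" using z(1) C(1) by (simp add: frontier_def interior_open)
  have CS: "C \<subseteq> S" using C(3) closure_subset[of C] by (rule order_trans[rotated])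
  have zS: "z \<in> S" using CS zC by (rule subsetD)
  have sadC: "saddle_on \<theta> C u g H" using sad CS by (rule saddle_on_subset)
  \<comment> \<open>The second clause of ellipticity, tested with \<open>e = \<xi>\<close> itself,
    says that \<open>1 + \<theta>\<close> times the form at \<open>\<xi>\<close> is
    nonnegative.\<close>
  obtain \<xi> where xi: "norm \<xi> = 1" "- \<theta> * (\<xi> \<bullet> (H z *v \<xi>)) \<le> \<xi> \<bullet> (H z *v \<xi>)"
    using saddle_onD(3)[OF sad zS] by (auto simp: elliptic_matrix_def)
  have q: "\<xi> \<bullet> (H z *v \<xi>) \<ge> 0"
  proof -
    have "0 \<le> (1 + \<theta>) * (\<xi> \<bullet> (H z *v \<xi>))" using xi(2) by (simp add: algebra_simps)
    then show ?thesis using saddle_on_pos[OF sad] by (simp add: zero_le_mult_iff)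
  qed
  have "0 \<le> - (\<xi> \<bullet> (H z *v \<xi>) + 2 * \<epsilon>)"
  proof (rule second_derivative_local_min_nonneg)
    show "\<forall>\<^sub>F t in nhds 0. ((\<lambda>t. - v (z + t *\<^sub>R \<xi>)) has_real_derivative
       - (g (z + t *\<^sub>R \<xi>) \<bullet> \<xi> + \<epsilon> * (2 * ((z - x) \<bullet> \<xi>) + 2 * t))) (at t)"
      using saddle_on_line(1)[OF sadC C(1) zC, of \<xi>]
    proof eventually_elim
      case (elim t)
      have sq: "(w + t *\<^sub>R \<xi>) \<bullet> (w + t *\<^sub>R \<xi>) = w \<bullet> w + 2 * t * (w \<bullet> \<xi>) + t\<^sup>2" for w t
        using xi(1)
        by (simp add: inner_add_left inner_add_right inner_commute[of \<xi> w] norm_eq_1 power2_eq_square distrib_left)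
      have "z + t *\<^sub>R \<xi> - x = (z - x) + t *\<^sub>R \<xi>" for t by simp
      then have vv: "v (z + t *\<^sub>R \<xi>) = u (z + t *\<^sub>R \<xi>) + \<epsilon> * ((z - x) \<bullet> (z - x) + 2 * t * ((z - x) \<bullet> \<xi>) + t\<^sup>2)" for t
        unfolding v_def by (simp only: sq)
      show ?case unfolding vv
        by (rule derivative_eq_intros elim refl)+ (simp add: algebra_simps)
    qed
    show "((\<lambda>t. - (g (z + t *\<^sub>R \<xi>) \<bullet> \<xi> + \<epsilon> * (2 * ((z - x) \<bullet> \<xi>) + 2 * t))) has_real_derivative
       - (\<xi> \<bullet> (H z *v \<xi>) + 2 * \<epsilon>)) (at 0)"
      by (rule derivative_eq_intros saddle_on_line(2)[OF sadC C(1) zC] refl)+ simp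
    show "\<forall>\<^sub>F t in nhds 0. - v (z + 0 *\<^sub>R \<xi>) \<le> - v (z + t *\<^sub>R \<xi>)"
      using eventually_line_in_open[OF C(1) zC, of \<xi>]
      by eventually_elim (use z(2) subsetD[OF closure_subset, of _ C] in auto)
  qed
  then show False using q e by linarith
qed

section \<open>From the curvature equation to an indefinite Hessian\<close>

text \<open>A value strictly between \<open>h a\<close> and \<open>h b\<close> is attained for a last time, where the derivative
  cannot be negative. So these values lie in the image of the null set \<open>N\<close>.\<close>

lemma nonincreasing_of_AE_derivative_neg:
  fixes h :: "real \<Rightarrow> real"
  assumes lip: "L-lipschitz_on {a..b} h" and "a \<le> b"
    and neg: "negligible N" "\<And>t. t \<in> {a..b} - N \<Longrightarrow> \<exists>D<0. (h has_real_derivative D) (at t within {a..})"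
  shows "h b \<le> h a"
proof (rule ccontr)
  assume "\<not> h b \<le> h a"
  then have hab: "h a < h b" by simp
  have cont: "continuous_on {a..b} h" using lip by (rule lipschitz_on_continuous_on)
  have "{h a<..<h b} \<subseteq> h ` (N \<inter> {a..b})"
  proof
    fix y assume y: "y \<in> {h a<..<h b}"
    define A where "A = {a..b} \<inter> h -` {..y}"
    have "closed A" unfolding A_def by (intro continuous_closed_preimage cont) auto
    then have "compact A" unfolding A_def by (metis bounded_Int bounded_closed_interval compact_eq_bounded_closed)
    moreover have "a \<in> A" using y \<open>a \<le> b\<close> by (auto simp: A_def)
    ultimately obtain x where x: "x \<in> A" "\<And>t. t \<in> A \<Longrightarrow> t \<le> x"
      using compact_attains_sup[of A] by auto
    have xb: "x < b" using x(1) y by (cases "x = b") (auto simp: A_def)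
    have after: "y < h t" if "x < t" "t \<le> b" for t
      using x(2)[of t] x(1) that by (force simp: A_def)
    have hx: "h x = y"
    proof (rule antisym)
      show "h x \<le> y" using x(1) by (simp add: A_def)
      show "y \<le> h x"
      proof (rule tendsto_lowerbound)
        show "(h \<longlongrightarrow> h x) (at x within {x<..b})"
          using cont x(1) by (force simp: continuous_on_def A_def intro: tendsto_within_subset)
        show "\<forall>\<^sub>F t in at x within {x<..b}. y \<le> h t"
          using after by (auto simp: eventually_at_filter less_imp_le)
        show "at x within {x<..b} \<noteq> bot" using xb by (simp add: at_within_eq_bot_iff)
      qed
    qed
    have "x \<in> N"
    proof (rule ccontr)
      assume "x \<notin> N"
      then obtain D where D: "D < 0" "(h has_real_derivative D) (at x within {a..})"
        using neg(2)[of x] x(1) by (auto simp: A_def)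
      obtain d where d: "d > 0" "\<And>e. 0 < e \<Longrightarrow> x + e \<in> {a..} \<Longrightarrow> e < d \<Longrightarrow> h (x + e) < h x"
        using has_real_derivative_neg_dec_right[OF D(2,1)] by blast
      define e where "e = min d (b - x) / 2"
      have "0 < e" "e < d" "x + e \<le> b" "x < x + e" using d(1) xb by (auto simp: e_def min_def field_simps)
      then show False using d(2)[of e] after[of "x + e"] hx x(1) by (auto simp: A_def)
    qed
    then show "y \<in> h ` (N \<inter> {a..b})" using hx x(1) by (auto simp: A_def)
  qed
  moreover have "negligible (h ` (N \<inter> {a..b}))"
  proof (rule negligible_locally_Lipschitz_image)
    show "negligible (N \<inter> {a..b})" using neg(1) by (rule negligible_subset) auto
    fix x assume "x \<in> N \<inter> {a..b}"
    then show "\<exists>T B. open T \<and> x \<in> T \<and> (\<forall>y\<in>N \<inter> {a..b} \<inter> T. norm (h y - h x) \<le> B * norm (y - x))"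
      using lipschitz_onD[OF lip] by (intro exI[of _ UNIV] exI[of _ L]) (auto simp: dist_norm)
  qed simp
  ultimately have "negligible {h a<..<h b}" by (rule negligible_subset[rotated])
  then show False using hab by (simp add: negligible_interval(2)[of "h a" "h b", simplified])
qed

text \<open>The monotonicity lemma asks for a strictly negative derivative, so it is applied to
  \<open>f s + c * s\<close> with \<open>c < \<Lambda>\<close> and to \<open>- f s + c * s\<close>
  with \<open>c < - (1 / \<Lambda>)\<close>; the extreme slopes follow in the limit.\<close>

lemma weingarten_bounds:
  fixes f :: "real \<Rightarrow> real"
  assumes "0 < \<Lambda>" and lip: "locally_lipschitz_on {0..} f" and "f 0 = 0"
    and der: "AE t in lebesgue. 0 \<le> t \<longrightarrow>
           (\<exists>D. (f has_real_derivative D) (at t within {0..}) \<and> - (1 / \<Lambda>) \<le> D \<and> D \<le> - \<Lambda>)"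
    and "0 \<le> t"
  shows "f t \<le> - \<Lambda> * t" "- (1 / \<Lambda>) * t \<le> f t"
proof -
  obtain N where N: "N \<in> null_sets lebesgue"
      "\<And>t. t \<notin> N \<Longrightarrow> 0 \<le> t \<Longrightarrow>
        \<exists>D. (f has_real_derivative D) (at t within {0..}) \<and> - (1 / \<Lambda>) \<le> D \<and> D \<le> - \<Lambda>"
    using AE_E3[OF der] by (auto simp: space_completion)
  have neg: "negligible N" using N(1) by (simp add: negligible_iff_null_sets)
  obtain L where L: "L-lipschitz_on {0..t} f"
    using lip[unfolded locally_lipschitz_on_def, rule_format, of "{0..t}"] by auto
  have lin: "\<bar>c\<bar>-lipschitz_on {0..t} (\<lambda>s. c * s)" for c :: real
    by (rule lipschitz_onI) (auto simp: dist_real_def abs_mult right_diff_distrib[symmetric])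
  have lipf: "(L + \<bar>c\<bar>)-lipschitz_on {0..t} (\<lambda>s. f s + c * s)" for c
    using lipschitz_on_add[OF L lin[of c]] .
  have lipf2: "(L + \<bar>c\<bar>)-lipschitz_on {0..t} (\<lambda>s. - f s + c * s)" for c
    using lipschitz_on_add[OF lipschitz_on_minus[OF L] lin[of c]] .
  have up: "f t + c * t \<le> 0" if "c < \<Lambda>" for c
  proof -
    have "f t + c * t \<le> f 0 + c * 0"
    proof (rule nonincreasing_of_AE_derivative_neg[OF lipf \<open>0 \<le> t\<close> neg])
      fix s assume "s \<in> {0..t} - N"
      then obtain D where D: "(f has_real_derivative D) (at s within {0..})" "D \<le> - \<Lambda>"
        using N(2)[of s] by auto
      have "((\<lambda>s. f s + c * s) has_real_derivative D + c) (at s within {0..})"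
        by (rule derivative_eq_intros D(1) refl)+ simp
      then show "\<exists>D<0. ((\<lambda>s. f s + c * s) has_real_derivative D) (at s within {0..})"
        using D(2) that by (intro exI[of _ "D + c"]) auto
    qed
    then show ?thesis using \<open>f 0 = 0\<close> by simp
  qed
  have lo: "- f t + c * t \<le> 0" if "c < - (1 / \<Lambda>)" for c
  proof -
    have "- f t + c * t \<le> - f 0 + c * 0"
    proof (rule nonincreasing_of_AE_derivative_neg[OF lipf2 \<open>0 \<le> t\<close> neg])
      fix s assume "s \<in> {0..t} - N"
      then obtain D where D: "(f has_real_derivative D) (at s within {0..})" "- (1 / \<Lambda>) \<le> D"
        using N(2)[of s] by auto
      have "((\<lambda>s. - f s + c * s) has_real_derivative - D + c) (at s within {0..})"
        by (rule derivative_eq_intros D(1) refl)+ simp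
      then show "\<exists>D<0. ((\<lambda>s. - f s + c * s) has_real_derivative D) (at s within {0..})"
        using D(2) that by (intro exI[of _ "- D + c"]) auto
    qed
    then show ?thesis using \<open>f 0 = 0\<close> by simp
  qed
  have lim: "c * t \<le> M" if "\<And>c'. c' < c \<Longrightarrow> c' * t \<le> M" for c M :: real
  proof (rule tendsto_upperbound)
    show "((\<lambda>c'. c' * t) \<longlongrightarrow> c * t) (at_left c)" by (intro tendsto_intros)
    show "\<forall>\<^sub>F c' in at_left c. c' * t \<le> M" using that by (auto simp: eventually_at_filter)
  qed simp
  show "f t \<le> - \<Lambda> * t" using lim[of \<Lambda> "- f t"] up by force
  show "- (1 / \<Lambda>) * t \<le> f t" using lim[of "- (1 / \<Lambda>)" "f t"] lo by force
qed

text \<open>The second difference \<open>\<Delta>\<close> is symmetric in \<open>a\<close> and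
  \<open>b\<close>. Divided by \<open>t^2\<close> it tends to \<open>a \<bullet> (A *v b)\<close>:
  the mean value theorem in the direction \<open>a\<close> leaves a difference of two gradients,
  which differentiability of \<open>g\<close> at \<open>x\<close> evaluates.\<close>

lemma second_derivative_symmetric:
  fixes u :: "real ^ 'n \<Rightarrow> real" and g :: "real ^ 'n \<Rightarrow> real ^ 'n"
  assumes "open S" "x \<in> S"
    and u: "\<And>y. y \<in> S \<Longrightarrow> (u has_derivative (\<lambda>h. g y \<bullet> h)) (at y)"
    and g: "(g has_derivative (\<lambda>h. A *v h)) (at x)"
  shows "a \<bullet> (A *v b) = b \<bullet> (A *v a)"
proof -
  define \<Delta> where "\<Delta> a b t = u (x + t *\<^sub>R a + t *\<^sub>R b) - u (x + t *\<^sub>R a) - u (x + t *\<^sub>R b) + u x" for a b t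
  have sym: "\<Delta> a b t = \<Delta> b a t" for a b t by (simp add: \<Delta>_def algebra_simps)
  obtain r where r: "r > 0" "ball x r \<subseteq> S" using assms(1,2) openE by blast
  have key: "((\<lambda>t. \<Delta> a b t / t\<^sup>2) \<longlongrightarrow> a \<bullet> (A *v b)) (at_right 0)" for a b
  proof (rule tendstoI)
    fix \<epsilon> :: real assume "\<epsilon> > 0"
    define K where "K = norm a + norm b + 1"
    have K: "K > 0" "norm a \<le> K" "norm b \<le> K" "norm a + norm b \<le> K" by (auto simp: K_def add_nonneg_pos)
    \<comment> \<open>Two remainders of size at most \<open>\<eta> * (t * K)\<close>, paired with
      \<open>a\<close> and divided by \<open>t\<close>, give at most
      \<open>2 * \<eta> * K^2 = \<epsilon> / 2\<close>.\<close>
    define \<eta> where "\<eta> = \<epsilon> / (4 * K\<^sup>2)"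
    have "\<eta> > 0" using \<open>\<epsilon> > 0\<close> K by (simp add: \<eta>_def)
    obtain d where d: "d > 0" "\<And>y. norm (y - x) < d \<Longrightarrow> norm (g y - g x - A *v (y - x)) \<le> \<eta> * norm (y - x)"
      using g \<open>\<eta> > 0\<close> unfolding has_derivative_at_alt by blast
    have est: "norm (g (x + k) - g x - A *v k) \<le> \<eta> * norm k" if "norm k < d" for k
      using d(2)[of "x + k"] that by simp
    have main: "dist (\<Delta> a b t / t\<^sup>2) (a \<bullet> (A *v b)) < \<epsilon>" if t: "0 < t" "t * K < r" "t * K < d" for t
    proof -
      define F where "F s = u (x + t *\<^sub>R b + s *\<^sub>R a) - u (x + s *\<^sub>R a)" for s
      have nb: "norm (t *\<^sub>R b + s *\<^sub>R a) \<le> t * K" "norm (s *\<^sub>R a) \<le> t * K" if "0 \<le> s" "s \<le> t" for s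
      proof -
        have "s * norm a \<le> t * norm a" using that by (intro mult_right_mono) auto
        moreover have "norm (t *\<^sub>R b + s *\<^sub>R a) \<le> t * norm b + s * norm a"
          using norm_triangle_ineq[of "t *\<^sub>R b" "s *\<^sub>R a"] that t by simp
        moreover have "t * norm b + t * norm a \<le> t * K" using K(4) t(1) by (simp flip: distrib_left)
        moreover have "t * norm b \<ge> 0" using t by simp
        ultimately show "norm (t *\<^sub>R b + s *\<^sub>R a) \<le> t * K" "norm (s *\<^sub>R a) \<le> t * K"
          using that(1) unfolding norm_scaleR by linarith+
      qed
      have inS: "x + t *\<^sub>R b + s *\<^sub>R a \<in> S" "x + s *\<^sub>R a \<in> S" if "0 \<le> s" "s \<le> t" for s
        using nb[OF that] t(2) r(2) by (auto simp: subset_iff dist_norm add.assoc norm_minus_commute)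
      have "\<exists>z. 0 < z \<and> z < t \<and> F t - F 0 = (t - 0) * (g (x + t *\<^sub>R b + z *\<^sub>R a) \<bullet> a - g (x + z *\<^sub>R a) \<bullet> a)"
        unfolding F_def
        by (intro MVT2[OF t(1)] DERIV_diff has_real_derivative_along_line u inS) auto
      then obtain z where z: "0 < z" "z < t"
          "F t - F 0 = t * (g (x + t *\<^sub>R b + z *\<^sub>R a) \<bullet> a - g (x + z *\<^sub>R a) \<bullet> a)" by auto
      define e1 where "e1 = g (x + (t *\<^sub>R b + z *\<^sub>R a)) - g x - A *v (t *\<^sub>R b + z *\<^sub>R a)"
      define e2 where "e2 = g (x + z *\<^sub>R a) - g x - A *v (z *\<^sub>R a)"
      have e1: "norm e1 \<le> \<eta> * (t * K)" unfolding e1_def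
        using est[of "t *\<^sub>R b + z *\<^sub>R a"] nb(1)[of z] z t \<open>\<eta> > 0\<close>
        by (auto intro: order_trans mult_left_mono)
      have e2: "norm e2 \<le> \<eta> * (t * K)" unfolding e2_def
        using est[of "z *\<^sub>R a"] nb(2)[of z] z t \<open>\<eta> > 0\<close>
        by (auto intro: order_trans mult_left_mono)
      have "\<Delta> a b t = F t - F 0" by (simp add: \<Delta>_def F_def algebra_simps)
      also have "\<dots> = t * ((t *\<^sub>R (A *v b) + (e1 - e2)) \<bullet> a)"
        unfolding z(3) e1_def e2_def
        by (simp add: matrix_vector_right_distrib matrix_vector_mult_scaleR inner_diff_left inner_add_left add.assoc)
      also have "\<dots> = t\<^sup>2 * (a \<bullet> (A *v b)) + t * ((e1 - e2) \<bullet> a)"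
        by (simp add: inner_add_left distrib_left power2_eq_square inner_commute[of _ a] inner_add_right)
      finally have "\<Delta> a b t / t\<^sup>2 - a \<bullet> (A *v b) = ((e1 - e2) \<bullet> a) / t"
        using t(1) by (simp add: field_simps power2_eq_square)
      moreover have "\<bar>(e1 - e2) \<bullet> a\<bar> \<le> (2 * (\<eta> * (t * K))) * K"
      proof -
        have "\<bar>(e1 - e2) \<bullet> a\<bar> \<le> norm (e1 - e2) * norm a" by (rule Cauchy_Schwarz_ineq2)
        also have "\<dots> \<le> (2 * (\<eta> * (t * K))) * K"
          using e1 e2 norm_triangle_ineq4[of e1 e2] K t \<open>\<eta> > 0\<close> by (intro mult_mono) auto
        finally show ?thesis .
      qed
      then have "\<bar>((e1 - e2) \<bullet> a) / t\<bar> \<le> 2 * \<eta> * K\<^sup>2"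
        using t(1) by (simp add: abs_divide field_simps power2_eq_square)
      moreover have "2 * \<eta> * K\<^sup>2 < \<epsilon>" using K \<open>\<epsilon> > 0\<close> by (simp add: \<eta>_def)
      ultimately show ?thesis by (simp add: dist_real_def)
    qed
    have "\<forall>\<^sub>F t in at_right 0. t < min r d / K" 
      using r(1) d(1) K(1) by (auto simp: eventually_at_right_field intro!: exI[of _ "min r d / K"])
    then show "\<forall>\<^sub>F t in at_right 0. dist (\<Delta> a b t / t\<^sup>2) (a \<bullet> (A *v b)) < \<epsilon>"
      using eventually_at_right_less[of 0]
    proof eventually_elim
      case (elim t)
      then have "t * K < min r d" using K(1) by (simp add: pos_less_divide_eq)
      then show ?case using main elim by simp
    qed
  qed
  show ?thesis
    using tendsto_unique[OF _ key[of a b]] key[of b a] by (simp add: sym[of a b])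
qed

text \<open>The expression in \<open>tr\<close> is, up to the positive factor
  \<open>1 + p1^2 + p2^2\<close>, the trace of the form \<open>m\<close> relative to the metric
  \<open>I + p p^T\<close>, written with the cofactor matrix. A singular symmetric form has at most
  one nonzero eigenvalue, and its sign is that of this trace.\<close>

lemma singular_form_nonneg:
  fixes m11 m12 m22 p1 p2 :: real
  assumes det: "m11 * m22 = m12\<^sup>2"
    and tr: "0 \<le> (1 + p2\<^sup>2) * m11 - 2 * p1 * p2 * m12 + (1 + p1\<^sup>2) * m22"
  shows "0 \<le> m11 * x\<^sup>2 + 2 * m12 * x * y + m22 * y\<^sup>2"
    and "\<exists>x y. x\<^sup>2 + y\<^sup>2 = 1 \<and> m11 * x\<^sup>2 + 2 * m12 * x * y + m22 * y\<^sup>2 = 0"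
proof -
  let ?T = "(1 + p2\<^sup>2) * m11 - 2 * p1 * p2 * m12 + (1 + p1\<^sup>2) * m22"
  \<comment> \<open>Meant for a diagonal entry \<open>m\<close>: by \<open>det\<close>, the product
    \<open>m * ?T\<close> is \<open>m^2\<close> plus squares, which a negative \<open>m\<close>
    would contradict.\<close>
  have pos: "0 \<le> m" if "m\<^sup>2 \<le> m * ?T" for m
  proof (rule ccontr)
    assume "\<not> 0 \<le> m"
    then have "m < 0" by simp
    then have "m * ?T \<le> 0" "0 < m\<^sup>2" using tr by (auto intro: mult_nonpos_nonneg)
    then show False using that by linarith
  qed
  have "m11 * ?T = (1 + p2\<^sup>2) * m11\<^sup>2 - 2 * p1 * p2 * m12 * m11 + (1 + p1\<^sup>2) * (m11 * m22)"
    by (simp add: power2_eq_square algebra_simps)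
  also have "\<dots> = m11\<^sup>2 + m12\<^sup>2 + (p2 * m11 - p1 * m12)\<^sup>2"
    unfolding det by (simp add: power2_eq_square algebra_simps)
  finally have m11: "m11 \<ge> 0" by (intro pos) simp
  have "m22 * ?T = (1 + p2\<^sup>2) * (m11 * m22) - 2 * p1 * p2 * m12 * m22 + (1 + p1\<^sup>2) * m22\<^sup>2"
    by (simp add: power2_eq_square algebra_simps)
  also have "\<dots> = m22\<^sup>2 + m12\<^sup>2 + (p2 * m12 - p1 * m22)\<^sup>2"
    unfolding det by (simp add: power2_eq_square algebra_simps)
  finally have m22: "m22 \<ge> 0" by (intro pos) simp
  show "0 \<le> m11 * x\<^sup>2 + 2 * m12 * x * y + m22 * y\<^sup>2"
  proof (cases "m11 = 0")
    case True
    then show ?thesis using det m22 by simp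
  next
    case False
    have "m11 * (m11 * x\<^sup>2 + 2 * m12 * x * y + m22 * y\<^sup>2) = m11\<^sup>2 * x\<^sup>2 + 2 * m11 * m12 * x * y + (m11 * m22) * y\<^sup>2"
      by (simp add: power2_eq_square algebra_simps)
    also have "\<dots> = (m11 * x + m12 * y)\<^sup>2"
      unfolding det by (simp add: power2_eq_square algebra_simps)
    finally have "0 \<le> m11 * (m11 * x\<^sup>2 + 2 * m12 * x * y + m22 * y\<^sup>2)" by simp
    then show ?thesis using False m11 by (simp add: zero_le_mult_iff)
  qed
  show "\<exists>x y. x\<^sup>2 + y\<^sup>2 = 1 \<and> m11 * x\<^sup>2 + 2 * m12 * x * y + m22 * y\<^sup>2 = 0"
  proof (cases "m11 = 0")
    case True
    then show ?thesis using det by (intro exI[of _ 1] exI[of _ 0]) simp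
  next
    case False
    \<comment> \<open>The null vector is \<open>(- m12, m11)\<close>, normalised by
      \<open>n\<close>.\<close>
    define n where "n = sqrt (m11\<^sup>2 + m12\<^sup>2)"
    have n: "n\<^sup>2 = m11\<^sup>2 + m12\<^sup>2" "n > 0" using False by (auto simp: n_def add_pos_nonneg)
    have "m11 * (- m12 / n)\<^sup>2 + 2 * m12 * (- m12 / n) * (m11 / n) + m22 * (m11 / n)\<^sup>2
       = m11 * (m11 * m22 - m12\<^sup>2) / n\<^sup>2"
      using n(2) by (simp add: field_simps power2_eq_square)
    then have "m11 * (- m12 / n)\<^sup>2 + 2 * m12 * (- m12 / n) * (m11 / n) + m22 * (m11 / n)\<^sup>2 = 0"
      using det by simp
    moreover have "(- m12 / n)\<^sup>2 + (m11 / n)\<^sup>2 = (m11\<^sup>2 + m12\<^sup>2) / n\<^sup>2"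
      by (simp add: power_divide add_divide_distrib)
    then have "(- m12 / n)\<^sup>2 + (m11 / n)\<^sup>2 = 1" using n by (metis divide_self less_numeral_extra(3) zero_less_power)
    ultimately show ?thesis by blast
  qed
qed

lemma quadratic_form_2:
  fixes H :: "real ^ 2 ^ 2"
  shows "e \<bullet> (H *v e) = H $ 1 $ 1 * (e $ 1)\<^sup>2 + (H $ 1 $ 2 + H $ 2 $ 1) * (e $ 1) * (e $ 2) + H $ 2 $ 2 * (e $ 2)\<^sup>2"
  by (simp add: inner_vec_def matrix_vector_mult_def sum_2 power2_eq_square algebra_simps)

lemma norm_2_eq_1_iff: "norm (e :: real ^ 2) = 1 \<longleftrightarrow> (e $ 1)\<^sup>2 + (e $ 2)\<^sup>2 = 1"
  by (simp add: norm_vec_def L2_set_def sum_2)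

text \<open>Here \<open>k1\<close> and \<open>k2\<close> are the principal curvatures multiplied by \<open>W = sqrt (1 + |p|\<^sup>2)\<close>, that is, the
  eigenvalues of the Hessian relative to the first fundamental form \<open>I + p p\<^sup>T\<close>, whose
  determinant is \<open>W\<^sup>2\<close>.\<close>

lemma elliptic_matrix_of_curvatures:
  fixes H :: "real ^ 2 ^ 2" and p1 p2 :: real
  assumes sym: "H $ 1 $ 2 = H $ 2 $ 1"
    and small: "p1\<^sup>2 + p2\<^sup>2 \<le> 1" and "k2 \<le> k1" and "0 < \<Lambda>"
    and tr: "(1 + p2\<^sup>2) * H $ 1 $ 1 - 2 * p1 * p2 * H $ 1 $ 2 + (1 + p1\<^sup>2) * H $ 2 $ 2 = (k1 + k2) * (1 + p1\<^sup>2 + p2\<^sup>2)"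
    and det: "H $ 1 $ 1 * H $ 2 $ 2 - (H $ 1 $ 2)\<^sup>2 = k1 * k2 * (1 + p1\<^sup>2 + p2\<^sup>2)"
    and k: "0 \<le> k1" "k2 \<le> - \<Lambda> * k1" "- \<Lambda> * k2 \<le> k1"
  shows "elliptic_matrix (\<Lambda> / 2) H"
proof -
  \<comment> \<open>\<open>G\<close> is the first fundamental form. Slope at most 1 keeps it between
    1 and 2 on unit vectors, and this ratio is the loss from \<open>\<Lambda>\<close> to
    \<open>\<Lambda> / 2\<close>.\<close>
  define G where "G e = (e $ 1)\<^sup>2 + (e $ 2)\<^sup>2 + (p1 * e $ 1 + p2 * e $ 2)\<^sup>2" for e :: "real ^ 2"
  have G1: "1 \<le> G e" "G e \<le> 2" if "norm e = 1" for e
  proof -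
    have e: "(e $ 1)\<^sup>2 + (e $ 2)\<^sup>2 = 1" using that by (simp add: norm_2_eq_1_iff)
    then show "1 \<le> G e" by (simp add: G_def)
    have "(p1 * e $ 1 + p2 * e $ 2)\<^sup>2 \<le> (p1 * e $ 1 + p2 * e $ 2)\<^sup>2 + (p1 * e $ 2 - p2 * e $ 1)\<^sup>2"
      by simp
    also have "\<dots> = (p1\<^sup>2 + p2\<^sup>2) * ((e $ 1)\<^sup>2 + (e $ 2)\<^sup>2)"
      by (simp add: power2_eq_square algebra_simps)
    also have "\<dots> = p1\<^sup>2 + p2\<^sup>2" using e by simp
    finally have "(p1 * e $ 1 + p2 * e $ 2)\<^sup>2 \<le> p1\<^sup>2 + p2\<^sup>2" .
    then show "G e \<le> 2" using e small by (simp add: G_def)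
  qed
  have k2: "k2 \<le> 0" using k(2) mult_nonneg_nonneg[OF less_imp_le[OF \<open>0 < \<Lambda>\<close>] k(1)] by linarith
  let ?a = "H $ 1 $ 1" and ?b = "H $ 1 $ 2" and ?c = "H $ 2 $ 2"
  \<comment> \<open>\<open>k1\<close> and \<open>k2\<close> are the eigenvalues of \<open>H\<close>
    relative to \<open>G\<close>, so \<open>H - k2 G\<close> and \<open>k1 G - H\<close> are
    singular. Their relative trace is \<open>k1 - k2 \<ge> 0\<close>, hence both are positive
    semidefinite with a null vector.\<close>
  have d1: "(?a - k2 * (1 + p1\<^sup>2)) * (?c - k2 * (1 + p2\<^sup>2)) = (?b - k2 * (p1 * p2))\<^sup>2"
    using tr det by algebra
  have d2: "(k1 * (1 + p1\<^sup>2) - ?a) * (k1 * (1 + p2\<^sup>2) - ?c) = (k1 * (p1 * p2) - ?b)\<^sup>2"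
    using tr det by algebra
  have "(1 + p2\<^sup>2) * (?a - k2 * (1 + p1\<^sup>2)) - 2 * p1 * p2 * (?b - k2 * (p1 * p2)) + (1 + p1\<^sup>2) * (?c - k2 * (1 + p2\<^sup>2))
      = (k1 - k2) * (1 + p1\<^sup>2 + p2\<^sup>2)"
    using tr by algebra
  then have t1: "0 \<le> (1 + p2\<^sup>2) * (?a - k2 * (1 + p1\<^sup>2)) - 2 * p1 * p2 * (?b - k2 * (p1 * p2)) + (1 + p1\<^sup>2) * (?c - k2 * (1 + p2\<^sup>2))"
    using \<open>k2 \<le> k1\<close> by simp
  have "(1 + p2\<^sup>2) * (k1 * (1 + p1\<^sup>2) - ?a) - 2 * p1 * p2 * (k1 * (p1 * p2) - ?b) + (1 + p1\<^sup>2) * (k1 * (1 + p2\<^sup>2) - ?c)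
      = (k1 - k2) * (1 + p1\<^sup>2 + p2\<^sup>2)"
    using tr by algebra
  then have t2: "0 \<le> (1 + p2\<^sup>2) * (k1 * (1 + p1\<^sup>2) - ?a) - 2 * p1 * p2 * (k1 * (p1 * p2) - ?b) + (1 + p1\<^sup>2) * (k1 * (1 + p2\<^sup>2) - ?c)"
    using \<open>k2 \<le> k1\<close> by simp
  have f1: "e \<bullet> (H *v e) - k2 * G e = (?a - k2 * (1 + p1\<^sup>2)) * (e $ 1)\<^sup>2
      + 2 * (?b - k2 * (p1 * p2)) * (e $ 1) * (e $ 2) + (?c - k2 * (1 + p2\<^sup>2)) * (e $ 2)\<^sup>2" for e
    unfolding quadratic_form_2 G_def sym[symmetric] by (simp add: power2_eq_square algebra_simps)
  have f2: "k1 * G e - e \<bullet> (H *v e) = (k1 * (1 + p1\<^sup>2) - ?a) * (e $ 1)\<^sup>2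
      + 2 * (k1 * (p1 * p2) - ?b) * (e $ 1) * (e $ 2) + (k1 * (1 + p2\<^sup>2) - ?c) * (e $ 2)\<^sup>2" for e
    unfolding quadratic_form_2 G_def sym[symmetric] by (simp add: power2_eq_square algebra_simps)
  have lower: "k2 * G e \<le> e \<bullet> (H *v e)" for e
    using singular_form_nonneg(1)[OF d1 t1, of "e $ 1" "e $ 2"] f1[of e] by simp
  have upper: "e \<bullet> (H *v e) \<le> k1 * G e" for e
    using singular_form_nonneg(1)[OF d2 t2, of "e $ 1" "e $ 2"] f2[of e] by simp
  obtain x y where xy: "x\<^sup>2 + y\<^sup>2 = 1"
      "(?a - k2 * (1 + p1\<^sup>2)) * x\<^sup>2 + 2 * (?b - k2 * (p1 * p2)) * x * y + (?c - k2 * (1 + p2\<^sup>2)) * y\<^sup>2 = 0"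
    using singular_form_nonneg(2)[OF d1 t1] by blast
  define \<xi> :: "real ^ 2" where "\<xi> = vector [x, y]"
  have xi: "norm \<xi> = 1" "\<xi> \<bullet> (H *v \<xi>) = k2 * G \<xi>"
    using xy f1[of \<xi>] by (auto simp: \<xi>_def norm_2_eq_1_iff)
  obtain x' y' where xy': "x'\<^sup>2 + y'\<^sup>2 = 1"
      "(k1 * (1 + p1\<^sup>2) - ?a) * x'\<^sup>2 + 2 * (k1 * (p1 * p2) - ?b) * x' * y' + (k1 * (1 + p2\<^sup>2) - ?c) * y'\<^sup>2 = 0"
    using singular_form_nonneg(2)[OF d2 t2] by blast
  define \<xi>' :: "real ^ 2" where "\<xi>' = vector [x', y']"
  have xi': "norm \<xi>' = 1" "\<xi>' \<bullet> (H *v \<xi>') = k1 * G \<xi>'"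
    using xy' f2[of \<xi>'] by (auto simp: \<xi>'_def norm_2_eq_1_iff)
  have "\<xi> \<bullet> (H *v \<xi>) \<le> - (\<Lambda> / 2) * (e \<bullet> (H *v e))" if e: "norm e = 1" for e
  proof -
    have "\<xi> \<bullet> (H *v \<xi>) \<le> k2 * 1"
      unfolding xi(2) using G1(1)[OF xi(1)] k2 by (intro mult_left_mono_neg) auto
    moreover have "e \<bullet> (H *v e) \<le> k1 * 2"
      using upper[of e] mult_left_mono[OF G1(2)[OF e] k(1)] by simp
    then have "\<Lambda> / 2 * (e \<bullet> (H *v e)) \<le> \<Lambda> / 2 * (k1 * 2)" using \<open>0 < \<Lambda>\<close> by (intro mult_left_mono) auto
    ultimately show ?thesis using k(2) by simp
  qed
  moreover have "- (\<Lambda> / 2) * (e \<bullet> (H *v e)) \<le> \<xi>' \<bullet> (H *v \<xi>')" if e: "norm e = 1" for e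
  proof -
    have "k1 * 1 \<le> \<xi>' \<bullet> (H *v \<xi>')"
      unfolding xi'(2) using G1(1)[OF xi'(1)] k(1) by (intro mult_left_mono) auto
    moreover have "k2 * 2 \<le> e \<bullet> (H *v e)"
      using lower[of e] mult_left_mono_neg[OF G1(2)[OF e] k2] by simp
    then have "\<Lambda> / 2 * (k2 * 2) \<le> \<Lambda> / 2 * (e \<bullet> (H *v e))" using \<open>0 < \<Lambda>\<close> by (intro mult_left_mono) auto
    ultimately show ?thesis using k(3) by simp
  qed
  ultimately show ?thesis unfolding elliptic_matrix_def using xi(1) xi'(1) by blast
qed

lemma has_derivative_vec_components:
  fixes g :: "'a::real_normed_vector \<Rightarrow> real ^ 'n"
  assumes "\<And>i. ((\<lambda>x. g x $ i) has_derivative (\<lambda>h. g' h $ i)) (at x)"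
  shows "(g has_derivative g') (at x)"
proof -
  have "((\<lambda>x. g x \<bullet> b) has_derivative (\<lambda>h. g' h \<bullet> b)) (at x)" if "b \<in> Basis" for b
    using that assms by (auto simp: Basis_vec_def inner_axis)
  then show ?thesis using has_derivative_componentwise_within[of g g' x UNIV] by simp
qed

lemma C2_on_has_derivatives:
  fixes u :: "real ^ 'n \<Rightarrow> real"
  assumes "C2_on S u" and x: "x \<in> interior S"
  shows "(u has_derivative (\<lambda>h. gradient_within S u x \<bullet> h)) (at x)"
    and "(gradient_within S u has_derivative (\<lambda>h. hessian_within S u x *v h)) (at x)"
proof -
  have at: "at x within S = at x" using x by (rule at_within_interior)
  have xS: "x \<in> S" using x interior_subset by blast
  have fd: "(f has_derivative (\<lambda>h. \<Sum>i\<in>UNIV. partial_within S i f x * h $ i)) (at x)"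
    if "f differentiable_on S" for f :: "real ^ 'n \<Rightarrow> real"
  proof -
    have D: "(f has_derivative frechet_derivative f (at x)) (at x)"
      using that xS at by (auto simp: differentiable_on_def frechet_derivative_works[symmetric])
    then interpret linear "frechet_derivative f (at x)" by (rule has_derivative_linear)
    have "frechet_derivative f (at x) h = (\<Sum>i\<in>UNIV. partial_within S i f x * h $ i)" for h
    proof -
      have "frechet_derivative f (at x) h = frechet_derivative f (at x) (\<Sum>i\<in>UNIV. h $ i *\<^sub>R axis i 1)"
        using basis_expansion[of h] by (simp add: scalar_mult_eq_scaleR)
      also have "\<dots> = (\<Sum>i\<in>UNIV. partial_within S i f x * h $ i)"
        by (simp add: sum scale partial_within_def at mult.commute)
      finally show ?thesis .
    qed
    then show ?thesis using D by (metis (no_types, lifting) ext)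
  qed
  show "(u has_derivative (\<lambda>h. gradient_within S u x \<bullet> h)) (at x)"
    using fd[of u] assms(1) by (simp add: C2_on_def gradient_within_def inner_vec_def)
  show "(gradient_within S u has_derivative (\<lambda>h. hessian_within S u x *v h)) (at x)"
  proof (rule has_derivative_vec_components)
    fix i
    show "((\<lambda>x. gradient_within S u x $ i) has_derivative (\<lambda>h. (hessian_within S u x *v h) $ i)) (at x)"
      using fd[of "partial_within S i u"] assms(1)
      by (simp add: C2_on_def gradient_within_def hessian_within_def matrix_vector_mult_def)
  qed
qed

section \<open>Crossing paths in the plane\<close>

text \<open>\<open>fashoda\<close> concerns paths inside a box with ends on its sides, whereas here
  \<open>f\<close> may overshoot to the left and right, and \<open>g\<close> below and above. The
  clamps \<open>X\<close> and \<open>Y\<close> bring them back into the box.\<close>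

lemma crossing_paths_meet:
  fixes f g :: "real \<Rightarrow> real ^ 2"
  assumes "path f" "path g" "a \<le> b" "c \<le> d"
    and f2: "\<And>x. x \<in> path_image f \<Longrightarrow> c < x $ 2 \<and> x $ 2 < d"
    and g1: "\<And>x. x \<in> path_image g \<Longrightarrow> a < x $ 1 \<and> x $ 1 < b"
    and ends: "pathstart f $ 1 \<le> a" "b \<le> pathfinish f $ 1" "pathstart g $ 2 \<le> c" "d \<le> pathfinish g $ 2"
  obtains z where "z \<in> path_image f" "z \<in> path_image g"
proof -
  define X :: "real ^ 2 \<Rightarrow> real ^ 2" where "X x = (\<chi> i. if i = 1 then max a (min b (x $ 1)) else x $ 2)" for x
  define Y :: "real ^ 2 \<Rightarrow> real ^ 2" where "Y x = (\<chi> i. if i = 1 then x $ 1 else max c (min d (x $ 2)))" for x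
  have X: "X x $ 1 = max a (min b (x $ 1))" "X x $ 2 = x $ 2"
    and Y: "Y x $ 1 = x $ 1" "Y x $ 2 = max c (min d (x $ 2))" for x by (auto simp: X_def Y_def)
  have cX: "continuous_on UNIV X"
  proof (subst continuous_on_componentwise, intro ballI)
    fix b' :: "real ^ 2" assume "b' \<in> Basis"
    then obtain i where "b' = axis i 1" by (auto simp: Basis_vec_def)
    then show "continuous_on UNIV (\<lambda>x. X x \<bullet> b')"
      by (cases "i = 1") (auto simp: inner_axis X_def intro!: continuous_intros)
  qed
  have cY: "continuous_on UNIV Y"
  proof (subst continuous_on_componentwise, intro ballI)
    fix b' :: "real ^ 2" assume "b' \<in> Basis"
    then obtain i where "b' = axis i 1" by (auto simp: Basis_vec_def)
    then show "continuous_on UNIV (\<lambda>x. Y x \<bullet> b')"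
      by (cases "i = 1") (auto simp: inner_axis Y_def intro!: continuous_intros)
  qed
  have sub: "path_image (X \<circ> f) \<subseteq> cbox (vector [a, c]) (vector [b, d])"
    "path_image (Y \<circ> g) \<subseteq> cbox (vector [a, c]) (vector [b, d])"
    using f2 g1 assms(3,4)
    by (auto simp: path_image_compose mem_box_cart forall_2 X Y less_imp_le)
  obtain z where z: "z \<in> path_image (X \<circ> f)" "z \<in> path_image (Y \<circ> g)"
  proof (rule fashoda[OF _ _ sub])
    show "path (X \<circ> f)" "path (Y \<circ> g)"
      using assms(1,2) cX cY by (auto intro!: path_continuous_image intro: continuous_on_subset)
    show "pathstart (X \<circ> f) $ 1 = (vector [a, c] :: real ^ 2) $ 1"
      "pathfinish (X \<circ> f) $ 1 = (vector [b, d] :: real ^ 2) $ 1"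
      "pathstart (Y \<circ> g) $ 2 = (vector [a, c] :: real ^ 2) $ 2"
      "pathfinish (Y \<circ> g) $ 2 = (vector [b, d] :: real ^ 2) $ 2"
      using ends assms(3,4) by (auto simp: pathstart_compose pathfinish_compose X Y)
  qed
  then obtain x y where x: "x \<in> path_image f" "z = X x" and y: "y \<in> path_image g" "z = Y y"
    by (auto simp: path_image_compose)
  have "max a (min b (x $ 1)) = y $ 1" "x $ 2 = max c (min d (y $ 2))"
    using x y X[of x] Y[of y] by metis+
  \<comment> \<open>The strict bounds \<open>f2\<close> and \<open>g1\<close> exclude that the
    common point was created by clamping.\<close>
  then have "x $ 1 = y $ 1" "x $ 2 = y $ 2" using f2[OF x(1)] g1[OF y(1)] by auto
  then have "x = y" by (simp add: vec_eq_iff forall_2)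
  then show ?thesis using that x(1) y(1) by blast
qed

text \<open>Coordinates of \<open>x\<close> in the basis \<open>e1\<close>, \<open>e2\<close> of the plane, by Cramer's rule.\<close>

definition plane_coords :: "real ^ 2 \<Rightarrow> real ^ 2 \<Rightarrow> real ^ 2 \<Rightarrow> real ^ 2" where
  "plane_coords e1 e2 x =
     (1 / (e1 $ 1 * e2 $ 2 - e1 $ 2 * e2 $ 1)) *\<^sub>R
       vector [x $ 1 * e2 $ 2 - x $ 2 * e2 $ 1, e1 $ 1 * x $ 2 - e1 $ 2 * x $ 1]"

lemma linear_plane_coords: "linear (plane_coords e1 e2)"
proof (rule linearI)
  define A :: "real ^ 2 \<Rightarrow> real ^ 2"
    where "A x = vector [x $ 1 * e2 $ 2 - x $ 2 * e2 $ 1, e1 $ 1 * x $ 2 - e1 $ 2 * x $ 1]" for x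
  have pc: "plane_coords e1 e2 x = (1 / (e1 $ 1 * e2 $ 2 - e1 $ 2 * e2 $ 1)) *\<^sub>R A x" for x
    by (simp add: plane_coords_def A_def)
  have "A (x + y) = A x + A y" "A (c *\<^sub>R x) = c *\<^sub>R A x" for x y c
    by (simp_all add: A_def vec_eq_iff forall_2 algebra_simps)
  then show "plane_coords e1 e2 (x + y) = plane_coords e1 e2 x + plane_coords e1 e2 y"
    "plane_coords e1 e2 (c *\<^sub>R x) = c *\<^sub>R plane_coords e1 e2 x" for x y c
    by (simp_all add: pc scaleR_add_right)
qed

lemma plane_coords_basis:
  assumes "e1 $ 1 * e2 $ 2 - e1 $ 2 * e2 $ 1 \<noteq> 0"
  shows "plane_coords e1 e2 e1 = vector [1, 0]" "plane_coords e1 e2 e2 = vector [0, 1]"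
  using assms unfolding plane_coords_def vec_eq_iff forall_2 by (simp_all add: mult.commute)

lemma plane_coords_expand:
  assumes "e1 $ 1 * e2 $ 2 - e1 $ 2 * e2 $ 1 \<noteq> 0" (is "?D \<noteq> 0")
  shows "x = plane_coords e1 e2 x $ 1 *\<^sub>R e1 + plane_coords e1 e2 x $ 2 *\<^sub>R e2"
proof -
  have "plane_coords e1 e2 x $ 1 * e1 $ i + plane_coords e1 e2 x $ 2 * e2 $ i
      = ((x $ 1 * e2 $ 2 - x $ 2 * e2 $ 1) * e1 $ i + (e1 $ 1 * x $ 2 - e1 $ 2 * x $ 1) * e2 $ i) / ?D" for i
    by (simp add: plane_coords_def add_divide_distrib)
  moreover have "(x $ 1 * e2 $ 2 - x $ 2 * e2 $ 1) * e1 $ 1 + (e1 $ 1 * x $ 2 - e1 $ 2 * x $ 1) * e2 $ 1 = x $ 1 * ?D"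
    "(x $ 1 * e2 $ 2 - x $ 2 * e2 $ 1) * e1 $ 2 + (e1 $ 1 * x $ 2 - e1 $ 2 * x $ 1) * e2 $ 2 = x $ 2 * ?D"
    by (simp_all add: algebra_simps)
  ultimately show ?thesis using assms by (simp add: vec_eq_iff forall_2)
qed

lemma inj_plane_coords:
  assumes "e1 $ 1 * e2 $ 2 - e1 $ 2 * e2 $ 1 \<noteq> 0" "plane_coords e1 e2 x = plane_coords e1 e2 y"
  shows "x = y"
proof -
  have "x = plane_coords e1 e2 y $ 1 *\<^sub>R e1 + plane_coords e1 e2 y $ 2 *\<^sub>R e2"
    using plane_coords_expand[OF assms(1), of x] unfolding assms(2) .
  also have "\<dots> = y" by (rule plane_coords_expand[OF assms(1), symmetric])
  finally show ?thesis .
qed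

text \<open>An inversion in \<open>p\<close> turns the two crossing loops into two paths that join opposite
  sides of a square.\<close>

lemma crossing_loops_meet:
  fixes p e1 e2 :: "real ^ 2"
  assumes indep: "e1 $ 1 * e2 $ 2 - e1 $ 2 * e2 $ 1 \<noteq> 0" and "0 < \<delta>"
    and e1: "\<And>t. t \<noteq> 0 \<Longrightarrow> \<bar>t\<bar> \<le> \<delta> \<Longrightarrow> p + t *\<^sub>R e1 \<in> A"
    and e2: "\<And>t. t \<noteq> 0 \<Longrightarrow> \<bar>t\<bar> \<le> \<delta> \<Longrightarrow> p + t *\<^sub>R e2 \<in> B"
    and "p \<notin> A" "p \<notin> B"
    and pcA: "path_component A (p - \<delta> *\<^sub>R e1) (p + \<delta> *\<^sub>R e1)"
    and pcB: "path_component B (p - \<delta> *\<^sub>R e2) (p + \<delta> *\<^sub>R e2)"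
  shows "A \<inter> B \<noteq> {}"
proof -
  define L where "L x = plane_coords e1 e2 (x - p)" for x
  have cL: "continuous_on T L" for T
    unfolding L_def by (intro linear_continuous_on_compose[OF _ linear_plane_coords] continuous_intros)
  have Linj: "x = y" if "L x = L y" for x y
    using inj_plane_coords[OF indep, of "x - p" "y - p"] that by (simp add: L_def)
  have L0: "L x \<noteq> 0" if "x \<noteq> p" for x
    using Linj[of x p] that linear_0[OF linear_plane_coords] by (auto simp: L_def)
  have Le1: "L (p + t *\<^sub>R e1) = t *\<^sub>R vector [1, 0]" and Le2: "L (p + t *\<^sub>R e2) = t *\<^sub>R vector [0, 1]" for t
    by (simp_all add: L_def linear_cmul[OF linear_plane_coords] plane_coords_basis[OF indep])
  have n1: "norm (vector [1, 0] :: real ^ 2) = 1" "norm (vector [0, 1] :: real ^ 2) = 1"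
    by (simp_all add: norm_2_eq_1_iff)
  obtain P where P: "path P" "path_image P \<subseteq> A" "pathstart P = p - \<delta> *\<^sub>R e1" "pathfinish P = p + \<delta> *\<^sub>R e1"
    using pcA by (auto simp: path_component_def)
  obtain Q where Q: "path Q" "path_image Q \<subseteq> B" "pathstart Q = p - \<delta> *\<^sub>R e2" "pathfinish Q = p + \<delta> *\<^sub>R e2"
    using pcB by (auto simp: path_component_def)
  have cpt: "compact (path_image P \<union> path_image Q)" using P(1) Q(1) by (simp add: compact_Un compact_path_image)
  have ne: "path_image P \<union> path_image Q \<noteq> {}" by simp
  obtain w where w: "w \<in> path_image P \<union> path_image Q" "\<And>x. x \<in> path_image P \<union> path_image Q \<Longrightarrow> norm (L w) \<le> norm (L x)"
    using continuous_attains_inf[OF cpt ne continuous_on_norm[OF cL]] by blast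
  have "w \<noteq> p" using w(1) P(2) Q(2) assms(5,6) by blast
  then have "norm (L w) > 0" using L0 by simp
  define \<eta> where "\<eta> = min (norm (L w)) \<delta>"
  have \<eta>: "0 < \<eta>" "\<eta> \<le> \<delta>" "\<eta> \<le> norm (L w)" using \<open>norm (L w) > 0\<close> \<open>0 < \<delta>\<close> by (auto simp: \<eta>_def)
  have seg: "\<exists>t. x = p + t *\<^sub>R e \<and> \<eta> \<le> \<bar>t\<bar> \<and> \<bar>t\<bar> \<le> \<delta>"
    if "x \<in> closed_segment (p - \<eta> *\<^sub>R e) (p - \<delta> *\<^sub>R e) \<or> x \<in> closed_segment (p + \<delta> *\<^sub>R e) (p + \<eta> *\<^sub>R e)" for x e
    using that
  proof
    assume "x \<in> closed_segment (p - \<eta> *\<^sub>R e) (p - \<delta> *\<^sub>R e)"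
    then obtain s where s: "0 \<le> s" "s \<le> 1" "x = (1 - s) *\<^sub>R (p - \<eta> *\<^sub>R e) + s *\<^sub>R (p - \<delta> *\<^sub>R e)"
      by (auto simp: in_segment)
    define t where "t = \<eta> + s * (\<delta> - \<eta>)"
    have "x = p + (- t) *\<^sub>R e" unfolding s(3) t_def by (simp add: algebra_simps)
    moreover have "\<eta> \<le> t" "t \<le> \<delta>"
      using s(1) \<eta>(2) mult_right_mono[OF s(2), of "\<delta> - \<eta>"] by (auto simp: t_def)
    ultimately show ?thesis using \<eta>(1) by (intro exI[of _ "- t"]) auto
  next
    assume "x \<in> closed_segment (p + \<delta> *\<^sub>R e) (p + \<eta> *\<^sub>R e)"
    then have "x \<in> closed_segment (p + \<eta> *\<^sub>R e) (p + \<delta> *\<^sub>R e)" by (simp add: closed_segment_commute)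
    then obtain s where s: "0 \<le> s" "s \<le> 1" "x = (1 - s) *\<^sub>R (p + \<eta> *\<^sub>R e) + s *\<^sub>R (p + \<delta> *\<^sub>R e)"
      by (auto simp: in_segment)
    define t where "t = \<eta> + s * (\<delta> - \<eta>)"
    have "x = p + t *\<^sub>R e" unfolding s(3) t_def by (simp add: algebra_simps)
    moreover have "\<eta> \<le> t" "t \<le> \<delta>"
      using s(1) \<eta>(2) mult_right_mono[OF s(2), of "\<delta> - \<eta>"] by (auto simp: t_def)
    ultimately show ?thesis using \<eta>(1) by (intro exI[of _ t]) auto
  qed
  \<comment> \<open>The loops are cut open at \<open>p\<close>: out along the straight line from
    parameter \<open>- \<eta>\<close> to \<open>- \<delta>\<close>, then the given path, then back
    in to \<open>\<eta>\<close>. No point comes closer to \<open>p\<close> than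
    \<open>\<eta>\<close> in the coordinates \<open>L\<close>.\<close>
  define F where "F = linepath (p - \<eta> *\<^sub>R e1) (p - \<delta> *\<^sub>R e1) +++ P +++ linepath (p + \<delta> *\<^sub>R e1) (p + \<eta> *\<^sub>R e1)"
  define G where "G = linepath (p - \<eta> *\<^sub>R e2) (p - \<delta> *\<^sub>R e2) +++ Q +++ linepath (p + \<delta> *\<^sub>R e2) (p + \<eta> *\<^sub>R e2)"
  have paths: "path F" "path G" using P Q by (auto simp: F_def G_def)
  have Fim: "x \<in> A \<and> \<eta> \<le> norm (L x)" if x: "x \<in> path_image F" for x
  proof -
    consider "x \<in> path_image P" | "x \<in> closed_segment (p - \<eta> *\<^sub>R e1) (p - \<delta> *\<^sub>R e1) \<or> x \<in> closed_segment (p + \<delta> *\<^sub>R e1) (p + \<eta> *\<^sub>R e1)"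
      using x P by (auto simp: F_def path_image_join)
    then show ?thesis
    proof cases
      case 1
      then show ?thesis using P(2) w(2)[of x] \<eta>(3) by auto
    next
      case 2
      then obtain t where t: "x = p + t *\<^sub>R e1" "\<eta> \<le> \<bar>t\<bar>" "\<bar>t\<bar> \<le> \<delta>" using seg by blast
      then show ?thesis using e1[of t] \<eta>(1) Le1[of t] n1(1) by auto
    qed
  qed
  have Gim: "x \<in> B \<and> \<eta> \<le> norm (L x)" if x: "x \<in> path_image G" for x
  proof -
    consider "x \<in> path_image Q" | "x \<in> closed_segment (p - \<eta> *\<^sub>R e2) (p - \<delta> *\<^sub>R e2) \<or> x \<in> closed_segment (p + \<delta> *\<^sub>R e2) (p + \<eta> *\<^sub>R e2)"
      using x Q by (auto simp: G_def path_image_join)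
    then show ?thesis
    proof cases
      case 1
      then show ?thesis using Q(2) w(2)[of x] \<eta>(3) by auto
    next
      case 2
      then obtain t where t: "x = p + t *\<^sub>R e2" "\<eta> \<le> \<bar>t\<bar>" "\<bar>t\<bar> \<le> \<delta>" using seg by blast
      then show ?thesis using e2[of t] \<eta>(1) Le2[of t] n1(2) by auto
    qed
  qed
  \<comment> \<open>Inversion in the unit circle of these coordinates. The cut ends go to the
    midpoints of the sides of the square of half width \<open>1 / \<eta>\<close>, and all other
    points stay in that square.\<close>
  define \<Phi> where "\<Phi> x = (1 / (norm (L x))\<^sup>2) *\<^sub>R L x" for x
  have nPhi: "norm (\<Phi> x) = 1 / norm (L x)" for x
    by (simp add: \<Phi>_def power2_eq_square)
  have cPhi: "continuous_on T \<Phi>" if "\<And>x. x \<in> T \<Longrightarrow> \<eta> \<le> norm (L x)" for T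
    unfolding \<Phi>_def using that \<eta>(1) by (intro continuous_intros cL) fastforce
  have box: "\<Phi> x \<in> cbox (vector [- (1 / \<eta>), - (1 / \<eta>)]) (vector [1 / \<eta>, 1 / \<eta>])" if "\<eta> \<le> norm (L x)" for x
  proof -
    have "\<bar>\<Phi> x $ i\<bar> \<le> 1 / \<eta>" for i
      using component_le_norm_cart[of "\<Phi> x" i] nPhi[of x] frac_le[of 1 1 \<eta> "norm (L x)"] that \<eta>(1) by simp
    then show ?thesis by (simp add: mem_box_cart forall_2 abs_le_iff minus_le_iff)
  qed
  have comp: "\<Phi> (p + t *\<^sub>R e1) = (1 / t) *\<^sub>R vector [1, 0]" "\<Phi> (p + t *\<^sub>R e2) = (1 / t) *\<^sub>R vector [0, 1]" for t
    by (simp_all add: \<Phi>_def Le1 Le2 n1 power2_eq_square divide_simps)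
  have F01: "pathstart F = p + (- \<eta>) *\<^sub>R e1" "pathfinish F = p + \<eta> *\<^sub>R e1"
    and G01: "pathstart G = p + (- \<eta>) *\<^sub>R e2" "pathfinish G = p + \<eta> *\<^sub>R e2"
    by (simp_all add: F_def G_def)
  obtain z where z: "z \<in> path_image (\<Phi> \<circ> F)" "z \<in> path_image (\<Phi> \<circ> G)"
  proof (rule fashoda)
    show "path (\<Phi> \<circ> F)" "path (\<Phi> \<circ> G)"
      using paths Fim Gim by (auto intro!: path_continuous_image cPhi)
    show "path_image (\<Phi> \<circ> F) \<subseteq> cbox (vector [- (1 / \<eta>), - (1 / \<eta>)]) (vector [1 / \<eta>, 1 / \<eta>])"
      "path_image (\<Phi> \<circ> G) \<subseteq> cbox (vector [- (1 / \<eta>), - (1 / \<eta>)]) (vector [1 / \<eta>, 1 / \<eta>])"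
      using box Fim Gim by (auto simp: path_image_compose simp del: mem_box_cart)
    show "pathstart (\<Phi> \<circ> F) $ 1 = (vector [- (1 / \<eta>), - (1 / \<eta>)] :: real ^ 2) $ 1"
      "pathfinish (\<Phi> \<circ> F) $ 1 = (vector [1 / \<eta>, 1 / \<eta>] :: real ^ 2) $ 1"
      "pathstart (\<Phi> \<circ> G) $ 2 = (vector [- (1 / \<eta>), - (1 / \<eta>)] :: real ^ 2) $ 2"
      "pathfinish (\<Phi> \<circ> G) $ 2 = (vector [1 / \<eta>, 1 / \<eta>] :: real ^ 2) $ 2"
      unfolding pathstart_compose pathfinish_compose F01 G01 comp by simp_all
  qed
  then obtain x y where x: "x \<in> path_image F" "z = \<Phi> x" and y: "y \<in> path_image G" "z = \<Phi> y"
    by (auto simp: path_image_compose)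
  have "1 / norm (L x) = 1 / norm (L y)" using nPhi[of x] nPhi[of y] x(2) y(2) by simp
  then have "norm (L x) = norm (L y)" by simp
  moreover have "norm (L x) > 0" using Fim[OF x(1)] \<eta>(1) by linarith
  moreover have "\<Phi> x = \<Phi> y" using x(2) y(2) by (rule trans[OF sym])
  ultimately have "L x = L y" unfolding \<Phi>_def by (simp only: scaleR_cancel_left) simp
  then have "x = y" by (rule Linj)
  then show ?thesis using Fim[OF x(1)] Gim[OF y(1)] by blast
qed

section \<open>One-sided boundedness\<close>

lemma sublinear_of_gradient_tendsto_0:
  fixes u :: "'a::euclidean_space \<Rightarrow> real"
  assumes u: "\<And>x. R \<le> norm x \<Longrightarrow> (u has_derivative (\<lambda>h. g x \<bullet> h)) (at x)"
    and g: "(g \<longlongrightarrow> 0) at_infinity" and "0 < \<epsilon>"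
  obtains r where "0 < r" "\<And>x. r \<le> norm x \<Longrightarrow> \<bar>u x\<bar> \<le> \<epsilon> * norm x"
proof -
  have "\<forall>\<^sub>F x in at_infinity. norm (g x) < \<epsilon> / 2"
    using tendstoD[OF g, of "\<epsilon> / 2"] \<open>0 < \<epsilon>\<close> by simp
  then obtain r0 where r0: "\<And>x. r0 \<le> norm x \<Longrightarrow> norm (g x) < \<epsilon> / 2"
    by (auto simp: eventually_at_infinity)
  define r1 where "r1 = max 1 (max r0 R)"
  have r1: "0 < r1" "r0 \<le> r1" "R \<le> r1" by (auto simp: r1_def)
  have "continuous_on (sphere 0 r1) u"
    using r1(3) by (intro continuous_at_imp_continuous_on ballI has_derivative_continuous[OF u]) auto
  then have "bounded (u ` sphere 0 r1)" by (intro compact_imp_bounded compact_continuous_image compact_sphere)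
  then obtain B where B: "0 < B" "\<And>x. norm x = r1 \<Longrightarrow> \<bar>u x\<bar> \<le> B"
    by (auto simp: bounded_pos)
  \<comment> \<open>Beyond \<open>2 * B / \<epsilon>\<close> the values on the sphere of radius
    \<open>r1\<close> use up at most half of \<open>\<epsilon> * norm x\<close>; the slope bound
    \<open>\<epsilon> / 2\<close> takes the other half.\<close>
  define r where "r = max (r1 + 1) (2 * B / \<epsilon>)"
  show ?thesis
  proof (rule that[of r])
    show "0 < r" using r1(1) by (auto simp: r_def)
    fix x :: 'a assume x: "r \<le> norm x"
    then have nx: "r1 < norm x" "2 * B / \<epsilon> \<le> norm x" by (auto simp: r_def)
    define \<omega> where "\<omega> = (1 / norm x) *\<^sub>R x"
    have om: "norm \<omega> = 1" "x = norm x *\<^sub>R \<omega>" using nx r1(1) by (auto simp: \<omega>_def)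
    have "\<exists>z. r1 < z \<and> z < norm x \<and> u (0 + norm x *\<^sub>R \<omega>) - u (0 + r1 *\<^sub>R \<omega>) = (norm x - r1) * (g (0 + z *\<^sub>R \<omega>) \<bullet> \<omega>)"
      using nx(1) r1 om(1) by (intro MVT2 has_real_derivative_along_line u) auto
    then obtain z where z: "r1 < z" "u x - u (r1 *\<^sub>R \<omega>) = (norm x - r1) * (g (z *\<^sub>R \<omega>) \<bullet> \<omega>)"
      using om(2) by auto
    have "\<bar>g (z *\<^sub>R \<omega>) \<bullet> \<omega>\<bar> \<le> norm (g (z *\<^sub>R \<omega>)) * norm \<omega>" by (rule Cauchy_Schwarz_ineq2)
    also have "\<dots> \<le> \<epsilon> / 2" using r0[of "z *\<^sub>R \<omega>"] om(1) z(1) r1 by simp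
    finally have "\<bar>u x - u (r1 *\<^sub>R \<omega>)\<bar> \<le> (norm x - r1) * (\<epsilon> / 2)"
      unfolding z(2) abs_mult using nx by (intro mult_mono) auto
    moreover have "(norm x - r1) * (\<epsilon> / 2) \<le> norm x * (\<epsilon> / 2)" using r1(1) \<open>0 < \<epsilon>\<close> by (intro mult_right_mono) auto
    moreover have "\<bar>u (r1 *\<^sub>R \<omega>)\<bar> \<le> B" using B(2)[of "r1 *\<^sub>R \<omega>"] om(1) r1(1) by simp
    moreover have "B \<le> norm x * (\<epsilon> / 2)" using nx(2) \<open>0 < \<epsilon>\<close> by (simp add: field_simps)
    moreover have "\<epsilon> * norm x = 2 * (norm x * (\<epsilon> / 2))" by simp
    ultimately show "\<bar>u x\<bar> \<le> \<epsilon> * norm x" by linarith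
  qed
qed

text \<open>Far out \<open>u - a \<bullet> x\<close> is increasing in the direction \<open>- a\<close>, so that every
  unbounded component reaches the region where \<open>- a \<bullet> x\<close> dominates.\<close>

lemma unbounded_superlevel_components_agree:
  fixes u :: "'a::euclidean_space \<Rightarrow> real"
  assumes u: "\<And>x. R \<le> norm x \<Longrightarrow> (u has_derivative (\<lambda>h. g x \<bullet> h)) (at x)"
    and g: "(g \<longlongrightarrow> 0) at_infinity" and "a \<noteq> 0"
    and S: "S = {x. R < norm x \<and> c < u x - a \<bullet> x}"
    and x: "\<not> bounded (connected_component_set S x)"
    and y: "\<not> bounded (connected_component_set S y)"
  shows "connected_component S x y"
proof -
  define \<alpha> where "\<alpha> = norm a"
  have \<alpha>: "\<alpha> > 0" "a \<bullet> a = \<alpha>\<^sup>2" using \<open>a \<noteq> 0\<close> by (auto simp: \<alpha>_def power2_norm_eq_inner)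
  define v where "v x = u x - a \<bullet> x" for x
  obtain r0 where r0: "0 < r0" "\<And>x. r0 \<le> norm x \<Longrightarrow> \<bar>u x\<bar> \<le> \<alpha> / 4 * norm x"
  proof (rule sublinear_of_gradient_tendsto_0[of R u g "\<alpha> / 4"])
    show "(u has_derivative (\<bullet>) (g x)) (at x)" if "R \<le> norm x" for x using that by (rule u)
  qed (use g \<alpha>(1) in auto)
  have "\<forall>\<^sub>F x in at_infinity. norm (g x) < \<alpha> / 2"
    using tendstoD[OF g, of "\<alpha> / 2"] \<alpha>(1) by simp
  then obtain r1 where r1: "\<And>x. r1 \<le> norm x \<Longrightarrow> norm (g x) < \<alpha> / 2"
    by (auto simp: eventually_at_infinity)
  define r where "r = max r0 (max r1 (max R (4 * \<bar>c\<bar> / \<alpha>))) + 1"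
  have r: "0 < r" "r0 \<le> r" "r1 \<le> r" "R < r" "4 * \<bar>c\<bar> / \<alpha> \<le> r" using r0(1) by (auto simp: r_def)
  have far: "\<exists>x'. connected_component S x x' \<and> 2 * r < norm x'"
    if "\<not> bounded (connected_component_set S x)" for x
  proof (rule ccontr)
    assume "\<not> ?thesis"
    then have "norm x' \<le> 2 * r" if "x' \<in> connected_component_set S x" for x' using that by force
    then have "bounded (connected_component_set S x)" by (rule boundedI)
    then show False using \<open>\<not> bounded (connected_component_set S x)\<close> by contradiction
  qed
  have ray: "r < norm (x - t *\<^sub>R a) \<and> connected_component S x (x - t *\<^sub>R a)"
    if x: "x \<in> S" "2 * r < norm x" and "0 \<le> t" for x t
  proof -
    have "\<alpha> / 4 * norm x \<ge> \<bar>c\<bar>"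
    proof -
      have "4 * \<bar>c\<bar> / \<alpha> \<le> norm x" using r x(2) by linarith
      then show ?thesis using \<alpha>(1) by (simp add: field_simps)
    qed
    moreover have "\<bar>u x\<bar> \<le> \<alpha> / 4 * norm x" using r0(2) r x(2) by simp
    moreover have "a \<bullet> x < u x - c" using x(1) S by auto
    ultimately have ax: "a \<bullet> x \<le> \<alpha> / 2 * norm x" by linarith
    \<comment> \<open>By \<open>ax\<close> the angle between \<open>x\<close> and \<open>a\<close>
      is at least 60 degrees, so the half-line from \<open>x\<close> along \<open>- a\<close> keeps
      at least distance \<open>sqrt 3 / 2 * norm x\<close> from the origin.\<close>
    have nr: "r < norm (x - s *\<^sub>R a)" if "0 \<le> s" for s
    proof -
      have "r\<^sup>2 < (3 / 4) * (norm x)\<^sup>2"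
      proof -
        have "(2 * r)\<^sup>2 < (norm x)\<^sup>2" using x(2) r(1) by (intro power_strict_mono) auto
        then have "4 * r\<^sup>2 < (norm x)\<^sup>2" by (simp add: power_mult_distrib)
        then show ?thesis using zero_le_power2[of "norm x"] by linarith
      qed
      also have "\<dots> \<le> (norm x)\<^sup>2 - s * \<alpha> * norm x + s\<^sup>2 * \<alpha>\<^sup>2"
      proof -
        have "0 \<le> (norm x / 2 - s * \<alpha>)\<^sup>2" by simp
        then show ?thesis by (simp add: power2_eq_square algebra_simps)
      qed
      also have "\<dots> \<le> (norm x)\<^sup>2 - 2 * s * (a \<bullet> x) + s\<^sup>2 * \<alpha>\<^sup>2"
        using mult_left_mono[OF ax that] by (simp add: algebra_simps)
      also have "\<dots> = (norm (x - s *\<^sub>R a))\<^sup>2"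
        unfolding power2_norm_eq_inner \<alpha>(2)[symmetric]
        by (simp add: inner_diff_left inner_diff_right inner_commute[of x a] power2_eq_square algebra_simps)
      finally show ?thesis by (rule power2_less_imp_less) simp
    qed
    have mono: "v x \<le> v (x - s *\<^sub>R a)" if "0 \<le> s" for s
    proof -
      have pos: "0 \<le> (g (x + t *\<^sub>R (- a)) - a) \<bullet> (- a)" if "0 \<le> t" for t
      proof -
        have "\<bar>g (x - t *\<^sub>R a) \<bullet> a\<bar> \<le> norm (g (x - t *\<^sub>R a)) * norm a" by (rule Cauchy_Schwarz_ineq2)
        also have "\<dots> \<le> \<alpha> / 2 * \<alpha>" using r1[of "x - t *\<^sub>R a"] nr[OF that] r by (intro mult_mono) (auto simp: \<alpha>_def)
        finally show ?thesis
          using \<alpha> zero_le_power2[of \<alpha>] by (simp add: inner_diff_left power2_eq_square)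
      qed
      have dv: "((\<lambda>t. v (x + t *\<^sub>R (- a))) has_real_derivative (g (x + t *\<^sub>R (- a)) - a) \<bullet> (- a)) (at t)"
        if "0 \<le> t" for t
      proof (rule has_real_derivative_along_line)
        have "R \<le> norm (x + t *\<^sub>R (- a))" using nr[OF that] r by simp
        then show "(v has_derivative (\<bullet>) (g (x + t *\<^sub>R - a) - a)) (at (x + t *\<^sub>R - a))"
          unfolding v_def inner_diff_left
          by (intro has_derivative_diff u bounded_linear_imp_has_derivative bounded_linear_inner_right)
      qed
      have "v (x + 0 *\<^sub>R (- a)) \<le> v (x + s *\<^sub>R (- a))"
        by (rule DERIV_nonneg_imp_nondecreasing[OF \<open>0 \<le> s\<close>]) (use dv pos in blast)
      then show ?thesis by simp
    qed
    have "x - s *\<^sub>R a \<in> S" if "0 \<le> s" for s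
      using nr[OF that] mono[OF that] x(1) r unfolding S v_def[symmetric] by simp
    then have "(\<lambda>s. x - s *\<^sub>R a) ` {0..t} \<subseteq> S" by auto
    moreover have "connected ((\<lambda>s. x - s *\<^sub>R a) ` {0..t})"
      by (intro connected_continuous_image continuous_intros) auto
    moreover have "x \<in> (\<lambda>s. x - s *\<^sub>R a) ` {0..t}" "x - t *\<^sub>R a \<in> (\<lambda>s. x - s *\<^sub>R a) ` {0..t}"
      using that by (auto intro: image_eqI[of _ _ 0])
    ultimately show ?thesis using nr[OF \<open>0 \<le> t\<close>] unfolding connected_component_def by blast
  qed
  obtain x' where x': "connected_component S x x'" "2 * r < norm x'" using far[OF x] by blast
  obtain y' where y': "connected_component S y y'" "2 * r < norm y'" using far[OF y] by blast
  define m where "m = norm x' + norm y'"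
  \<comment> \<open>The length of a shift along \<open>- a\<close>. On the segment between the
    shifted points \<open>v\<close> is at least \<open>3/4 \<alpha> T - 5/4 \<alpha> m\<close>, and
    \<open>T\<close> is large enough for this to exceed \<open>\<bar>c\<bar>\<close>.\<close>
  define T where "T = 2 * m + r + 2 * \<bar>c\<bar> / \<alpha>"
  define t where "t = T / \<alpha>"
  have m0: "0 \<le> m" by (simp add: m_def)
  have T0: "0 < T" using m0 r(1) \<alpha>(1) by (simp add: T_def add_nonneg_pos add_pos_nonneg)
  have t0: "0 \<le> t" "t * \<alpha> = T" using T0 \<alpha>(1) by (simp_all add: t_def)
  have "closed_segment (x' - t *\<^sub>R a) (y' - t *\<^sub>R a) \<subseteq> S"
  proof
    fix w assume "w \<in> closed_segment (x' - t *\<^sub>R a) (y' - t *\<^sub>R a)"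
    then obtain s where s: "0 \<le> s" "s \<le> 1" "w = (1 - s) *\<^sub>R (x' - t *\<^sub>R a) + s *\<^sub>R (y' - t *\<^sub>R a)"
      by (auto simp: in_segment)
    define q where "q = (1 - s) *\<^sub>R x' + s *\<^sub>R y'"
    have w: "w = q - t *\<^sub>R a" unfolding s(3) q_def by (simp add: algebra_simps)
    have q: "norm q \<le> m"
    proof -
      have "norm q \<le> (1 - s) * norm x' + s * norm y'"
        unfolding q_def using norm_triangle_ineq[of "(1 - s) *\<^sub>R x'" "s *\<^sub>R y'"] s by simp
      also have "\<dots> \<le> 1 * norm x' + 1 * norm y'" using s by (intro add_mono mult_right_mono) auto
      finally show ?thesis by (simp add: m_def)
    qed
    have ta: "norm (t *\<^sub>R a) = T" using t0 \<alpha>_def by simp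
    have nw: "T - m \<le> norm w" "norm w \<le> T + m"
      using norm_triangle_ineq2[of "t *\<^sub>R a" q] norm_triangle_ineq4[of q "t *\<^sub>R a"] q ta
      by (auto simp: w norm_minus_commute)
    have "r \<le> T - m" using m0 \<alpha>(1) by (simp add: T_def)
    then have rw: "r \<le> norm w" using nw by linarith
    have "\<bar>a \<bullet> q\<bar> \<le> \<alpha> * m" using order_trans[OF Cauchy_Schwarz_ineq2[of a q] mult_left_mono[OF q]] by (simp add: \<alpha>_def)
    moreover have "a \<bullet> w = a \<bullet> q - t * (\<alpha> * \<alpha>)" by (simp add: w inner_diff_right \<alpha>(2) power2_eq_square)
    moreover have "t * (\<alpha> * \<alpha>) = \<alpha> * T" by (simp add: t0(2)[symmetric])
    moreover have "\<bar>u w\<bar> \<le> \<alpha> / 4 * (T + m)"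
    proof (rule order_trans)
      show "\<bar>u w\<bar> \<le> \<alpha> / 4 * norm w" using r0(2)[of w] rw r by simp
      show "\<alpha> / 4 * norm w \<le> \<alpha> / 4 * (T + m)" using nw(2) \<alpha>(1) by (intro mult_left_mono) auto
    qed
    moreover have "\<alpha> / 4 * (T + m) = \<alpha> * T / 4 + \<alpha> * m / 4" by (simp add: field_simps)
    ultimately have "v w \<ge> 3 / 4 * (\<alpha> * T) - 5 / 4 * (\<alpha> * m)"
      unfolding v_def by linarith
    moreover have "\<alpha> * T = 2 * (\<alpha> * m) + \<alpha> * r + 2 * \<bar>c\<bar>" using \<alpha>(1) by (simp add: T_def field_simps)
    moreover have "\<alpha> * r > 0" "\<alpha> * m \<ge> 0" using \<alpha>(1) r(1) m0 by auto
    ultimately have "c < v w" by linarith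
    then show "w \<in> S" using rw r by (simp add: S v_def)
  qed
  then have "connected_component S (x' - t *\<^sub>R a) (y' - t *\<^sub>R a)"
    unfolding connected_component_def by (meson connected_segment ends_in_segment)
  then have "connected_component S x' y'"
    using ray[OF conjunct2[OF connected_component_in[OF x'(1)]] x'(2) t0(1)]
      ray[OF conjunct2[OF connected_component_in[OF y'(1)]] y'(2) t0(1)]
    by (blast intro: connected_component_trans connected_component_sym)
  then show ?thesis using x'(1) y'(1)
    by (blast intro: connected_component_trans connected_component_sym)
qed

lemma open_superlevel:
  fixes v :: "'a::real_normed_vector \<Rightarrow> real"
  assumes "continuous_on {x. R \<le> norm x} v"
  shows "open {x. R < norm x \<and> c < v x}"
proof -
  have "open {x::'a. R < norm x}" by (intro open_Collect_less continuous_intros)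
  moreover have "continuous_on {x. R < norm x} v"
    using assms by (rule continuous_on_subset) auto
  ultimately have "open ({x. R < norm x} \<inter> v -` {c<..})"
    by (intro continuous_open_preimage) auto
  moreover have "{x. R < norm x} \<inter> v -` {c<..} = {x. R < norm x \<and> c < v x}" by auto
  ultimately show ?thesis by simp
qed

text \<open>Away from the inner sphere the frontier of the component lies where
  \<open>v \<le> c\<close>. Were \<open>v \<le> c\<close> also at its limit points on that sphere,
  the maximum principle would give \<open>v \<le> c\<close> throughout the component.\<close>

lemma bounded_superlevel_component_reaches_sphere:
  fixes v :: "real ^ 'n \<Rightarrow> real"
  assumes sad: "saddle_on \<theta> {x. R \<le> norm x} v g H"
    and S: "S = {x. R < norm x \<and> c < v x}" and "x \<in> S"
    and bd: "bounded (connected_component_set S x)"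
  obtains z where "z \<in> closure (connected_component_set S x)" "norm z = R" "c < v z"
proof (rule ccontr)
  note conclude = that
  assume "\<not> thesis"
  then have no: "v z \<le> c" if "z \<in> closure (connected_component_set S x)" "norm z = R" for z
    using conclude[OF that] by linarith
  let ?C = "connected_component_set S x"
  have oS: "open S" unfolding S by (rule open_superlevel[OF saddle_on_continuous[OF sad]])
  have "?C \<subseteq> {x. R \<le> norm x}" using connected_component_subset[of S x] by (auto simp: S)
  moreover have "closed {x :: real ^ 'n. R \<le> norm x}" by (intro closed_Collect_le continuous_intros)
  ultimately have cl: "closure ?C \<subseteq> {x. R \<le> norm x}" by (rule closure_minimal)
  have "v x \<le> c"
  proof (rule saddle_on_max_principle[OF sad open_connected_component[OF oS] bd cl])
    fix z assume z: "z \<in> frontier ?C"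
    then have "z \<in> closure ?C" by (simp add: frontier_def)
    have "z \<in> frontier S" using frontier_of_connected_component_subset z by (rule subsetD)
    then have "z \<notin> S" using oS by (simp add: frontier_def interior_open)
    moreover have "R \<le> norm z" using subsetD[OF cl \<open>z \<in> closure ?C\<close>] by simp
    ultimately show "v z \<le> c" using no[OF \<open>z \<in> closure ?C\<close>] by (cases "norm z = R") (auto simp: S)
  next
    show "x \<in> ?C" using \<open>x \<in> S\<close> by simp
  qed
  then show False using \<open>x \<in> S\<close> by (simp add: S)
qed

lemma saddle_on_local_min_along:
  assumes sad: "saddle_on \<theta> S v g H" and "open S" "p \<in> S" "g p = 0" "0 < e \<bullet> (H p *v e)"
  obtains \<delta> where "0 < \<delta>" "\<And>t. t \<noteq> 0 \<Longrightarrow> \<bar>t\<bar> < \<delta> \<Longrightarrow> v p < v (p + t *\<^sub>R e)"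
proof -
  obtain \<delta> where \<delta>: "0 < \<delta>" "\<And>t. t \<noteq> 0 \<Longrightarrow> \<bar>t\<bar> < \<delta> \<Longrightarrow> v (p + 0 *\<^sub>R e) < v (p + t *\<^sub>R e)"
    by (rule second_derivative_strict_local_min[OF saddle_on_line[OF assms(1-3), of e]])
      (use assms(4,5) in auto)
  show ?thesis by (rule that[OF \<delta>(1)]) (use \<delta>(2) in auto)
qed

lemma elliptic_matrix_indefinite:
  assumes "elliptic_matrix \<theta> H" "0 < \<theta>" "e \<bullet> (H *v e) \<noteq> 0"
  obtains e1 e2 where "0 < e1 \<bullet> (H *v e1)" "e2 \<bullet> (H *v e2) < 0"
proof -
  have e0: "e \<noteq> 0" using assms(3) by auto
  define d where "d = (1 / norm e) *\<^sub>R e"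
  have d: "norm d = 1" using e0 by (simp add: d_def)
  have Qd: "d \<bullet> (H *v d) = (e \<bullet> (H *v e)) / (norm e)\<^sup>2"
    by (simp add: d_def matrix_vector_mult_scaleR power2_eq_square)
  show ?thesis
  proof (cases "0 < e \<bullet> (H *v e)")
    case True
    obtain \<xi> where "\<xi> \<bullet> (H *v \<xi>) \<le> - \<theta> * (d \<bullet> (H *v d))"
      using assms(1) d by (auto simp: elliptic_matrix_def)
    moreover have "0 < \<theta> * (d \<bullet> (H *v d))" unfolding Qd using True e0 assms(2) by simp
    ultimately show ?thesis using that[of e \<xi>] True by linarith
  next
    case False
    then have neg: "e \<bullet> (H *v e) < 0" using assms(3) by simp
    obtain \<xi> where "- \<theta> * (d \<bullet> (H *v d)) \<le> \<xi> \<bullet> (H *v \<xi>)"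
      using assms(1) d by (auto simp: elliptic_matrix_def)
    moreover have "\<theta> * (d \<bullet> (H *v d)) < 0"
      unfolding Qd using neg e0 assms(2) by (intro mult_pos_neg divide_neg_pos) auto
    ultimately show ?thesis using that[of \<xi> e] neg by linarith
  qed
qed

text \<open>A quadratic form scales by squares, so it cannot be positive on one of two parallel
  vectors and negative on the other.\<close>

lemma indefinite_directions_independent:
  fixes H :: "real ^ 2 ^ 2"
  assumes "0 < e1 \<bullet> (H *v e1)" "e2 \<bullet> (H *v e2) < 0"
  shows "e1 $ 1 * e2 $ 2 - e1 $ 2 * e2 $ 1 \<noteq> 0"
proof
  assume D: "e1 $ 1 * e2 $ 2 - e1 $ 2 * e2 $ 1 = 0"
  have "e1 $ i = 0" for i
  proof (rule ccontr)
    assume i: "e1 $ i \<noteq> 0"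
    have par: "e1 $ i *\<^sub>R e2 = e2 $ i *\<^sub>R e1"
      using D exhaust_2[of i] by (auto simp: vec_eq_iff forall_2 mult.commute)
    have "(e1 $ i)\<^sup>2 * (e2 \<bullet> (H *v e2)) = (e1 $ i *\<^sub>R e2) \<bullet> (H *v (e1 $ i *\<^sub>R e2))"
      by (simp add: matrix_vector_mult_scaleR power2_eq_square)
    also have "\<dots> = (e2 $ i)\<^sup>2 * (e1 \<bullet> (H *v e1))"
      unfolding par by (simp add: matrix_vector_mult_scaleR power2_eq_square)
    finally have "(e1 $ i)\<^sup>2 * (e2 \<bullet> (H *v e2)) \<ge> 0" using assms(1) by simp
    moreover have "(e1 $ i)\<^sup>2 * (e2 \<bullet> (H *v e2)) < 0"
      using i assms(2) by (intro mult_pos_neg) auto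
    ultimately show False by linarith
  qed
  then have "e1 = 0" by (simp add: vec_eq_iff)
  then show False using assms(1) by simp
qed

lemma connected_component_annulus:
  assumes "\<And>x. R < norm x \<Longrightarrow> norm x < \<rho> \<Longrightarrow> x \<in> S"
    and "R < norm x" "norm x < \<rho>" "R < norm y" "norm y < \<rho>"
  shows "connected_component S x (y :: real ^ 2)"
proof -
  have "connected {x :: real ^ 2. R < norm (x - 0) \<and> norm (x - 0) < \<rho>}"
    by (rule connected_annulus) simp
  then show ?thesis unfolding connected_component_def using assms by fastforce
qed

text \<open>At a nondegenerate point \<open>p\<close> the function \<open>u - g p \<bullet> x\<close> has a saddle. If its value there is
  above all values on the compact annulus, both the strict super- and sublevel sets of the
  exterior domain are connected, which a saddle in the plane forbids.\<close>

lemma tangent_plane_height_bounded: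
  fixes u :: "real ^ 2 \<Rightarrow> real"
  assumes sad: "saddle_on \<theta> {x. R \<le> norm x} u g H" and "0 < R"
    and g: "(g \<longlongrightarrow> 0) at_infinity"
    and q: "R < norm q" "\<And>x. norm x = R \<Longrightarrow> u q < u x"
  obtains C \<rho> where "R < \<rho>"
    "\<And>p e. \<rho> < norm p \<Longrightarrow> g p \<noteq> 0 \<Longrightarrow> e \<bullet> (H p *v e) \<noteq> 0 \<Longrightarrow> u p - g p \<bullet> p \<le> C"
proof -
  have contu: "continuous_on {x. R \<le> norm x} u" using sad by (rule saddle_on_continuous)
  have "continuous_on (sphere 0 R) u" by (rule continuous_on_subset[OF contu]) auto
  moreover have "sphere (0 :: real ^ 2) R \<noteq> {}" using \<open>0 < R\<close> by simp
  ultimately obtain x0 where x0: "norm x0 = R" "\<And>x. norm x = R \<Longrightarrow> u x0 \<le> u x"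
    using continuous_attains_inf[of "sphere 0 R" u] by auto
  define b where "b = u x0"
  have qb: "u q < b" using q(2)[OF x0(1)] by (simp add: b_def)
  \<comment> \<open>A third of the gap: removing the linear part changes \<open>u\<close> by at most
    \<open>\<kappa>\<close> up to radius \<open>\<rho>0\<close>, so \<open>v q\<close> is still
    below the minimum of \<open>v\<close> on the inner circle.\<close>
  define \<kappa> where "\<kappa> = (b - u q) / 3"
  have \<kappa>: "0 < \<kappa>" "u q + \<kappa> < b - \<kappa>" using qb by (auto simp: \<kappa>_def field_simps)
  define \<rho>0 where "\<rho>0 = norm q + 1"
  have \<rho>0: "0 < \<rho>0" "R < \<rho>0" "norm q < \<rho>0" using q(1) \<open>0 < R\<close> by (auto simp: \<rho>0_def)
  have "compact {x :: real ^ 2. R \<le> norm x \<and> norm x \<le> \<rho>0}"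
  proof -
    have "{x :: real ^ 2. R \<le> norm x \<and> norm x \<le> \<rho>0} = cball 0 \<rho>0 - ball 0 R" by auto
    then show ?thesis by (simp add: compact_diff)
  qed
  moreover have "continuous_on {x. R \<le> norm x \<and> norm x \<le> \<rho>0} u"
    by (rule continuous_on_subset[OF contu]) auto
  ultimately have "bounded (u ` {x. R \<le> norm x \<and> norm x \<le> \<rho>0})"
    by (intro compact_imp_bounded compact_continuous_image)
  then obtain C0 where C0: "\<And>x. R \<le> norm x \<Longrightarrow> norm x \<le> \<rho>0 \<Longrightarrow> \<bar>u x\<bar> \<le> C0"
    by (auto simp: bounded_iff)
  have "\<forall>\<^sub>F x in at_infinity. norm (g x) < \<kappa> / \<rho>0"
    using tendstoD[OF g, of "\<kappa> / \<rho>0"] \<kappa>(1) \<rho>0(1) by simp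
  then obtain r where r: "\<And>x. r \<le> norm x \<Longrightarrow> norm (g x) < \<kappa> / \<rho>0"
    by (auto simp: eventually_at_infinity)
  show ?thesis
  proof (rule that[of "max r R + 1" "C0 + \<kappa>"])
    fix p e assume p: "max r R + 1 < norm p" "g p \<noteq> 0" "e \<bullet> (H p *v e) \<noteq> 0"
    show "u p - g p \<bullet> p \<le> C0 + \<kappa>"
    proof (rule ccontr)
      assume high: "\<not> u p - g p \<bullet> p \<le> C0 + \<kappa>"
      define a where "a = g p"
      define c where "c = u p - a \<bullet> p"
      define v where "v x = u x - a \<bullet> x - 0" for x
      have a: "a \<noteq> 0" "norm a < \<kappa> / \<rho>0" using p r by (auto simp: a_def)
      have small: "\<bar>a \<bullet> x\<bar> \<le> \<kappa>" if "norm x \<le> \<rho>0" for x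
      proof -
        have "\<bar>a \<bullet> x\<bar> \<le> norm a * norm x" by (rule Cauchy_Schwarz_ineq2)
        also have "\<dots> \<le> (\<kappa> / \<rho>0) * \<rho>0" using a(2) that by (intro mult_mono) (auto intro: less_imp_le order_trans[OF norm_ge_zero])
        finally show ?thesis using \<rho>0(1) by simp
      qed
      have low: "v x < c" if "R \<le> norm x" "norm x \<le> \<rho>0" for x
        using C0[OF that] small[OF that(2)] high by (simp add: v_def c_def a_def)
      have sadv: "saddle_on \<theta> {x. R \<le> norm x} v (\<lambda>x. g x - a) H"
        unfolding v_def by (rule saddle_on_minus_affine[OF sad])
      have sadv': "saddle_on \<theta> {x. R \<le> norm x} (\<lambda>x. - v x) (\<lambda>x. - (g x - a)) (\<lambda>x. - H x)"
        by (rule saddle_on_uminus[OF sadv])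
      have derv: "(u has_derivative (\<bullet>) (g x)) (at x)" if "R \<le> norm x" for x
        using saddle_onD(1)[OF sad] that by simp
      have derv': "((\<lambda>x. - u x) has_derivative (\<bullet>) (- g x)) (at x)" if "R \<le> norm x" for x
        by (rule saddle_onD(1)[OF saddle_on_uminus[OF sad]]) (use that in simp)
      have g': "((\<lambda>x. - g x) \<longlongrightarrow> 0) at_infinity" using tendsto_minus[OF g] by simp
      define A where "A = {x. R < norm x \<and> c < v x}"
      \<comment> \<open>The sublevel set is written as a superlevel set of \<open>- v\<close>, so
        that the same lemmas serve \<open>A\<close> and \<open>B\<close>.\<close>
      define B where "B = {x. R < norm x \<and> - c < - v x}"
      have oA: "open A" and oB: "open B"
        unfolding A_def B_def
        by (rule open_superlevel, rule saddle_on_continuous, rule sadv sadv')+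
      have A': "A = {x. R < norm x \<and> c < u x - a \<bullet> x}"
        by (simp add: A_def v_def)
      have B': "B = {x. R < norm x \<and> - c < - u x - (- a) \<bullet> x}"
        by (simp add: B_def v_def)
      have unbA: "\<not> bounded (connected_component_set A x)" if xA: "x \<in> A" for x
      proof
        assume "bounded (connected_component_set A x)"
        then obtain z where "norm z = R" "c < v z"
          by (rule bounded_superlevel_component_reaches_sphere[OF sadv A_def xA])
        then show False using low[of z] \<rho>0(2) by simp
      qed
      have qB: "q \<in> B" using low[of q] q(1) \<rho>0 by (simp add: B_def)
      \<comment> \<open>A bounded component of \<open>q\<close> would contain its component in the
        smaller set \<open>{v < b - \<kappa>}\<close>, which has to reach the inner circle; but
        there \<open>v \<ge> b - \<kappa>\<close>.\<close>
      have unbq: "\<not> bounded (connected_component_set B q)"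
      proof
        assume bd: "bounded (connected_component_set B q)"
        define B1 where "B1 = {x. R < norm x \<and> - (b - \<kappa>) < - v x}"
        have "v x0 \<ge> b - \<kappa>" using small[of x0] x0(1) \<rho>0(2) by (auto simp: v_def b_def)
        then have "B1 \<subseteq> B" using low[of x0] x0(1) \<rho>0(2) by (auto simp: B1_def B_def)
        then have "bounded (connected_component_set B1 q)"
          using bd bounded_subset connected_component_mono by metis
        moreover have "q \<in> B1" using small[of q] \<rho>0(3) \<kappa>(2) q(1) by (auto simp: B1_def v_def)
        ultimately obtain z where z: "norm z = R" "- (b - \<kappa>) < - v z"
          using bounded_superlevel_component_reaches_sphere[OF sadv' B1_def] by metis
        then show False using small[of z] x0(2)[of z] \<rho>0(2) by (auto simp: v_def b_def)
      qed
      \<comment> \<open>A bounded component would reach the inner circle and enter the annulus,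
        which lies in \<open>B\<close> and contains \<open>q\<close>; it would then be the unbounded
        component of \<open>q\<close>.\<close>
      have unbB: "\<not> bounded (connected_component_set B x)" if xB: "x \<in> B" for x
      proof
        assume bd: "bounded (connected_component_set B x)"
        then obtain z where z: "z \<in> closure (connected_component_set B x)" "norm z = R"
          by (rule bounded_superlevel_component_reaches_sphere[OF sadv' B_def xB])
        obtain w where w: "w \<in> connected_component_set B x" "dist w z < \<rho>0 - R"
          using z(1)[unfolded closure_approachable, rule_format, of "\<rho>0 - R"] \<rho>0(2) by auto
        have "norm w < \<rho>0" using w(2) z(2) norm_triangle_ineq2[of w z] by (simp add: dist_norm)
        moreover have "R < norm w" using w(1) connected_component_in[of B x w] by (auto simp: B_def)
        ultimately have "connected_component B w q"
          using q(1) \<rho>0(3) low by (intro connected_component_annulus[of R \<rho>0]) (auto simp: B_def)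
        then have "connected_component B x q" using w(1) by (auto intro: connected_component_trans)
        then have "connected_component_set B x = connected_component_set B q"
          by (simp add: connected_component_eq)
        then show False using bd unbq by simp
      qed
      have connA: "connected_component A x y" if "x \<in> A" "y \<in> A" for x y
        by (rule unbounded_superlevel_components_agree[OF derv g a(1) A']) (use unbA that in auto)
      have connB: "connected_component B x y" if "x \<in> B" "y \<in> B" for x y
        by (rule unbounded_superlevel_components_agree[OF derv' g' _ B']) (use a(1) unbB that in auto)
      have Hp: "elliptic_matrix \<theta> (H p)" using saddle_onD(3)[OF sad, of p] p(1) by simp
      obtain e1 e2 where e12: "0 < e1 \<bullet> (H p *v e1)" "e2 \<bullet> (H p *v e2) < 0"
        using elliptic_matrix_indefinite[OF Hp saddle_on_pos[OF sad] p(3)] .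
      define U where "U = {x :: real ^ 2. R < norm x}"
      have U: "open U" "p \<in> U" "U \<subseteq> {x. R \<le> norm x}"
        unfolding U_def using p(1) by (auto intro!: open_Collect_less continuous_intros)
      obtain \<delta>1 where \<delta>1: "0 < \<delta>1" "\<And>t. t \<noteq> 0 \<Longrightarrow> \<bar>t\<bar> < \<delta>1 \<Longrightarrow> v p < v (p + t *\<^sub>R e1)"
        by (rule saddle_on_local_min_along[OF saddle_on_subset[OF sadv U(3)] U(1,2)])
          (use e12 in \<open>auto simp: a_def\<close>)
      obtain \<delta>2 where \<delta>2: "0 < \<delta>2" "\<And>t. t \<noteq> 0 \<Longrightarrow> \<bar>t\<bar> < \<delta>2 \<Longrightarrow> - v p < - v (p + t *\<^sub>R e2)"
        by (rule saddle_on_local_min_along[OF saddle_on_subset[OF sadv' U(3)] U(1,2)])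
          (use e12 in \<open>auto simp: a_def uminus_matrix_vector\<close>)
      obtain \<delta>3 where \<delta>3: "0 < \<delta>3" "\<And>t. \<bar>t\<bar> < \<delta>3 \<Longrightarrow> p + t *\<^sub>R e1 \<in> U \<and> p + t *\<^sub>R e2 \<in> U"
        using eventually_conj[OF eventually_line_in_open[OF U(1,2), of e1] eventually_line_in_open[OF U(1,2), of e2]]
        by (auto simp: eventually_nhds_metric dist_real_def)
      define \<delta> where "\<delta> = min \<delta>1 (min \<delta>2 \<delta>3) / 2"
      have \<delta>: "0 < \<delta>" "\<delta> < \<delta>1" "\<delta> < \<delta>2" "\<delta> < \<delta>3"
        using \<delta>1(1) \<delta>2(1) \<delta>3(1) by (auto simp: \<delta>_def)
      have vp: "v p = c" by (simp add: v_def c_def)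
      have inA: "p + t *\<^sub>R e1 \<in> A" if "t \<noteq> 0" "\<bar>t\<bar> \<le> \<delta>" for t
        using \<delta>1(2)[of t] \<delta>3(2)[of t] that \<delta> vp by (simp add: A_def U_def)
      have inB: "p + t *\<^sub>R e2 \<in> B" if "t \<noteq> 0" "\<bar>t\<bar> \<le> \<delta>" for t
        using \<delta>2(2)[of t] \<delta>3(2)[of t] that \<delta> vp by (simp add: B_def U_def)
      have "A \<inter> B \<noteq> {}"
      proof (rule crossing_loops_meet[OF indefinite_directions_independent[OF e12] \<delta>(1) inA inB])
        show "p \<notin> A" "p \<notin> B" using vp by (auto simp: A_def B_def)
        have "connected_component A (p + (- \<delta>) *\<^sub>R e1) (p + \<delta> *\<^sub>R e1)"
          using \<delta>(1) by (intro connA inA) auto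
        then show "path_component A (p - \<delta> *\<^sub>R e1) (p + \<delta> *\<^sub>R e1)"
          by (simp add: open_path_connected_component[OF oA])
        have "connected_component B (p + (- \<delta>) *\<^sub>R e2) (p + \<delta> *\<^sub>R e2)"
          using \<delta>(1) by (intro connB inB) auto
        then show "path_component B (p - \<delta> *\<^sub>R e2) (p + \<delta> *\<^sub>R e2)"
          by (simp add: open_path_connected_component[OF oB])
      qed
      then show False by (auto simp: A_def B_def)
    qed
  qed simp
qed

lemma nonpos_of_nondecreasing_tendsto_0:
  fixes f :: "real \<Rightarrow> real"
  assumes f: "\<And>r. \<rho> < r \<Longrightarrow> (f has_real_derivative f' r) (at r)" "\<And>r. \<rho> < r \<Longrightarrow> 0 \<le> f' r"
    and lim: "(f \<longlongrightarrow> 0) at_top" and "\<rho> < r"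
  shows "f r \<le> 0"
proof (rule tendsto_lowerbound[OF lim])
  show "\<forall>\<^sub>F s in at_top. f r \<le> f s"
    using eventually_ge_at_top[of r]
  proof eventually_elim
    case (elim s)
    show ?case
      by (rule DERIV_nonneg_imp_nondecreasing[OF elim])
        (meson assms(1,2,4) less_le_trans)
  qed
qed simp

text \<open>The height \<open>u - r D\<close> of the tangent line at \<open>0\<close> is minus \<open>r\<^sup>2\<close> times the derivative of \<open>u / r\<close>.\<close>

lemma bounded_by_tangent_height_on_ray:
  fixes U D Q :: "real \<Rightarrow> real"
  assumes "0 \<le> \<rho>"
    and U: "\<And>r. \<rho> < r \<Longrightarrow> (U has_real_derivative D r) (at r)"
    and D: "\<And>r. \<rho> < r \<Longrightarrow> (D has_real_derivative Q r) (at r)"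
    and lim: "((\<lambda>r. U r / r) \<longlongrightarrow> 0) at_top"
    and C: "\<And>r. \<rho> < r \<Longrightarrow> Q r \<noteq> 0 \<Longrightarrow> U r - r * D r \<le> C"
    and "\<rho> < r0" "\<rho> < r"
  shows "U r \<le> max C (U r0)"
proof -
  define \<Gamma> where "\<Gamma> r = U r - r * D r" for r
  have \<Gamma>': "(\<Gamma> has_real_derivative - (r * Q r)) (at r)" if "\<rho> < r" for r
    unfolding \<Gamma>_def by (rule derivative_eq_intros U D that refl)+ simp
  have Q0: "Q r = 0" if "\<rho> < r" "C < \<Gamma> r" for r
    using C[OF that(1)] that(2) by (force simp: \<Gamma>_def)
  have W: "((\<lambda>r. (U r - K) / r) has_real_derivative (K - \<Gamma> r) / r\<^sup>2) (at r)" if "\<rho> < r" for K r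
    by (rule derivative_eq_intros U that refl | use that \<open>0 \<le> \<rho>\<close> in \<open>simp; fail\<close>)+
      (use that \<open>0 \<le> \<rho>\<close> in \<open>simp add: \<Gamma>_def power2_eq_square field_simps\<close>)
  have Wlim: "((\<lambda>r. (U r - K) / r) \<longlongrightarrow> 0) at_top" for K
  proof -
    have "((\<lambda>r. U r / r - K / r) \<longlongrightarrow> 0 - 0) at_top"
      by (intro tendsto_diff lim tendsto_divide_0[OF tendsto_const] filterlim_at_top_imp_at_infinity filterlim_ident)
    then show ?thesis by (simp add: diff_divide_distrib)
  qed
  show ?thesis
  proof (cases "\<exists>r1>\<rho>. C < \<Gamma> r1")
    case False
    then have "0 \<le> C - \<Gamma> s" if "\<rho> < s" for s using that by force
    then have "(U r - C) / r \<le> 0"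
      by (intro nonpos_of_nondecreasing_tendsto_0[OF W _ Wlim \<open>\<rho> < r\<close>] divide_nonneg_nonneg) auto
    then show ?thesis using \<open>\<rho> < r\<close> \<open>0 \<le> \<rho>\<close> by (simp add: divide_le_0_iff)
  next
    case True
    then obtain r1 where r1: "\<rho> < r1" "C < \<Gamma> r1" by blast
    have cont: "continuous_on {\<rho><..} \<Gamma>"
      using \<Gamma>' by (auto intro!: continuous_at_imp_continuous_on DERIV_isCont)
    \<comment> \<open>Where \<open>\<Gamma> > C\<close>, the height bound forces
      \<open>Q = 0\<close>, so \<open>\<Gamma>\<close> is locally constant there. The level set
      through \<open>r1\<close> is thus open and closed in the ray.\<close>
    have "\<forall>s\<in>{\<rho><..}. \<Gamma> s = \<Gamma> r1"
    proof (rule continuous_levelset_open[OF _ cont])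
      show "open {s \<in> {\<rho><..}. \<Gamma> s = \<Gamma> r1}"
      proof (rule openI)
        fix s assume s: "s \<in> {s \<in> {\<rho><..}. \<Gamma> s = \<Gamma> r1}"
        have "open ({\<rho><..} \<inter> \<Gamma> -` {C<..})" using cont by (intro continuous_open_preimage) auto
        then obtain d where d: "0 < d" "ball s d \<subseteq> {\<rho><..} \<inter> \<Gamma> -` {C<..}"
          using s r1(2) openE[of "{\<rho><..} \<inter> \<Gamma> -` {C<..}" s] by auto
        have "\<exists>c. \<forall>x\<in>ball s d. \<Gamma> x = c"
        proof (rule has_field_derivative_zero_constant)
          fix x assume "x \<in> ball s d"
          then have "x \<in> {\<rho><..} \<inter> \<Gamma> -` {C<..}" using d(2) by (rule subsetD[rotated])
          then have "\<rho> < x" "Q x = 0" using Q0[of x] by auto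
          then show "(\<Gamma> has_real_derivative 0) (at x within ball s d)"
            using \<Gamma>'[of x] by (simp add: has_field_derivative_at_within)
        qed simp
        then have "\<Gamma> x = \<Gamma> r1" if "x \<in> ball s d" for x using that s d(1) by force
        then show "\<exists>T>0. ball s T \<subseteq> {s \<in> {\<rho><..}. \<Gamma> s = \<Gamma> r1}" using d by auto
      qed
    qed (use r1 in auto)
    then have const: "\<Gamma> s = \<Gamma> r1" if "\<rho> < s" for s using that by simp
    \<comment> \<open>With \<open>\<Gamma>\<close> constant, \<open>(U - \<Gamma> r1) / r\<close>
      has derivative 0 and tends to 0. Used with both signs, this bounds \<open>U r\<close> by
      \<open>\<Gamma> r1\<close> and \<open>\<Gamma> r1\<close> by \<open>U r0\<close>.\<close>
    have "(U r - \<Gamma> r1) / r \<le> 0"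
    proof (rule nonpos_of_nondecreasing_tendsto_0[OF W _ Wlim \<open>\<rho> < r\<close>])
      show "0 \<le> (\<Gamma> r1 - \<Gamma> s) / s\<^sup>2" if "\<rho> < s" for s unfolding const[OF that] by simp
    qed
    then have "U r \<le> \<Gamma> r1" using \<open>\<rho> < r\<close> \<open>0 \<le> \<rho>\<close> by (simp add: divide_le_0_iff)
    moreover have "- ((U r0 - \<Gamma> r1) / r0) \<le> 0"
    proof (rule nonpos_of_nondecreasing_tendsto_0[OF DERIV_minus[OF W] _ _ \<open>\<rho> < r0\<close>])
      show "0 \<le> - ((\<Gamma> r1 - \<Gamma> s) / s\<^sup>2)" if "\<rho> < s" for s unfolding const[OF that] by simp
      show "((\<lambda>s. - ((U s - \<Gamma> r1) / s)) \<longlongrightarrow> 0) at_top" using tendsto_minus[OF Wlim] by simp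
    qed
    then have "\<Gamma> r1 \<le> U r0" using \<open>\<rho> < r0\<close> \<open>0 \<le> \<rho>\<close> by (simp add: zero_le_divide_iff)
    ultimately show ?thesis by simp
  qed
qed

lemma saddle_on_bounded_above_or_below:
  fixes u :: "real ^ 2 \<Rightarrow> real"
  assumes sad: "saddle_on \<theta> {x. R \<le> norm x} u g H" and "0 < R"
    and g: "(g \<longlongrightarrow> 0) at_infinity"
  shows "(\<exists>M. \<forall>x. R \<le> norm x \<longrightarrow> u x \<le> M) \<or> (\<exists>M. \<forall>x. R \<le> norm x \<longrightarrow> M \<le> u x)"
proof (rule disjCI)
  assume nb: "\<not> (\<exists>M. \<forall>x. R \<le> norm x \<longrightarrow> M \<le> u x)"
  have contu: "continuous_on {x. R \<le> norm x} u" using sad by (rule saddle_on_continuous)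
  have bdd: "\<exists>B. \<forall>x. R \<le> norm x \<longrightarrow> norm x \<le> \<rho> \<longrightarrow> \<bar>u x\<bar> \<le> B" for \<rho>
  proof -
    have "{x :: real ^ 2. R \<le> norm x \<and> norm x \<le> \<rho>} = cball 0 \<rho> - ball 0 R" by auto
    then have "compact {x :: real ^ 2. R \<le> norm x \<and> norm x \<le> \<rho>}" by (simp add: compact_diff)
    moreover have "continuous_on {x. R \<le> norm x \<and> norm x \<le> \<rho>} u"
      by (rule continuous_on_subset[OF contu]) auto
    ultimately have "bounded (u ` {x. R \<le> norm x \<and> norm x \<le> \<rho>})"
      by (intro compact_imp_bounded compact_continuous_image)
    then show ?thesis by (auto simp: bounded_iff)
  qed
  obtain B where B: "\<And>x. norm x = R \<Longrightarrow> \<bar>u x\<bar> \<le> B" using bdd[of R] by auto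
  obtain q where q: "R \<le> norm q" "u q < - B" using nb by (meson not_le)
  have qR: "R < norm q" using q B[of q] by (cases "norm q = R") auto
  have qs: "u q < u x" if "norm x = R" for x using B[OF that] q(2) by linarith
  obtain C \<rho> where \<rho>: "R < \<rho>"
    and C: "\<And>p e. \<rho> < norm p \<Longrightarrow> g p \<noteq> 0 \<Longrightarrow> e \<bullet> (H p *v e) \<noteq> 0 \<Longrightarrow> u p - g p \<bullet> p \<le> C"
    by (rule tangent_plane_height_bounded[OF sad \<open>0 < R\<close> g qR qs]) blast+
  \<comment> \<open>The ray lemma compares with a base point strictly beyond \<open>\<rho>\<close>.
    It will be taken at radius \<open>\<rho> + 1\<close>, which \<open>B'\<close> therefore has to
    cover.\<close>
  obtain B' where B': "\<And>x. R \<le> norm x \<Longrightarrow> norm x \<le> \<rho> + 1 \<Longrightarrow> \<bar>u x\<bar> \<le> B'" using bdd[of "\<rho> + 1"] by auto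
  have "u x \<le> max C B'" if x: "R \<le> norm x" for x
  proof (cases "norm x \<le> \<rho> + 1")
    case True
    then show ?thesis using B'[of x] x by linarith
  next
    case False
    define \<omega> where "\<omega> = (1 / norm x) *\<^sub>R x"
    have om: "norm \<omega> = 1" "norm x *\<^sub>R \<omega> = x" using False \<rho> \<open>0 < R\<close> by (auto simp: \<omega>_def)
    have inS: "r *\<^sub>R \<omega> \<in> {x. R \<le> norm x}" "norm (r *\<^sub>R \<omega>) = r" if "\<rho> < r" for r
      using that om(1) \<rho> \<open>0 < R\<close> by auto
    define U where "U r = u (r *\<^sub>R \<omega>)" for r
    define D where "D r = g (r *\<^sub>R \<omega>) \<bullet> \<omega>" for r
    define Q where "Q r = \<omega> \<bullet> (H (r *\<^sub>R \<omega>) *v \<omega>)" for r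
    have U: "(U has_real_derivative D r) (at r)" if "\<rho> < r" for r
      using has_real_derivative_along_line[of u "g (r *\<^sub>R \<omega>)" 0 r \<omega>] saddle_onD(1)[OF sad inS(1)[OF that]]
      by (simp add: U_def[abs_def] D_def)
    have D: "(D has_real_derivative Q r) (at r)" if "\<rho> < r" for r
      using has_real_derivative_gradient_along_line[of g "H (r *\<^sub>R \<omega>)" 0 r \<omega> \<omega>] saddle_onD(2)[OF sad inS(1)[OF that]]
      by (simp add: D_def[abs_def] Q_def)
    have CQ: "U r - r * D r \<le> C" if "\<rho> < r" "g (r *\<^sub>R \<omega>) \<noteq> 0" "Q r \<noteq> 0" for r
      using C[of "r *\<^sub>R \<omega>" \<omega>] inS(2)[OF that(1)] that by (simp add: U_def D_def Q_def)
    have "U (norm x) \<le> max C (U (\<rho> + 1))"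
    proof (rule bounded_by_tangent_height_on_ray[where U = U and D = D and Q = Q and \<rho> = \<rho> and C = C and ?r0.0 = "\<rho> + 1" and r = "norm x"])
      show "((\<lambda>r. U r / r) \<longlongrightarrow> 0) at_top"
      proof (rule tendstoI)
        fix \<epsilon> :: real assume e: "\<epsilon> > 0"
        obtain r where r: "0 < r" "\<And>x. r \<le> norm x \<Longrightarrow> \<bar>u x\<bar> \<le> \<epsilon> / 2 * norm x"
        proof (rule sublinear_of_gradient_tendsto_0[of R u g "\<epsilon> / 2"])
          show "(u has_derivative (\<bullet>) (g x)) (at x)" if "R \<le> norm x" for x
            using saddle_onD(1)[OF sad] that by simp
        qed (use g e in auto)
        show "\<forall>\<^sub>F s in at_top. dist (U s / s) 0 < \<epsilon>"
          using eventually_ge_at_top[of r] eventually_gt_at_top[of \<rho>]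
        proof eventually_elim
          case (elim s)
          have "\<bar>U s\<bar> \<le> \<epsilon> / 2 * s" using r(2)[of "s *\<^sub>R \<omega>"] inS(2)[OF elim(2)] elim by (simp add: U_def)
          moreover have "0 < s" using elim(1) r(1) by simp
          ultimately have "\<bar>U s / s\<bar> \<le> \<epsilon> / 2" by (simp add: abs_divide pos_divide_le_eq)
          then show ?case unfolding dist_real_def diff_zero using e by linarith
        qed
      qed
      \<comment> \<open>The bound \<open>CQ\<close> says nothing where \<open>g\<close> vanishes. At
        such a point with \<open>Q r \<noteq> 0\<close>, \<open>D\<close> leaves the value 0
        immediately to the right. So \<open>g\<close> is nonzero there and, the height being still
        above \<open>C\<close>, \<open>CQ\<close> forces \<open>Q = 0\<close>; but then
        \<open>D\<close> could not have changed.\<close>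
      show "U r - r * D r \<le> C" if r: "\<rho> < r" "Q r \<noteq> 0" for r
      proof (rule ccontr)
        assume high: "\<not> U r - r * D r \<le> C"
        then have "g (r *\<^sub>R \<omega>) = 0" using CQ[of r] r by blast
        then have Dr: "D r = 0" by (simp add: D_def)
        have "isCont (\<lambda>r. U r - r * D r) r"
          by (intro continuous_intros DERIV_isCont[OF U[OF r(1)]] DERIV_isCont[OF D[OF r(1)]])
        then have "((\<lambda>r. U r - r * D r) \<longlongrightarrow> U r - r * D r) (nhds r)"
          by (simp add: isCont_def tendsto_nhds_iff)
        then have "\<forall>\<^sub>F s in nhds r. C < U s - s * D s"
          using high by (intro order_tendstoD(1)) auto
        then obtain d1 where d1: "0 < d1" "\<And>s. \<bar>s - r\<bar> < d1 \<Longrightarrow> C < U s - s * D s"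
          by (auto simp: eventually_nhds_metric dist_real_def)
        obtain d2 where d2: "0 < d2" "\<And>h. 0 < h \<Longrightarrow> h < d2 \<Longrightarrow> D (r + h) \<noteq> D r"
        proof (cases "0 < Q r")
          case True
          then show ?thesis using DERIV_pos_inc_right[OF D[OF r(1)]] that by (metis less_irrefl)
        next
          case False
          then have "Q r < 0" using r(2) by simp
          then show ?thesis using DERIV_neg_dec_right[OF D[OF r(1)]] that by (metis less_irrefl)
        qed
        define h where "h = min d1 d2 / 2"
        have h: "0 < h" "h < d1" "h < d2" using d1(1) d2(1) by (auto simp: h_def)
        have Qz: "Q (r + s) = 0" if "0 < s" "s \<le> h" for s
        proof (rule ccontr)
          assume "Q (r + s) \<noteq> 0"
          moreover have "D (r + s) \<noteq> 0" using d2(2)[of s] that h Dr by simp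
          then have "g ((r + s) *\<^sub>R \<omega>) \<noteq> 0" unfolding D_def by force
          ultimately have "U (r + s) - (r + s) * D (r + s) \<le> C" using CQ[of "r + s"] that r(1) by simp
          then show False using d1(2)[of "r + s"] that h by simp
        qed
        have "\<exists>z. r < z \<and> z < r + h \<and> D (r + h) - D r = (r + h - r) * Q z"
          using h(1) r(1) by (intro MVT2 D) auto
        then obtain z where z: "r < z" "z < r + h" "D (r + h) - D r = h * Q z" by auto
        have "Q z = 0" using Qz[of "z - r"] z by simp
        then show False using z(3) d2(2)[of h] h by simp
      qed
    qed (use U D False \<rho> \<open>0 < R\<close> in auto)
    moreover have "U (\<rho> + 1) \<le> B'" using B'[of "(\<rho> + 1) *\<^sub>R \<omega>"] om(1) \<rho> \<open>0 < R\<close> by (simp add: U_def)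
    ultimately show ?thesis using om(2) by (auto simp: U_def)
  qed
  then show "\<exists>M. \<forall>x. R \<le> norm x \<longrightarrow> u x \<le> M" by blast
qed

section \<open>Existence of the limit\<close>

text \<open>For \<open>\<theta> (2 m + 3) > 1\<close> the Hessian of \<open>|x - z| powr (- 2 (m + 1))\<close> is too convex in the radial
  direction for a function with \<open>\<theta>\<close>-elliptic Hessian to touch it from above.\<close>

lemma saddle_on_no_touching_barrier:
  fixes u :: "real ^ 'n \<Rightarrow> real"
  assumes sad: "saddle_on \<theta> S u g H" and "open S" "y \<in> S" and "y \<noteq> z" "0 < \<tau>" and m: "1 < \<theta> * (2 * real m + 3)"
    and mn: "\<And>x. x \<in> S \<Longrightarrow> u y - \<tau> * (1 / (norm (y - z))\<^sup>2) ^ Suc m \<le> u x - \<tau> * (1 / (norm (x - z))\<^sup>2) ^ Suc m"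
  shows False
proof -
  define A where "A = (norm (y - z))\<^sup>2"
  have A: "A > 0" using \<open>y \<noteq> z\<close> by (simp add: A_def)
  define I where "I = 1 / A"
  have I: "I > 0" using A by (simp add: I_def)
  \<comment> \<open>The left side is the second derivative along \<open>e\<close> of the barrier at
    \<open>y\<close>. As the difference has a minimum at \<open>y\<close>, it is a lower bound for
    that of \<open>u\<close>.\<close>
  have key: "\<tau> * (real (Suc m) * I ^ (m + 2) * (4 * (real m + 2) * \<beta>\<^sup>2 * I - 2)) \<le> e \<bullet> (H y *v e)"
    if e: "norm e = 1" and \<beta>: "\<beta> = (y - z) \<bullet> e" for e \<beta>
  proof -
    define q where "q t = A + 2 * \<beta> * t + t\<^sup>2" for t
    have q: "(norm (y + t *\<^sub>R e - z))\<^sup>2 = q t" for t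
    proof -
      have "y + t *\<^sub>R e - z = (y - z) + t *\<^sub>R e" by simp
      moreover have "(norm ((y - z) + t *\<^sub>R e))\<^sup>2 = q t"
        using e unfolding A_def q_def \<beta> power2_norm_eq_inner norm_eq_1 inner_add_left inner_add_right
        by (simp add: inner_commute[of e "y - z"] power2_eq_square distrib_left del: inner_diff_left inner_diff_right)
      ultimately show ?thesis by (simp only:)
    qed
    have q0: "q 0 = A" by (simp add: q_def)
    have dq: "(q has_real_derivative (2 * \<beta> + 2 * t)) (at t)" for t
      unfolding q_def by (auto intro!: derivative_eq_intros)
    have "0 \<le> e \<bullet> (H y *v e) - \<tau> * (real (Suc m) * I ^ (m + 2) * (4 * (real m + 2) * \<beta>\<^sup>2 * I - 2))"
    proof (rule second_derivative_local_min_nonneg)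
      have "open (q -` {0<..})"
        by (rule continuous_open_vimage[OF open_greaterThan]) (rule DERIV_isCont[OF dq])
      then have "\<forall>\<^sub>F t in nhds 0. t \<in> q -` {0<..}" using q0 A by (intro eventually_nhds_in_open) auto
      then show "\<forall>\<^sub>F t in nhds 0. ((\<lambda>t. u (y + t *\<^sub>R e) - \<tau> * (1 / q t) ^ Suc m) has_real_derivative
         g (y + t *\<^sub>R e) \<bullet> e + \<tau> * (real (Suc m) * (2 * \<beta> + 2 * t) * (1 / q t) ^ (m + 2))) (at t)"
        using saddle_on_line(1)[OF sad \<open>open S\<close> \<open>y \<in> S\<close>, of e]
      proof eventually_elim
        case (elim t)
        then have "q t \<noteq> 0" by auto
        show ?case
          by (rule derivative_eq_intros elim dq refl \<open>q t \<noteq> 0\<close>)+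
            (use \<open>q t \<noteq> 0\<close> in \<open>simp add: field_simps power2_eq_square\<close>)
      qed
      show "((\<lambda>t. g (y + t *\<^sub>R e) \<bullet> e + \<tau> * (real (Suc m) * (2 * \<beta> + 2 * t) * (1 / q t) ^ (m + 2)))
         has_real_derivative e \<bullet> (H y *v e) - \<tau> * (real (Suc m) * I ^ (m + 2) * (4 * (real m + 2) * \<beta>\<^sup>2 * I - 2))) (at 0)"
      proof -
        have "q 0 \<noteq> 0" using q0 A by simp
        show ?thesis
          by (rule derivative_eq_intros saddle_on_line(2)[OF sad \<open>open S\<close> \<open>y \<in> S\<close>] dq refl \<open>q 0 \<noteq> 0\<close>)+
            (use A in \<open>simp add: q0 I_def field_simps power2_eq_square\<close>)
      qed
      show "\<forall>\<^sub>F t in nhds 0. u (y + 0 *\<^sub>R e) - \<tau> * (1 / q 0) ^ Suc m \<le> u (y + t *\<^sub>R e) - \<tau> * (1 / q t) ^ Suc m"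
        using eventually_line_in_open[OF \<open>open S\<close> \<open>y \<in> S\<close>, of e]
      proof eventually_elim
        case (elim t)
        show ?case using mn[OF elim] q[of t] q[of 0] by simp
      qed
    qed
    then show ?thesis by simp
  qed
  define d where "d = (1 / norm (y - z)) *\<^sub>R (y - z)"
  have d: "norm d = 1" "((y - z) \<bullet> d)\<^sup>2 = A"
    using \<open>y \<noteq> z\<close> by (simp_all add: d_def A_def power2_norm_eq_inner[symmetric] power2_eq_square)
  define P where "P = \<tau> * (real (Suc m) * I ^ (m + 2))"
  have P: "P > 0" using \<open>0 < \<tau>\<close> I by (simp add: P_def)
  have AI: "A * I = 1" using A by (simp add: I_def)
  \<comment> \<open>Radially the bracket in \<open>key\<close> is \<open>4 m + 6\<close>, and in
    every direction it is at least \<open>- 2\<close>. The ratio \<open>2 m + 3\<close> exceeds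
    \<open>1 / \<theta>\<close>, the largest that ellipticity allows.\<close>
  have rad: "P * (4 * real m + 6) \<le> d \<bullet> (H y *v d)"
  proof -
    have "4 * (real m + 2) * A * I - 2 = 4 * real m + 6" by (simp add: mult.assoc AI)
    then show ?thesis using key[OF d(1) refl] unfolding d(2) P_def by (simp only: mult.assoc)
  qed
  obtain \<xi> where xi: "norm \<xi> = 1" "\<xi> \<bullet> (H y *v \<xi>) \<le> - \<theta> * (d \<bullet> (H y *v d))"
    using saddle_onD(3)[OF sad \<open>y \<in> S\<close>] d(1) by (auto simp: elliptic_matrix_def)
  have "P * (- 2) \<le> P * (4 * (real m + 2) * ((y - z) \<bullet> \<xi>)\<^sup>2 * I - 2)"
    using P I by (intro mult_left_mono) auto
  also have "\<dots> \<le> \<xi> \<bullet> (H y *v \<xi>)" using key[OF xi(1) refl] by (simp add: P_def mult.assoc)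
  also have "\<dots> \<le> - \<theta> * (P * (4 * real m + 6))"
    using xi(2) mult_left_mono[OF rad less_imp_le[OF saddle_on_pos[OF sad]]] by simp
  finally have "P * (\<theta> * (2 * real m + 3)) \<le> P * 1" by (simp add: algebra_simps)
  then have "\<theta> * (2 * real m + 3) \<le> 1" using P by (simp only: mult_le_cancel_left_pos)
  then show False using m by linarith
qed

text \<open>The barrier that is \<open>0\<close> on the sphere of radius \<open>\<rho>\<close> and \<open>1\<close> on that of radius \<open>\<rho> / 8\<close> takes this
  value at radius \<open>3 \<rho> / 4\<close>.\<close>

definition barrier_const :: "nat \<Rightarrow> real" where
  "barrier_const m = ((16 / 9) ^ Suc m - 1) / (64 ^ Suc m - 1)"

lemma barrier_const: "0 < barrier_const m" "barrier_const m \<le> 1"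
proof -
  have "(1::real) < (16 / 9) ^ Suc m" by (rule one_less_power) auto
  moreover have "(16 / 9 :: real) ^ Suc m \<le> 64 ^ Suc m" by (rule power_mono) auto
  ultimately show "0 < barrier_const m" "barrier_const m \<le> 1"
    unfolding barrier_const_def
    by (auto intro!: divide_pos_pos simp: divide_le_eq_1 simp del: power_Suc)
qed

text \<open>Let \<open>\<phi>\<close> be the barrier. Over the closure of the component of
  \<open>{u < \<tau> * \<phi>}\<close> through \<open>y\<close>, the minimum of
  \<open>u - \<tau> * \<phi>\<close> is negative. It is not attained inside, by the touching lemma,
  nor on the free boundary, where the difference is not negative, nor on the outer sphere, where
  \<open>\<phi> = 0 \<le> u\<close>. So the component comes down to radius
  \<open>\<rho> / 8\<close>, and it lies in \<open>{u < \<tau>}\<close> because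
  \<open>\<phi> < 1\<close>.\<close>

lemma low_point_connects_to_small_ball:
  fixes u :: "real ^ 'n \<Rightarrow> real"
  assumes sad: "saddle_on \<theta> S u g H" and m: "1 < \<theta> * (2 * real m + 3)" and "0 < \<rho>" "0 < \<tau>"
    and cb: "cball z \<rho> \<subseteq> S" and nonneg: "\<And>x. x \<in> cball z \<rho> \<Longrightarrow> 0 \<le> u x"
    and y: "norm (y - z) \<le> 3 / 4 * \<rho>" "u y < \<tau> * barrier_const m"
  obtains y' where "norm (y' - z) < \<rho> / 4" "path_component {x. norm (x - z) < \<rho> \<and> u x < \<tau>} y y'"
proof -
  define V where "V = {x. norm (x - z) < \<rho> \<and> u x < \<tau>}"
  have contu: "continuous_on (cball z \<rho>) u"
    by (rule continuous_on_subset[OF saddle_on_continuous[OF sad] cb])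
  have op: "open {x \<in> T. f x < (h x :: real)}" if "continuous_on T f" "continuous_on T h" "open T"
    for f h and T :: "(real ^ 'n) set"
  proof -
    have "open (T \<inter> (\<lambda>x. h x - f x) -` {0<..})"
      using that by (intro continuous_open_preimage continuous_intros) auto
    moreover have "T \<inter> (\<lambda>x. h x - f x) -` {0<..} = {x \<in> T. f x < h x}" by auto
    ultimately show ?thesis by simp
  qed
  have "continuous_on (ball z \<rho>) u" by (rule continuous_on_subset[OF contu]) auto
  then have oV: "open V"
    using op[of "ball z \<rho>" u "\<lambda>_. \<tau>"] by (simp add: V_def dist_norm norm_minus_commute)
  have uy: "u y < \<tau>" using y(2) barrier_const[of m] \<open>0 < \<tau>\<close>
    by (metis less_le_trans mult_left_le less_imp_le)
  have yV: "y \<in> V" using y(1) \<open>0 < \<rho>\<close> uy by (simp add: V_def)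
  show ?thesis
  proof (cases "norm (y - z) < \<rho> / 4")
    case True
    have "path_component V y y" using yV by (rule path_component_refl)
    then show ?thesis using that[OF True] by (simp add: V_def)
  next
    case False
    define K where "K = (64::real) ^ Suc m - 1"
    have K: "K > 0" unfolding K_def using one_less_power[of "64::real" "Suc m"] by simp
    define \<phi> where "\<phi> x = ((\<rho>\<^sup>2 / (norm (x - z))\<^sup>2) ^ Suc m - 1) / K" for x
    \<comment> \<open>With \<open>c\<close>, the function \<open>\<tau> * \<phi>\<close> becomes a
      pure power minus the constant \<open>\<tau> / K\<close>, the shape that the touching lemma
      expects.\<close>
    define c where "c = \<tau> * (\<rho>\<^sup>2) ^ Suc m / K"
    have c: "c > 0" using \<open>0 < \<tau>\<close> \<open>0 < \<rho>\<close> K by (simp add: c_def)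
    have \<phi>c: "\<tau> * \<phi> x = c * (1 / (norm (x - z))\<^sup>2) ^ Suc m - \<tau> / K" for x
      by (simp add: \<phi>_def c_def power_divide diff_divide_distrib right_diff_distrib del: power_Suc)
    define T where "T = {x. \<rho> / 8 < norm (x - z) \<and> norm (x - z) < \<rho>}"
    define T' where "T' = {x. \<rho> / 8 \<le> norm (x - z) \<and> norm (x - z) \<le> \<rho>}"
    have oT: "open T" unfolding T_def by (intro open_Collect_conj open_Collect_less continuous_intros)
    have cT': "closed T'" unfolding T'_def by (intro closed_Collect_conj closed_Collect_le continuous_intros)
    have TT': "T \<subseteq> T'" by (auto simp: T_def T'_def)
    have T'cb: "T' \<subseteq> cball z \<rho>" by (auto simp: T'_def dist_norm norm_minus_commute)
    have c\<phi>: "continuous_on T' \<phi>" unfolding \<phi>_def using K \<open>0 < \<rho>\<close>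
      by (intro continuous_intros) (auto simp: T'_def)
    have cuT': "continuous_on T' u" by (rule continuous_on_subset[OF contu T'cb])
    define W where "W = {x \<in> T. u x < \<tau> * \<phi> x}"
    have oW: "open W" unfolding W_def
      by (intro op oT continuous_intros continuous_on_subset[OF c\<phi> TT'] continuous_on_subset[OF cuT' TT'])
    have \<phi>1: "\<phi> x < 1" if "x \<in> T" for x
    proof -
      have "\<rho>\<^sup>2 < (8 * norm (x - z))\<^sup>2" using that \<open>0 < \<rho>\<close> by (intro power_strict_mono) (auto simp: T_def)
      then have "\<rho>\<^sup>2 / (norm (x - z))\<^sup>2 < 64" using that \<open>0 < \<rho>\<close>
        by (simp add: T_def power_mult_distrib divide_less_eq zero_less_power2)
      then have "(\<rho>\<^sup>2 / (norm (x - z))\<^sup>2) ^ Suc m < 64 ^ Suc m" by (intro power_strict_mono) auto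
      then show ?thesis using K by (simp add: \<phi>_def K_def divide_less_eq del: power_Suc)
    qed
    have y\<phi>: "barrier_const m \<le> \<phi> y"
    proof -
      have "(4 * norm (y - z))\<^sup>2 \<le> (3 * \<rho>)\<^sup>2" using y(1) by (intro power_mono) auto
      moreover have "norm (y - z) > 0" using False \<open>0 < \<rho>\<close> by auto
      ultimately have "16 / 9 \<le> \<rho>\<^sup>2 / (norm (y - z))\<^sup>2" by (simp add: power_mult_distrib le_divide_eq)
      then have "(16 / 9) ^ Suc m \<le> (\<rho>\<^sup>2 / (norm (y - z))\<^sup>2) ^ Suc m" by (intro power_mono) auto
      then show ?thesis using K by (simp add: \<phi>_def barrier_const_def K_def[symmetric] divide_right_mono del: power_Suc)
    qed
    have yW: "y \<in> W"
    proof -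
      have "\<tau> * barrier_const m \<le> \<tau> * \<phi> y" using y\<phi> \<open>0 < \<tau>\<close> by (intro mult_left_mono) auto
      then show ?thesis using y False \<open>0 < \<rho>\<close> by (simp add: W_def T_def)
    qed
    let ?C = "connected_component_set W y"
    have oC: "open ?C" by (rule open_connected_component[OF oW])
    have CW: "?C \<subseteq> W" by (rule connected_component_subset)
    have CT': "closure ?C \<subseteq> T'"
      by (rule closure_minimal[OF _ cT']) (use CW TT' in \<open>auto simp: W_def\<close>)
    have "bounded T'" by (rule bounded_subset[OF bounded_cball T'cb])
    then have cpt: "compact (closure ?C)"
      using bounded_subset[OF _ CT'] by (simp add: compact_eq_bounded_closed)
    have cont: "continuous_on (closure ?C) (\<lambda>x. u x - \<tau> * \<phi> x)"
      by (intro continuous_intros continuous_on_subset[OF c\<phi> CT'] continuous_on_subset[OF cuT' CT'])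
    have yC: "y \<in> ?C" using yW by simp
    then have ycl: "y \<in> closure ?C" using closure_subset by (rule subsetD[rotated])
    obtain w where w: "w \<in> closure ?C" "\<And>x. x \<in> closure ?C \<Longrightarrow> u w - \<tau> * \<phi> w \<le> u x - \<tau> * \<phi> x"
      using continuous_attains_inf[OF cpt _ cont] ycl by (metis empty_iff)
    have wneg: "u w - \<tau> * \<phi> w < 0" using w(2)[OF ycl] yW by (simp add: W_def)
    have "w \<notin> ?C"
    proof
      assume wC: "w \<in> ?C"
      have CS: "?C \<subseteq> S" using CW TT' T'cb cb by (auto simp: W_def)
      have "w \<noteq> z" using wC CW \<open>0 < \<rho>\<close> by (auto simp: W_def T_def)
      show False
      proof (rule saddle_on_no_touching_barrier[OF saddle_on_subset[OF sad CS] oC wC \<open>w \<noteq> z\<close> c m])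
        fix x assume "x \<in> ?C"
        then have "x \<in> closure ?C" using closure_subset by (rule subsetD[rotated])
        from w(2)[OF this] show "u w - c * (1 / (norm (w - z))\<^sup>2) ^ Suc m \<le> u x - c * (1 / (norm (x - z))\<^sup>2) ^ Suc m"
          by (simp add: \<phi>c del: power_Suc)
      qed
    qed
    then have "w \<in> frontier ?C" using w(1) oC by (simp add: frontier_def interior_open)
    then have "w \<in> frontier W" using frontier_of_connected_component_subset by (rule subsetD[rotated])
    then have "w \<notin> W" using oW by (simp add: frontier_def interior_open)
    then have wT: "w \<notin> T" using wneg by (simp add: W_def)
    have wT': "w \<in> T'" using w(1) CT' by (rule subsetD[rotated])
    have "norm (w - z) \<noteq> \<rho>"
    proof
      assume "norm (w - z) = \<rho>"
      then have "\<phi> w = 0" using \<open>0 < \<rho>\<close> by (simp add: \<phi>_def)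
      then show False using wneg nonneg[of w] wT' T'cb by (auto simp: subset_iff)
    qed
    then have w8: "norm (w - z) = \<rho> / 8" using wT wT' by (auto simp: T_def T'_def)
    obtain y' where y': "y' \<in> ?C" "dist y' w < \<rho> / 8"
      using w(1)[unfolded closure_approachable, rule_format, of "\<rho> / 8"] \<open>0 < \<rho>\<close> by auto
    have "norm (y' - z) < \<rho> / 4"
      using norm_triangle_ineq[of "y' - w" "w - z"] y'(2) w8 by (simp add: dist_norm)
    moreover have "W \<subseteq> V"
    proof
      fix x assume x: "x \<in> W"
      then have "\<tau> * \<phi> x < \<tau> * 1" using \<phi>1[of x] \<open>0 < \<tau>\<close> by (intro mult_strict_left_mono) (auto simp: W_def)
      then show "x \<in> V" using x by (auto simp: W_def V_def T_def)
    qed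
    then have "connected_component V y y'" using y'(1) connected_component_of_subset by fastforce
    then have "path_component V y y'" by (simp add: open_path_connected_component[OF oV])
    ultimately show ?thesis using that by (simp add: V_def)
  qed
qed

text \<open>Each disc costs one factor \<open>barrier_const m\<close>. Centres at most
  \<open>\<rho> / 2\<close> apart put a point within \<open>\<rho> / 4\<close> of one centre within
  \<open>3 / 4 * \<rho>\<close> of the next, where the preceding lemma starts.\<close>

lemma low_point_connects_along_chain:
  fixes u :: "real ^ 'n \<Rightarrow> real" and c :: "nat \<Rightarrow> real ^ 'n"
  assumes sad: "saddle_on \<theta> S u g H" and m: "1 < \<theta> * (2 * real m + 3)" and "0 < \<rho>"
    and nonneg: "\<And>x. x \<in> S \<Longrightarrow> 0 \<le> u x"
    and cb: "\<And>i. i \<le> N \<Longrightarrow> cball (c i) \<rho> \<subseteq> S"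
    and step: "\<And>i. i < N \<Longrightarrow> norm (c (Suc i) - c i) \<le> \<rho> / 2"
    and "0 < \<tau>" "norm (y - c 0) < \<rho> / 4" "u y < \<tau> * barrier_const m ^ N"
  shows "\<exists>y'. norm (y' - c N) < \<rho> / 4 \<and> path_component {x. u x < \<tau> \<and> (\<exists>i\<le>N. norm (x - c i) < \<rho>)} y y'"
  using cb step \<open>0 < \<tau>\<close> \<open>norm (y - c 0) < \<rho> / 4\<close> \<open>u y < \<tau> * barrier_const m ^ N\<close>
proof (induction N arbitrary: \<tau>)
  case 0
  have "y \<in> {x. u x < \<tau> \<and> (\<exists>i\<le>0. norm (x - c i) < \<rho>)}" using 0 \<open>0 < \<rho>\<close> by auto
  from path_component_refl[OF this] show ?case using 0 by (intro exI[of _ y]) simp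
next
  case (Suc N)
  let ?\<eta> = "barrier_const m"
  have "0 < \<tau> * ?\<eta>" using Suc.prems(3) barrier_const(1) by simp
  then obtain y1 where y1: "norm (y1 - c N) < \<rho> / 4"
      "path_component {x. u x < \<tau> * ?\<eta> \<and> (\<exists>i\<le>N. norm (x - c i) < \<rho>)} y y1"
    using Suc.IH[of "\<tau> * ?\<eta>"] Suc.prems(1,2,4,5) by (auto simp: mult.assoc)
  have uy1: "u y1 < \<tau> * ?\<eta>" using path_component_mem(2)[OF y1(2)] by simp
  have near: "norm (y1 - c (Suc N)) \<le> 3 / 4 * \<rho>"
    using norm_triangle_ineq[of "y1 - c N" "c N - c (Suc N)"] y1(1) Suc.prems(2)[of N]
    by (simp add: norm_minus_commute)
  have nn: "0 \<le> u x" if "x \<in> cball (c (Suc N)) \<rho>" for x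
    using nonneg Suc.prems(1)[of "Suc N"] that by blast
  obtain y' where y': "norm (y' - c (Suc N)) < \<rho> / 4"
      "path_component {x. norm (x - c (Suc N)) < \<rho> \<and> u x < \<tau>} y1 y'"
    by (rule low_point_connects_to_small_ball[OF sad m \<open>0 < \<rho>\<close> Suc.prems(3) Suc.prems(1)[OF order_refl] nn near uy1])
  have "\<tau> * ?\<eta> \<le> \<tau>" using Suc.prems(3) barrier_const[of m] by (simp add: mult_left_le)
  then have "u x < \<tau> \<and> (\<exists>i\<le>Suc N. norm (x - c i) < \<rho>)"
    if "u x < \<tau> * ?\<eta> \<and> (\<exists>i\<le>N. norm (x - c i) < \<rho>)" for x
    using that by (meson le_SucI less_le_trans)
  then have pc1: "path_component {x. u x < \<tau> \<and> (\<exists>i\<le>Suc N. norm (x - c i) < \<rho>)} y y1"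
    by (intro path_component_of_subset[OF _ y1(2)] Collect_mono impI)
  have pc2: "path_component {x. u x < \<tau> \<and> (\<exists>i\<le>Suc N. norm (x - c i) < \<rho>)} y1 y'"
    by (rule path_component_of_subset[OF _ y'(2)]) auto
  show ?case using y'(1) path_component_trans[OF pc1 pc2] by blast
qed

lemma low_point_connects_along_segment:
  fixes u :: "real ^ 'n \<Rightarrow> real" and z w :: "real ^ 'n"
  assumes sad: "saddle_on \<theta> S u g H" and m: "1 < \<theta> * (2 * real m + 3)" and "0 < \<rho>"
    and nonneg: "\<And>x. x \<in> S \<Longrightarrow> 0 \<le> u x"
    and cb: "\<And>c. c \<in> closed_segment z w \<Longrightarrow> cball c \<rho> \<subseteq> S"
    and len: "norm (w - z) \<le> 16 * \<rho>"
    and "0 < \<tau>" "norm (y - z) < \<rho> / 4" "u y < \<tau> * barrier_const m ^ 32"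
  obtains y' where "norm (y' - w) < \<rho> / 4"
    "path_component {x. u x < \<tau> \<and> (\<exists>c\<in>closed_segment z w. norm (x - c) < \<rho>)} y y'"
proof -
  \<comment> \<open>32 steps of length at most \<open>\<rho> / 2\<close> cover a segment of length
    \<open>16 * \<rho>\<close>.\<close>
  define c where "c i = z + (real i / 32) *\<^sub>R (w - z)" for i :: nat
  have seg: "c i \<in> closed_segment z w" if "i \<le> 32" for i
    unfolding in_segment c_def using that by (intro exI[of _ "real i / 32"]) (auto simp: algebra_simps)
  have step: "norm (c (Suc i) - c i) \<le> \<rho> / 2" for i
  proof -
    have "c (Suc i) - c i = (1 / 32) *\<^sub>R (w - z)"
      by (simp add: c_def add_divide_distrib scaleR_add_left)
    then show ?thesis using len by simp
  qed
  have "c 0 = z" "c 32 = w" by (simp_all add: c_def)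
  then obtain y' where y': "norm (y' - w) < \<rho> / 4"
      "path_component {x. u x < \<tau> \<and> (\<exists>i\<le>32. norm (x - c i) < \<rho>)} y y'"
    using low_point_connects_along_chain[OF sad m \<open>0 < \<rho>\<close> nonneg, of 32 c \<tau> y] cb seg step assms(7-9)
    by auto
  show ?thesis
    by (rule that[OF y'(1) path_component_of_subset[OF _ y'(2)]]) (use seg in blast)
qed

section \<open>Low chains that block paths across an annulus\<close>

lemma orthonormal_frame_inj:
  fixes f h x y :: "real ^ 2"
  assumes "norm f = 1" "norm h = 1" "f \<bullet> h = 0" and "x \<bullet> f = y \<bullet> f" "x \<bullet> h = y \<bullet> h"
  shows "x = y"
proof -
  define d where "d = x - y"
  have d: "d $ 1 * f $ 1 + d $ 2 * f $ 2 = 0" "d $ 1 * h $ 1 + d $ 2 * h $ 2 = 0"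
    using assms(4,5) by (simp_all add: d_def inner_vec_def sum_2 algebra_simps)
  have fh: "(f $ 1)\<^sup>2 + (f $ 2)\<^sup>2 = 1" "(h $ 1)\<^sup>2 + (h $ 2)\<^sup>2 = 1" "f $ 1 * h $ 1 + f $ 2 * h $ 2 = 0"
    using assms(1-3) by (simp_all add: norm_2_eq_1_iff inner_vec_def sum_2)
  define D where "D = f $ 1 * h $ 2 - f $ 2 * h $ 1"
  have "D\<^sup>2 = ((f $ 1)\<^sup>2 + (f $ 2)\<^sup>2) * ((h $ 1)\<^sup>2 + (h $ 2)\<^sup>2) - (f $ 1 * h $ 1 + f $ 2 * h $ 2)\<^sup>2"
    unfolding D_def power2_eq_square by (simp add: algebra_simps)
  then have "D \<noteq> 0" using fh by auto
  moreover have "d $ 1 * D = (d $ 1 * f $ 1 + d $ 2 * f $ 2) * h $ 2 - (d $ 1 * h $ 1 + d $ 2 * h $ 2) * f $ 2"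
    "d $ 2 * D = (d $ 1 * h $ 1 + d $ 2 * h $ 2) * f $ 1 - (d $ 1 * f $ 1 + d $ 2 * f $ 2) * h $ 1"
    by (simp_all add: D_def algebra_simps)
  then have "d $ 1 * D = 0" "d $ 2 * D = 0" unfolding d by simp_all
  ultimately have "d = 0" by (simp add: vec_eq_iff forall_2)
  then show ?thesis by (simp add: d_def)
qed

text \<open>The low path stays near the middle line \<open>x \<bullet> f = 2 * s\<close> of a strip
  and runs past both ends of a rectangle in it; \<open>\<Gamma>\<close> traverses that rectangle in
  the direction \<open>f\<close>. So they meet, at a point where both \<open>u < \<tau>\<close> and
  \<open>\<tau> \<le> u\<close>.\<close>

lemma rectangle_blocked:
  fixes u :: "real ^ 2 \<Rightarrow> real" and f h :: "real ^ 2" and \<Gamma> :: "real \<Rightarrow> real ^ 2"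
  assumes fh: "norm f = 1" "norm h = 1" "f \<bullet> h = 0" and "0 < s"
    and pc: "path_component {x. u x < \<tau> \<and> (\<exists>c\<in>closed_segment ((2 * s) *\<^sub>R f + (4 * s) *\<^sub>R h) ((2 * s) *\<^sub>R f - (4 * s) *\<^sub>R h). norm (x - c) < s / 2)} y y'"
    and y: "norm (y - ((2 * s) *\<^sub>R f + (4 * s) *\<^sub>R h)) < s / 8"
    and y': "norm (y' - ((2 * s) *\<^sub>R f - (4 * s) *\<^sub>R h)) < s / 8"
    and \<Gamma>: "path \<Gamma>" "\<And>x. x \<in> path_image \<Gamma> \<Longrightarrow> \<tau> \<le> u x \<and> \<bar>x \<bullet> h\<bar> \<le> 3 * s"
    and ends: "pathstart \<Gamma> \<bullet> f \<le> s" "3 * s \<le> pathfinish \<Gamma> \<bullet> f"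
  shows False
proof -
  obtain \<sigma> where \<sigma>: "path \<sigma>" "pathstart \<sigma> = y" "pathfinish \<sigma> = y'"
    and im: "\<And>x. x \<in> path_image \<sigma> \<Longrightarrow> u x < \<tau> \<and> (\<exists>c\<in>closed_segment ((2 * s) *\<^sub>R f + (4 * s) *\<^sub>R h) ((2 * s) *\<^sub>R f - (4 * s) *\<^sub>R h). norm (x - c) < s / 2)"
    using pc unfolding path_component_def by blast
  define M where "M x = (\<chi> i. if i = (1 :: 2) then - (x \<bullet> h) else x \<bullet> f)" for x :: "real ^ 2"
  have M: "M x $ 1 = - (x \<bullet> h)" "M x $ 2 = x \<bullet> f" for x by (simp_all add: M_def)
  have contM: "continuous_on T M" for T
  proof (subst continuous_on_componentwise, intro ballI)
    fix b' :: "real ^ 2" assume "b' \<in> Basis"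
    then obtain i where "b' = axis i 1" by (auto simp: Basis_vec_def)
    then show "continuous_on T (\<lambda>x. M x \<bullet> b')"
      by (cases "i = 1") (auto simp: inner_axis M_def intro!: continuous_intros)
  qed
  have fh': "f \<bullet> f = 1" "h \<bullet> h = 1" "h \<bullet> f = 0" using fh by (auto simp: norm_eq_1 inner_commute)
  have close: "\<bar>x \<bullet> e - c \<bullet> e\<bar> < r" if "norm (x - c) < r" "norm e = 1" for x c e :: "real ^ 2" and r
    using Cauchy_Schwarz_ineq2[of "x - c" e] that by (simp add: inner_diff_left)
  have strip: "s < x \<bullet> f \<and> x \<bullet> f < 3 * s" if x: "x \<in> path_image \<sigma>" for x
  proof -
    obtain c where c: "c \<in> closed_segment ((2 * s) *\<^sub>R f + (4 * s) *\<^sub>R h) ((2 * s) *\<^sub>R f - (4 * s) *\<^sub>R h)" "norm (x - c) < s / 2"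
      using im[OF x] by blast
    obtain t where "c = (1 - t) *\<^sub>R ((2 * s) *\<^sub>R f + (4 * s) *\<^sub>R h) + t *\<^sub>R ((2 * s) *\<^sub>R f - (4 * s) *\<^sub>R h)"
      using c(1) by (auto simp: in_segment)
    then have "c \<bullet> f = (1 - t) * (2 * s) + t * (2 * s)"
      by (simp only: inner_add_left inner_diff_left inner_scaleR_left fh') simp
    then have "c \<bullet> f = 2 * s" by (simp add: algebra_simps)
    then show ?thesis using close[OF c(2) fh(1)] \<open>0 < s\<close> by (intro conjI) linarith+
  qed
  obtain z where z: "z \<in> path_image (M \<circ> \<sigma>)" "z \<in> path_image (M \<circ> \<Gamma>)"
  proof (rule crossing_paths_meet)
    show "path (M \<circ> \<sigma>)" "path (M \<circ> \<Gamma>)"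
      using \<sigma>(1) \<Gamma>(1) contM by (auto intro!: path_continuous_image)
    \<comment> \<open>\<open>7 / 2 * s\<close> separates the bound \<open>3 * s\<close> along
      \<open>\<Gamma>\<close> from the ends of \<open>\<sigma>\<close>, which lie beyond
      \<open>4 * s - s / 8\<close>.\<close>
    show "- (7 / 2 * s) \<le> 7 / 2 * s" "s \<le> 3 * s" using \<open>0 < s\<close> by auto
    show "s < x $ 2 \<and> x $ 2 < 3 * s" if "x \<in> path_image (M \<circ> \<sigma>)" for x
      using that strip by (auto simp: path_image_compose M)
    show "- (7 / 2 * s) < x $ 1 \<and> x $ 1 < 7 / 2 * s" if "x \<in> path_image (M \<circ> \<Gamma>)" for x
      using that \<Gamma>(2) \<open>0 < s\<close> by (fastforce simp: path_image_compose M abs_le_iff)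
    have "\<bar>y \<bullet> h - 4 * s\<bar> < s / 8"
      using close[OF y fh(2)] by (simp add: inner_add_left fh' fh)
    then show "pathstart (M \<circ> \<sigma>) $ 1 \<le> - (7 / 2 * s)"
      unfolding pathstart_compose M \<sigma> using \<open>0 < s\<close> by linarith
    have "\<bar>y' \<bullet> h + 4 * s\<bar> < s / 8"
      using close[OF y' fh(2)] by (simp add: inner_diff_left fh' fh)
    then show "7 / 2 * s \<le> pathfinish (M \<circ> \<sigma>) $ 1"
      unfolding pathfinish_compose M \<sigma> using \<open>0 < s\<close> by linarith
    show "pathstart (M \<circ> \<Gamma>) $ 2 \<le> s" "3 * s \<le> pathfinish (M \<circ> \<Gamma>) $ 2"
      using ends by (simp_all add: pathstart_compose pathfinish_compose M)
  qed
  then obtain a b where ab: "a \<in> path_image \<sigma>" "b \<in> path_image \<Gamma>" "M a = M b"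
    by (auto simp: path_image_compose)
  have "a \<bullet> h = b \<bullet> h" "a \<bullet> f = b \<bullet> f" using M[of a] M[of b] ab(3) by simp_all
  then have "a = b" using orthonormal_frame_inj[OF fh] by blast
  then have "u a = u b" by simp
  then show False using conjunct1[OF im[OF ab(1)]] conjunct1[OF \<Gamma>(2)[OF ab(2)]] by linarith
qed

text \<open>A low point on the circle of radius \<open>s\<close> is joined, through low points, across each of four
  rectangles surrounding the disc of radius \<open>s\<close>, and so separates that disc from the outside.\<close>

lemma low_point_blocks_crossing:
  fixes u :: "real ^ 2 \<Rightarrow> real" and \<Gamma> :: "real \<Rightarrow> real ^ 2"
  assumes sad: "saddle_on \<theta> {x. R \<le> norm x} u g H" and m: "1 < \<theta> * (2 * real m + 3)"
    and "0 < R" and s: "2 * R \<le> s"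
    and nonneg: "\<And>x. R \<le> norm x \<Longrightarrow> 0 \<le> u x" and "0 < \<tau>"
    and \<Gamma>: "path \<Gamma>" "\<And>x. x \<in> path_image \<Gamma> \<Longrightarrow> \<tau> \<le> u x"
    and ends: "norm (pathstart \<Gamma>) \<le> s" "5 * s \<le> norm (pathfinish \<Gamma>)"
    and y: "norm y = s"
  shows "\<tau> * barrier_const m ^ 128 \<le> u y"
proof (rule ccontr)
  assume low: "\<not> \<tau> * barrier_const m ^ 128 \<le> u y"
  define b where "b = barrier_const m"
  have b: "0 < b" "b \<le> 1" using barrier_const by (simp_all add: b_def)
  have s0: "0 < s" using \<open>0 < R\<close> s by linarith
  define e where "e = (1 / s) *\<^sub>R y"
  define k :: "real ^ 2" where "k = vector [- (e $ 2), e $ 1]"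
  have e1: "norm e = 1" using y s0 by (simp add: e_def)
  have k1: "norm k = 1" using e1 by (simp add: k_def norm_2_eq_1_iff add.commute)
  have ek: "e \<bullet> k = 0" by (simp add: k_def inner_vec_def sum_2)
  have ip: "e \<bullet> e = 1" "k \<bullet> k = 1" "e \<bullet> k = 0" "k \<bullet> e = 0"
    using e1 k1 ek by (auto simp: norm_eq_1 inner_commute)
  have pyth: "(norm x)\<^sup>2 = (x \<bullet> e)\<^sup>2 + (x \<bullet> k)\<^sup>2" for x
  proof -
    have "(x \<bullet> e)\<^sup>2 + (x \<bullet> k)\<^sup>2 = ((e $ 1)\<^sup>2 + (e $ 2)\<^sup>2) * ((x $ 1)\<^sup>2 + (x $ 2)\<^sup>2)"
      by (simp add: k_def inner_vec_def sum_2 power2_eq_square algebra_simps)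
    also have "\<dots> = (norm x)\<^sup>2"
      using e1 unfolding norm_2_eq_1_iff by (simp add: norm_vec_def L2_set_def sum_2)
    finally show ?thesis by simp
  qed
  \<comment> \<open>A low point somewhere in the small disc around \<open>p\<close>: the form in
    which lowness is handed from one segment to the next.\<close>
  define P where "P p t \<longleftrightarrow> (\<exists>y. norm (y - p) < s / 8 \<and> u y < t)" for p t
  have P_mono: "P p t'" if "P p t" "t \<le> t'" for p t t' using that unfolding P_def by force
  \<comment> \<open>Discs of radius \<open>s / 2\<close> centred on a segment in the half-plane
    \<open>s \<le> x \<bullet> d\<close> stay in \<open>norm x \<ge> s / 2 \<ge> R\<close>. For this
    radius a chain of 32 steps covers length \<open>8 * s\<close>.\<close>
  have walk: "P q t \<and> (\<exists>y y'. norm (y - p) < s / 8 \<and> norm (y' - q) < s / 8 \<and>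
      path_component {x. u x < t \<and> (\<exists>c\<in>closed_segment p q. norm (x - c) < s / 2)} y y')"
    if P: "P p (t * b ^ 32)" and "0 < t" and d: "norm d = 1" "s \<le> p \<bullet> d" "s \<le> q \<bullet> d" and len: "norm (q - p) \<le> 8 * s"
    for p q d t
  proof -
    obtain y where yp: "norm (y - p) < (s / 2) / 4" and ut: "u y < t * barrier_const m ^ 32"
      using P by (auto simp: P_def b_def)
    have cb: "cball c (s / 2) \<subseteq> {x. R \<le> norm x}" if c: "c \<in> closed_segment p q" for c
    proof
      fix x assume x: "x \<in> cball c (s / 2)"
      obtain r where r: "0 \<le> r" "r \<le> 1" "c = (1 - r) *\<^sub>R p + r *\<^sub>R q" using c by (auto simp: in_segment)
      have "(1 - r) * s + r * s \<le> (1 - r) * (p \<bullet> d) + r * (q \<bullet> d)"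
        using r d by (intro add_mono mult_left_mono) auto
      then have "s \<le> c \<bullet> d" by (simp add: r(3) inner_add_left algebra_simps)
      also have "\<dots> \<le> norm c" using norm_cauchy_schwarz[of c d] d(1) by simp
      finally have "s \<le> norm c" .
      then show "x \<in> {x. R \<le> norm x}"
        using x norm_triangle_ineq2[of c x] s by (simp add: dist_norm)
    qed
    have s2: "0 < s / 2" using s0 by simp
    have len': "norm (q - p) \<le> 16 * (s / 2)" using len by simp
    have nn: "0 \<le> u x" if "x \<in> {x. R \<le> norm x}" for x using nonneg that by simp
    obtain y' where y': "norm (y' - q) < (s / 2) / 4"
        "path_component {x. u x < t \<and> (\<exists>c\<in>closed_segment p q. norm (x - c) < s / 2)} y y'"
      by (rule low_point_connects_along_segment[OF sad m s2 nn cb len' \<open>0 < t\<close> yp ut])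
    have "u y' < t" using path_component_mem(2)[OF y'(2)] by simp
    then have "P q t" using y'(1) unfolding P_def by auto
    then show ?thesis using yp y' by auto
  qed
  \<comment> \<open>The end of \<open>\<Gamma>\<close> lies outside this square, whose half diagonal
    \<open>3 * sqrt 2 * s\<close> is below \<open>5 * s\<close>. The side through which
    \<open>\<Gamma>\<close> first leaves selects the rectangle to be blocked.\<close>
  define B where "B = {x. \<bar>x \<bullet> e\<bar> \<le> 3 * s \<and> \<bar>x \<bullet> k\<bar> \<le> 3 * s}"
  have cB: "closed B" unfolding B_def by (intro closed_Collect_conj closed_Collect_le continuous_intros)
  have comp: "\<bar>x \<bullet> e\<bar> \<le> norm x" "\<bar>x \<bullet> k\<bar> \<le> norm x" for x
    using Cauchy_Schwarz_ineq2[of x e] Cauchy_Schwarz_ineq2[of x k] e1 k1 by simp_all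
  have "pathstart \<Gamma> \<in> B" using comp[of "pathstart \<Gamma>"] ends(1) s0 by (simp add: B_def)
  moreover have "pathfinish \<Gamma> \<notin> B"
  proof
    assume "pathfinish \<Gamma> \<in> B"
    then have "\<bar>pathfinish \<Gamma> \<bullet> e\<bar> \<le> \<bar>3 * s\<bar>" "\<bar>pathfinish \<Gamma> \<bullet> k\<bar> \<le> \<bar>3 * s\<bar>"
      using s0 by (auto simp: B_def)
    then have "(pathfinish \<Gamma> \<bullet> e)\<^sup>2 \<le> (3 * s)\<^sup>2" "(pathfinish \<Gamma> \<bullet> k)\<^sup>2 \<le> (3 * s)\<^sup>2"
      unfolding abs_le_square_iff .
    moreover have n2: "(3 * s)\<^sup>2 = 9 * s\<^sup>2" "(5 * s)\<^sup>2 = 25 * s\<^sup>2"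
      by (simp_all add: power_mult_distrib)
    moreover have "(5 * s)\<^sup>2 \<le> (norm (pathfinish \<Gamma>))\<^sup>2" using ends(2) s0 by (intro power_mono) auto
    ultimately have "25 * s\<^sup>2 \<le> 18 * s\<^sup>2" unfolding pyth n2 by linarith
    then show False using s0 by simp
  qed
  ultimately obtain \<Gamma>' where \<Gamma>': "path \<Gamma>'" "pathstart \<Gamma>' = pathstart \<Gamma>" "path_image \<Gamma>' \<subseteq> path_image \<Gamma> \<inter> B"
      "pathfinish \<Gamma>' \<in> frontier B"
    by (rule exists_path_subpath_to_frontier_closed[OF cB \<Gamma>(1)])
  define w where "w = pathfinish \<Gamma>'"
  have "open {x. \<bar>x \<bullet> e\<bar> < 3 * s \<and> \<bar>x \<bullet> k\<bar> < 3 * s}"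
    by (intro open_Collect_conj open_Collect_less continuous_intros)
  then have "{x. \<bar>x \<bullet> e\<bar> < 3 * s \<and> \<bar>x \<bullet> k\<bar> < 3 * s} \<subseteq> interior B"
    by (rule interior_maximal[rotated]) (auto simp: B_def)
  then have "3 * s \<le> \<bar>w \<bullet> e\<bar> \<or> 3 * s \<le> \<bar>w \<bullet> k\<bar>" using \<Gamma>'(4) by (force simp: frontier_def w_def)
  then consider (1) "3 * s \<le> w \<bullet> k" | (2) "3 * s \<le> w \<bullet> (- k)" | (3) "3 * s \<le> w \<bullet> e" | (4) "3 * s \<le> w \<bullet> (- e)" by fastforce
  note exits = this
  have blocked: False
    if fh: "norm f = 1" "norm h = 1" "f \<bullet> h = 0" and h: "h = e \<or> h = k"
      and Pf: "P ((2 * s) *\<^sub>R f + (4 * s) *\<^sub>R h) (\<tau> * b ^ 32)" and wf: "3 * s \<le> w \<bullet> f" for f h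
  proof -
    have f2: "f \<bullet> f = 1" "h \<bullet> f = 0" using fh by (auto simp: norm_eq_1 inner_commute)
    have "s \<le> ((2 * s) *\<^sub>R f + (4 * s) *\<^sub>R h) \<bullet> f" "s \<le> ((2 * s) *\<^sub>R f - (4 * s) *\<^sub>R h) \<bullet> f"
      using f2 s0 by (simp_all add: inner_add_left inner_diff_left)
    moreover have "norm (((2 * s) *\<^sub>R f - (4 * s) *\<^sub>R h) - ((2 * s) *\<^sub>R f + (4 * s) *\<^sub>R h)) \<le> 8 * s"
    proof -
      have "((2 * s) *\<^sub>R f - (4 * s) *\<^sub>R h) - ((2 * s) *\<^sub>R f + (4 * s) *\<^sub>R h) = (- (8 * s)) *\<^sub>R h"
        by (simp add: algebra_simps flip: scaleR_add_left)
      then show ?thesis using fh(2) s0 by simp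
    qed
    ultimately obtain y y' where yy: "norm (y - ((2 * s) *\<^sub>R f + (4 * s) *\<^sub>R h)) < s / 8"
        "norm (y' - ((2 * s) *\<^sub>R f - (4 * s) *\<^sub>R h)) < s / 8"
        "path_component {x. u x < \<tau> \<and> (\<exists>c\<in>closed_segment ((2 * s) *\<^sub>R f + (4 * s) *\<^sub>R h) ((2 * s) *\<^sub>R f - (4 * s) *\<^sub>R h). norm (x - c) < s / 2)} y y'"
      using walk[OF Pf \<open>0 < \<tau>\<close> fh(1)] by blast
    show False
    proof (rule rectangle_blocked[OF fh s0 yy(3,1,2) \<Gamma>'(1)])
      show "\<tau> \<le> u x \<and> \<bar>x \<bullet> h\<bar> \<le> 3 * s" if "x \<in> path_image \<Gamma>'" for x
        using that \<Gamma>'(3) \<Gamma>(2) h by (auto simp: B_def)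
      have "pathstart \<Gamma> \<bullet> f \<le> norm (pathstart \<Gamma>)" using norm_cauchy_schwarz[of "pathstart \<Gamma>" f] fh(1) by simp
      then show "pathstart \<Gamma>' \<bullet> f \<le> s" using ends(1) \<Gamma>'(2) by simp
      show "3 * s \<le> pathfinish \<Gamma>' \<bullet> f" using wf by (simp add: w_def)
    qed
  qed
  have pw: "\<tau> * b ^ n * b ^ 32 = \<tau> * b ^ (n + 32)" "0 < \<tau> * b ^ n" for n
    using b(1) \<open>0 < \<tau>\<close> by (simp_all add: power_add)
  have go: "P q (\<tau> * b ^ n)"
    if "P p (\<tau> * b ^ (n + 32))" "norm d = 1" "s \<le> p \<bullet> d" "s \<le> q \<bullet> d" "q - p = r *\<^sub>R d'" "norm d' = 1" "\<bar>r\<bar> \<le> 8 * s"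
    for p q d d' n r
    using walk[of p "\<tau> * b ^ n" d q] that pw[of n] by simp
  have less: "P p (\<tau> * b ^ n)" if "P p (\<tau> * b ^ n')" "n \<le> n'" for p n n'
    by (rule P_mono[OF that(1)], intro mult_left_mono power_decreasing) (use that b \<open>0 < \<tau>\<close> in auto)
  \<comment> \<open>At most four segments of 32 steps are walked, the last one across the exit
    rectangle, whence 128. Only the side facing away from \<open>y\<close> needs all four; the other
    cases give away factors through \<open>less\<close>.\<close>
  have P0: "P (s *\<^sub>R e) (\<tau> * b ^ 128)"
    unfolding P_def using low s0 by (intro exI[of _ y]) (simp add: e_def b_def)
  have nk: "norm (- k) = 1" "norm (- e) = 1" using e1 k1 by simp_all
  have P4: "P ((4 * s) *\<^sub>R e) (\<tau> * b ^ 96)"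
    by (rule go[where p = "s *\<^sub>R e" and d = e and d' = e and r = "3 * s"])
      (use P0 e1 ip s0 in \<open>simp_all flip: scaleR_diff_left\<close>)
  have P2: "P ((2 * s) *\<^sub>R e) (\<tau> * b ^ 96)"
    by (rule go[where p = "s *\<^sub>R e" and d = e and d' = e and r = s])
      (use P0 e1 ip s0 in \<open>simp_all flip: scaleR_diff_left\<close>)
  show False using exits
  proof cases
    case 1
    have "P ((2 * s) *\<^sub>R k + (4 * s) *\<^sub>R e) (\<tau> * b ^ 64)"
      by (rule go[where p = "(4 * s) *\<^sub>R e" and d = e and d' = k and r = "2 * s"])
        (use P4 e1 k1 ip s0 in \<open>simp_all add: inner_add_left\<close>)
    then have "P ((2 * s) *\<^sub>R k + (4 * s) *\<^sub>R e) (\<tau> * b ^ 32)" by (rule less) simp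
    then show False using blocked[OF k1 e1 ip(4)] 1 by simp
  next
    case 2
    have "P ((2 * s) *\<^sub>R (- k) + (4 * s) *\<^sub>R e) (\<tau> * b ^ 64)"
      by (rule go[where p = "(4 * s) *\<^sub>R e" and d = e and d' = "- k" and r = "2 * s"])
        (use P4 e1 nk ip s0 in \<open>simp_all add: inner_diff_left\<close>)
    then have "P ((2 * s) *\<^sub>R (- k) + (4 * s) *\<^sub>R e) (\<tau> * b ^ 32)" by (rule less) simp
    then show False using blocked[OF nk(1) e1] ip 2 by simp
  next
    case 3
    have "P ((2 * s) *\<^sub>R e + (4 * s) *\<^sub>R k) (\<tau> * b ^ 64)"
      by (rule go[where p = "(2 * s) *\<^sub>R e" and d = e and d' = k and r = "4 * s"])
        (use P2 e1 k1 ip s0 in \<open>simp_all add: inner_add_left\<close>)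
    then have "P ((2 * s) *\<^sub>R e + (4 * s) *\<^sub>R k) (\<tau> * b ^ 32)" by (rule less) simp
    then show False using blocked[OF e1 k1 ip(3)] 3 by simp
  next
    case 4
    have P44: "P ((4 * s) *\<^sub>R e + (4 * s) *\<^sub>R k) (\<tau> * b ^ 64)"
      by (rule go[where p = "(4 * s) *\<^sub>R e" and d = e and d' = k and r = "4 * s"])
        (use P4 e1 k1 ip s0 in \<open>simp_all add: inner_add_left\<close>)
    have diff: "((2 * s) *\<^sub>R (- e) + (4 * s) *\<^sub>R k) - ((4 * s) *\<^sub>R e + (4 * s) *\<^sub>R k) = (6 * s) *\<^sub>R (- e)"
      by (simp add: vec_eq_iff algebra_simps)
    have "P ((2 * s) *\<^sub>R (- e) + (4 * s) *\<^sub>R k) (\<tau> * b ^ 32)"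
      by (rule go[where d = k, OF _ _ _ _ diff nk(2)])
        (use P44 k1 ip s0 in \<open>simp_all add: inner_add_left inner_diff_left\<close>)
    then show False using blocked[OF nk(2) k1] ip 4 by simp
  qed
qed

section \<open>Circles of high values and the limit\<close>

lemma saddle_on_annulus_min:
  fixes u :: "real ^ 'n \<Rightarrow> real"
  assumes sad: "saddle_on \<theta> {x. R \<le> norm x} u g H" and "R \<le> r1"
    and r1: "\<And>x. norm x = r1 \<Longrightarrow> M \<le> u x" and r2: "\<And>x. norm x = r2 \<Longrightarrow> M \<le> u x"
    and x: "r1 \<le> norm x" "norm x \<le> r2"
  shows "M \<le> u x"
proof (cases "norm x = r1 \<or> norm x = r2")
  case True
  then show ?thesis using r1 r2 by blast
next
  case False
  define C where "C = {x :: real ^ 'n. r1 < norm x \<and> norm x < r2}"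
  define K where "K = {x :: real ^ 'n. r1 \<le> norm x \<and> norm x \<le> r2}"
  have oC: "open C" unfolding C_def by (intro open_Collect_conj open_Collect_less continuous_intros)
  have "closed K" unfolding K_def by (intro closed_Collect_conj closed_Collect_le continuous_intros)
  then have CK: "closure C \<subseteq> K" by (rule closure_minimal[rotated]) (auto simp: C_def K_def)
  have "bounded C" by (rule bounded_subset[OF bounded_ball[of 0 r2]]) (auto simp: C_def)
  have "- u x \<le> - M"
  proof (rule saddle_on_max_principle[OF saddle_on_uminus[OF sad] oC \<open>bounded C\<close>])
    show "closure C \<subseteq> {x. R \<le> norm x}" using CK \<open>R \<le> r1\<close> by (auto simp: K_def)
    show "x \<in> C" using False x by (auto simp: C_def)
    fix z assume "z \<in> frontier C"
    then have "z \<in> K" "z \<notin> C" using CK oC by (auto simp: frontier_def interior_open)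
    then have "norm z = r1 \<or> norm z = r2" by (auto simp: K_def C_def)
    then show "- u z \<le> - M" using r1 r2 by auto
  qed
  then show ?thesis by simp
qed

text \<open>The component of \<open>{u > \<tau>}\<close> through \<open>p\<close> either reaches
  down to the inner circle or is unbounded. In both cases it contains a path from radius at most
  \<open>s\<close> to radius at least \<open>5 * s\<close>, with \<open>s = norm p / 5\<close> or
  \<open>s = norm p\<close>, and such a path keeps the circle of radius \<open>s\<close> from being
  very low.\<close>

lemma high_point_gives_high_circle:
  fixes u :: "real ^ 2 \<Rightarrow> real"
  assumes sad: "saddle_on \<theta> {x. R \<le> norm x} u g H" and m: "1 < \<theta> * (2 * real m + 3)" and "0 < R"
    and nonneg: "\<And>x. R \<le> norm x \<Longrightarrow> 0 \<le> u x" and "0 < \<tau>"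
    and t: "2 * R \<le> t" and p: "5 * t \<le> norm p" "\<tau> < u p"
  obtains r where "t \<le> r" "\<And>y. norm y = r \<Longrightarrow> \<tau> * barrier_const m ^ 128 \<le> u y"
proof -
  define A where "A = {x. R < norm x \<and> \<tau> < u x}"
  have oA: "open A" unfolding A_def by (rule open_superlevel[OF saddle_on_continuous[OF sad]])
  have pA: "p \<in> A" using p t \<open>0 < R\<close> by (simp add: A_def)
  have path: "\<exists>\<Gamma>. path \<Gamma> \<and> path_image \<Gamma> \<subseteq> A \<and> pathstart \<Gamma> = a \<and> pathfinish \<Gamma> = b"
    if "connected_component A a b" for a b
    using that unfolding open_path_connected_component[OF oA, symmetric] path_component_def by blast
  show ?thesis
  proof (cases "bounded (connected_component_set A p)")
    case True
    obtain z where z: "z \<in> closure (connected_component_set A p)" "norm z = R"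
      by (rule bounded_superlevel_component_reaches_sphere[OF sad A_def pA True])
    obtain w where w: "connected_component A p w" "dist w z < R"
      using z(1)[unfolded closure_approachable, rule_format, of R] \<open>0 < R\<close> by auto
    obtain \<Gamma> where \<Gamma>: "path \<Gamma>" "path_image \<Gamma> \<subseteq> A" "pathstart \<Gamma> = w" "pathfinish \<Gamma> = p"
      using path[OF connected_component_sym[OF w(1)]] by blast
    define s where "s = norm p / 5"
    have s: "t \<le> s" "2 * R \<le> s" using p t by (auto simp: s_def)
    have nw: "norm w \<le> s" using norm_triangle_ineq2[of w z] w(2) z(2) s by (simp add: dist_norm)
    show ?thesis
    proof (rule that[OF s(1)])
      fix y :: "real ^ 2" assume y: "norm y = s"
      show "\<tau> * barrier_const m ^ 128 \<le> u y"
      proof (rule low_point_blocks_crossing[OF sad m \<open>0 < R\<close> s(2) nonneg \<open>0 < \<tau>\<close> \<Gamma>(1) _ _ _ y])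
        show "\<tau> \<le> u x" if "x \<in> path_image \<Gamma>" for x using that \<Gamma>(2) by (auto simp: A_def)
      qed (use \<Gamma> nw in \<open>auto simp: s_def\<close>)
    qed
  next
    case False
    have "\<exists>w. connected_component A p w \<and> 5 * norm p < norm w"
    proof (rule ccontr)
      assume "\<not> ?thesis"
      then have "norm w \<le> 5 * norm p" if "w \<in> connected_component_set A p" for w using that by force
      then have "bounded (connected_component_set A p)" by (rule boundedI)
      then show False using False by contradiction
    qed
    then obtain w where w: "connected_component A p w" "5 * norm p < norm w" by blast
    obtain \<Gamma> where \<Gamma>: "path \<Gamma>" "path_image \<Gamma> \<subseteq> A" "pathstart \<Gamma> = p" "pathfinish \<Gamma> = w"
      using path[OF w(1)] by blast
    have s: "t \<le> norm p" "2 * R \<le> norm p" using p t \<open>0 < R\<close> by linarith+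
    show ?thesis
    proof (rule that[OF s(1)])
      fix y :: "real ^ 2" assume y: "norm y = norm p"
      show "\<tau> * barrier_const m ^ 128 \<le> u y"
      proof (rule low_point_blocks_crossing[OF sad m \<open>0 < R\<close> s(2) nonneg \<open>0 < \<tau>\<close> \<Gamma>(1) _ _ _ y])
        show "\<tau> \<le> u x" if "x \<in> path_image \<Gamma>" for x using that \<Gamma>(2) by (auto simp: A_def)
      qed (use \<Gamma> w(2) in auto)
    qed
  qed
qed

lemma saddle_on_bounded_below_tendsto:
  fixes u :: "real ^ 2 \<Rightarrow> real"
  assumes sad: "saddle_on \<theta> {x. R \<le> norm x} u g H" and "0 < R"
    and bd: "\<And>x. R \<le> norm x \<Longrightarrow> M \<le> u x"
  shows "(\<exists>L. (u \<longlongrightarrow> L) at_infinity) \<or> filterlim u at_top at_infinity"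
proof (rule disjCI)
  assume "\<not> filterlim u at_top at_infinity"
  then obtain K where K: "\<not> (\<forall>\<^sub>F x in at_infinity. K \<le> u x)" by (auto simp: filterlim_at_top)
  \<comment> \<open>\<open>Sup E\<close> is the lower limit of \<open>u\<close> at infinity. It is
    finite because \<open>u\<close> is bounded below and does not tend to infinity.\<close>
  define E where "E = {l. \<forall>\<^sub>F x in at_infinity. l \<le> u x}"
  have "M \<in> E" unfolding E_def eventually_at_infinity using bd by blast
  have EK: "l \<le> K" if "l \<in> E" for l
  proof (rule ccontr)
    assume "\<not> l \<le> K"
    moreover have "\<forall>\<^sub>F x in at_infinity. l \<le> u x" using that by (simp add: E_def)
    ultimately have "\<forall>\<^sub>F x in at_infinity. K \<le> u x" by (auto elim: eventually_mono)
    then show False using K by contradiction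
  qed
  then have bdd: "bdd_above E" by (auto simp: bdd_above_def)
  define L where "L = Sup E"
  have LE: "l \<le> L" if "l \<in> E" for l unfolding L_def using that bdd by (rule cSup_upper)
  have below: "\<forall>\<^sub>F x in at_infinity. l \<le> u x" if "l < L" for l
  proof -
    obtain l' where "l' \<in> E" "l < l'" using \<open>l < L\<close> \<open>M \<in> E\<close> bdd unfolding L_def by (metis less_cSup_iff empty_iff)
    then show ?thesis unfolding E_def by (auto elim: eventually_mono)
  qed
  have above: "\<forall>\<^sub>F x in at_infinity. u x < L + d" if "0 < d" for d
  proof (rule ccontr)
    assume freq: "\<not> (\<forall>\<^sub>F x in at_infinity. u x < L + d)"
    obtain m :: nat where "1 / \<theta> < real m" using reals_Archimedean2 by blast
    then have m: "1 < \<theta> * (2 * real m + 3)"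
    proof -
      have "1 < \<theta> * real m" using \<open>1 / \<theta> < real m\<close> saddle_on_pos[OF sad] by (simp add: field_simps)
      moreover have "\<theta> * real m \<le> \<theta> * (2 * real m + 3)" using saddle_on_pos[OF sad] by (intro mult_left_mono) auto
      ultimately show ?thesis by linarith
    qed
    \<comment> \<open>\<open>\<kappa>\<close> is what a height \<open>d\<close> guarantees on a
      whole circle. Measured from \<open>c = L - \<kappa> / 2\<close>, an eventual lower bound,
      circles with \<open>u - c \<ge> \<kappa>\<close> exceed \<open>L\<close> by
      \<open>\<kappa> / 2\<close>. The minimum principle fills in the annuli between them, and
      \<open>L\<close> would not be the lower limit.\<close>
    define \<kappa> where "\<kappa> = d * barrier_const m ^ 128"
    have \<kappa>: "0 < \<kappa>" using \<open>0 < d\<close> barrier_const(1)[of m] by (simp add: \<kappa>_def)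
    define c where "c = L - \<kappa> / 2"
    have "\<forall>\<^sub>F x in at_infinity. c \<le> u x" by (rule below) (use \<kappa> in \<open>simp add: c_def\<close>)
    then obtain R1 where R1: "\<And>x. R1 \<le> norm x \<Longrightarrow> c \<le> u x" by (auto simp: eventually_at_infinity)
    define R' where "R' = max R R1"
    have R': "0 < R'" "R \<le> R'" "R1 \<le> R'" using \<open>0 < R\<close> by (auto simp: R'_def)
    \<comment> \<open>The zero slope makes this an instance of
      \<open>saddle_on_minus_affine\<close>.\<close>
    define v where "v x = u x - 0 \<bullet> x - c" for x
    have sadv: "saddle_on \<theta> {x. R' \<le> norm x} v (\<lambda>x. g x - 0) H"
      unfolding v_def using R'(2) by (intro saddle_on_minus_affine saddle_on_subset[OF sad]) auto
    have nn: "0 \<le> v x" if "R' \<le> norm x" for x using R1[of x] R' that by (simp add: v_def)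
    have circle: "\<exists>r\<ge>t. \<forall>y. norm y = r \<longrightarrow> \<kappa> \<le> v y" if t: "2 * R' \<le> t" for t
    proof -
      obtain p where p: "5 * t \<le> norm p" "L + d \<le> u p"
        using freq unfolding eventually_at_infinity by (meson not_le)
      have "d < v p" using p(2) \<kappa> by (simp add: v_def c_def)
      then obtain r where "t \<le> r" "\<And>y. norm y = r \<Longrightarrow> d * barrier_const m ^ 128 \<le> v y"
        using high_point_gives_high_circle[OF sadv m R'(1) nn \<open>0 < d\<close> t p(1)] by blast
      then show ?thesis unfolding \<kappa>_def by blast
    qed
    obtain r1 where r1: "2 * R' \<le> r1" "\<And>y. norm y = r1 \<Longrightarrow> \<kappa> \<le> v y" using circle[OF order_refl] by blast
    have "\<kappa> \<le> v x" if x: "r1 \<le> norm x" for x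
    proof -
      have "2 * R' \<le> norm x" using r1(1) x by linarith
      then obtain r2 where r2: "norm x \<le> r2" "\<And>y. norm y = r2 \<Longrightarrow> \<kappa> \<le> v y" using circle by blast
      have "R' \<le> r1" using r1(1) R'(1) by linarith
      then show ?thesis by (rule saddle_on_annulus_min[OF sadv _ r1(2) r2(2) x r2(1)])
    qed
    then have "L + \<kappa> / 2 \<in> E"
      unfolding E_def mem_Collect_eq eventually_at_infinity by (intro exI[of _ r1]) (force simp: v_def c_def)
    then show False using LE[of "L + \<kappa> / 2"] \<kappa> by simp
  qed
  have "(u \<longlongrightarrow> L) at_infinity"
  proof (rule order_tendstoI)
    fix a assume "a < L"
    then obtain a' where "a < a'" "a' < L" using dense by blast
    then show "\<forall>\<^sub>F x in at_infinity. a < u x" using below[of a'] by (auto elim!: eventually_mono)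
  next
    fix a assume "L < a"
    then show "\<forall>\<^sub>F x in at_infinity. u x < a" using above[of "a - L"] by simp
  qed
  then show "\<exists>L. (u \<longlongrightarrow> L) at_infinity" by blast
qed

lemma saddle_on_bounded_below_ereal_limit:
  fixes u :: "real ^ 2 \<Rightarrow> real"
  assumes "saddle_on \<theta> {x. R \<le> norm x} u g H" "0 < R" "\<And>x. R \<le> norm x \<Longrightarrow> M \<le> u x"
  shows "\<exists>L :: ereal. ((\<lambda>x. ereal (u x)) \<longlongrightarrow> L) at_infinity"
  using saddle_on_bounded_below_tendsto[OF assms]
proof
  assume "\<exists>L. (u \<longlongrightarrow> L) at_infinity"
  then obtain L where "(u \<longlongrightarrow> L) at_infinity" by blast
  then have "((\<lambda>x. ereal (u x)) \<longlongrightarrow> ereal L) at_infinity" by (rule tendsto_ereal)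
  then show ?thesis by blast
next
  assume "filterlim u at_top at_infinity"
  then have "((\<lambda>x. ereal (u x)) \<longlongrightarrow> \<infinity>) at_infinity"
    unfolding tendsto_PInfty filterlim_at_top_dense by simp
  then show ?thesis by blast
qed

section \<open>Back to the graph\<close>

text \<open>The third component of the normal is \<open>1 / sqrt (1 + |Du|^2)\<close>; its limit 1
  alone forces \<open>|Du|\<close> to 0.\<close>

lemma gradient_tendsto_0_of_upward_normal:
  assumes "(upward_normal S u \<longlongrightarrow> vector [0, 0, 1]) F"
  shows "(gradient_within S u \<longlongrightarrow> 0) F"
proof -
  define n where "n x = norm (gradient_within S u x)" for x
  have "((\<lambda>x. upward_normal S u x $ 3) \<longlongrightarrow> (vector [0, 0, 1] :: real ^ 3) $ 3) F"
    by (rule tendsto_vec_nth[OF assms])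
  then have "((\<lambda>x. 1 / sqrt (1 + (n x)\<^sup>2)) \<longlongrightarrow> 1) F"
    by (simp add: upward_normal_def Let_def n_def)
  then have "((\<lambda>x. (1 / (1 / sqrt (1 + (n x)\<^sup>2)))\<^sup>2 - 1) \<longlongrightarrow> (1 / 1)\<^sup>2 - 1) F"
    by (intro tendsto_intros) auto
  moreover have "(1 / (1 / sqrt (1 + (n x)\<^sup>2)))\<^sup>2 - 1 = (n x)\<^sup>2" for x by simp
  ultimately have "((\<lambda>x. sqrt ((n x)\<^sup>2)) \<longlongrightarrow> sqrt 0) F" by (intro tendsto_real_sqrt) simp
  then have "(n \<longlongrightarrow> 0) F" by (simp add: n_def[abs_def])
  then show ?thesis by (simp add: n_def[abs_def] tendsto_norm_zero_iff)
qed

lemma elliptic_matrix_of_principal_curvatures: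
  assumes pc: "principal_curvatures S u x k1 k2" and sym: "hessian_within S u x $ 1 $ 2 = hessian_within S u x $ 2 $ 1"
    and small: "norm (gradient_within S u x) \<le> 1" and "0 < \<Lambda>"
    and k: "0 \<le> k1" "k2 \<le> - \<Lambda> * k1" "- (1 / \<Lambda>) * k1 \<le> k2"
  shows "elliptic_matrix (\<Lambda> / 2) (hessian_within S u x)"
proof -
  define p where "p = gradient_within S u x"
  define H where "H = hessian_within S u x"
  define W where "W = sqrt (1 + (norm p)\<^sup>2)"
  have W0: "0 < W" by (simp add: W_def add_pos_nonneg)
  have W2: "W\<^sup>2 = 1 + (norm p)\<^sup>2" by (simp add: W_def)
  have np: "(norm p)\<^sup>2 = (p $ 1)\<^sup>2 + (p $ 2)\<^sup>2" by (simp add: norm_vec_def L2_set_def sum_2)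
  have W2': "1 + (p $ 1)\<^sup>2 + (p $ 2)\<^sup>2 = W\<^sup>2" by (simp add: W2 np)
  have "(1 + (norm p)\<^sup>2) powr (3 / 2) = W ^ 3"
  proof -
    have "1 + (norm p)\<^sup>2 = W powr 2" using W0 W2 by simp
    then have "(1 + (norm p)\<^sup>2) powr (3 / 2) = (W powr 2) powr (3 / 2)" by (simp only:)
    also have "\<dots> = W ^ 3" using W0 by (simp only: powr_powr) simp
    finally show ?thesis .
  qed
  then have mean: "(k1 + k2) / 2 = ((1 + (p $ 2)\<^sup>2) * H $ 1 $ 1 - 2 * p $ 1 * p $ 2 * H $ 1 $ 2 + (1 + (p $ 1)\<^sup>2) * H $ 2 $ 2) / (2 * W ^ 3)"
    using pc unfolding principal_curvatures_def graph_mean_curvature_def Let_def p_def H_def by (metis (no_types))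
  have gauss: "k1 * k2 = (H $ 1 $ 1 * H $ 2 $ 2 - H $ 1 $ 2 * H $ 2 $ 1) / (W\<^sup>2)\<^sup>2"
    using pc by (simp add: principal_curvatures_def graph_gauss_curvature_def p_def H_def det_2 W2)
  show ?thesis unfolding H_def[symmetric]
  proof (rule elliptic_matrix_of_curvatures[where ?p1.0 = "p $ 1" and ?p2.0 = "p $ 2" and ?k1.0 = "k1 * W" and ?k2.0 = "k2 * W"])
    show "H $ 1 $ 2 = H $ 2 $ 1" using sym by (simp add: H_def)
    show "(p $ 1)\<^sup>2 + (p $ 2)\<^sup>2 \<le> 1"
      using small power_mono[of "norm p" 1 2] np by (simp add: p_def)
    show "k2 * W \<le> k1 * W" using pc W0 by (simp add: principal_curvatures_def)
    show "(1 + (p $ 2)\<^sup>2) * H $ 1 $ 1 - 2 * p $ 1 * p $ 2 * H $ 1 $ 2 + (1 + (p $ 1)\<^sup>2) * H $ 2 $ 2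
        = (k1 * W + k2 * W) * (1 + (p $ 1)\<^sup>2 + (p $ 2)\<^sup>2)"
      using mean W0 unfolding W2' by (simp add: field_simps power2_eq_square power3_eq_cube)
    show "H $ 1 $ 1 * H $ 2 $ 2 - (H $ 1 $ 2)\<^sup>2 = k1 * W * (k2 * W) * (1 + (p $ 1)\<^sup>2 + (p $ 2)\<^sup>2)"
    proof -
      have "H $ 1 $ 1 * H $ 2 $ 2 - H $ 1 $ 2 * H $ 2 $ 1 = k1 * k2 * (W\<^sup>2)\<^sup>2"
        unfolding gauss using W0 by simp
      then show ?thesis using sym unfolding W2' by (simp add: H_def power2_eq_square)
    qed
    show "0 \<le> k1 * W" using k(1) W0 by simp
    show "k2 * W \<le> - \<Lambda> * (k1 * W)"
      using mult_right_mono[OF k(2), of W] W0 by (simp add: mult.assoc)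
    have "- \<Lambda> * k2 \<le> k1" using k(3) \<open>0 < \<Lambda>\<close> by (simp add: field_simps)
    then show "- \<Lambda> * (k2 * W) \<le> k1 * W"
      using mult_right_mono[of "- \<Lambda> * k2" k1 W] W0 by (simp add: mult.assoc)
  qed (rule \<open>0 < \<Lambda>\<close>)
qed

theorem theorem1p2:
  fixes \<Lambda> R :: real
    and f :: "real \<Rightarrow> real"
    and u \<kappa>\<^sub>1 \<kappa>\<^sub>2 :: "real ^ 2 \<Rightarrow> real"
  assumes "0 < \<Lambda>" and "\<Lambda> < 1"
    and "locally_lipschitz_on {0..} f"
    and "f 0 = 0"
    and "AE t in lebesgue. 0 \<le> t \<longrightarrow>
           (\<exists>D. (f has_real_derivative D) (at t within {0..}) \<and> - (1 / \<Lambda>) \<le> D \<and> D \<le> - \<Lambda>)"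
    and "0 < R"
    and "C2_on (- ball 0 R) u"
    and "\<And>x. x \<in> - ball 0 R \<Longrightarrow> principal_curvatures (- ball 0 R) u x (\<kappa>\<^sub>1 x) (\<kappa>\<^sub>2 x)"
    and "\<And>x. x \<in> - ball 0 R \<Longrightarrow> 0 \<le> \<kappa>\<^sub>1 x \<and> \<kappa>\<^sub>2 x = f (\<kappa>\<^sub>1 x)"
    and "(upward_normal (- ball 0 R) u \<longlongrightarrow> vector [0, 0, 1]) at_infinity"
  shows "(\<exists>c. (\<forall>x \<in> - ball 0 R. 0 < u x + c) \<or> (\<forall>x \<in> - ball 0 R. u x + c < 0))
       \<and> (\<exists>L :: ereal. ((\<lambda>x. ereal (u x)) \<longlongrightarrow> L) at_infinity)"
proof -
  define g where "g = gradient_within (- ball 0 R) u"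
  define H where "H = hessian_within (- ball 0 R) u"
  have g0: "(g \<longlongrightarrow> 0) at_infinity"
    unfolding g_def by (rule gradient_tendsto_0_of_upward_normal[OF assms(10)])
  then have "\<forall>\<^sub>F x in at_infinity. norm (g x) < 1" using tendstoD[OF g0, of 1] by simp
  then obtain R1 where R1: "\<And>x. R1 \<le> norm x \<Longrightarrow> norm (g x) < 1" by (auto simp: eventually_at_infinity)
  \<comment> \<open>\<open>R' > R\<close> turns derivatives within the domain into ordinary ones,
    and \<open>R' \<ge> R1\<close> gives the slope bound 1 that ellipticity of the Hessian rests
    on.\<close>
  define R' where "R' = max (R + 1) R1"
  have R': "R < R'" "R1 \<le> R'" "0 < R'" using \<open>0 < R\<close> by (auto simp: R'_def)
  define U where "U = {x :: real ^ 2. R < norm x}"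
  have oU: "open U" unfolding U_def by (intro open_Collect_less continuous_intros)
  have U: "U \<subseteq> interior (- ball 0 R)" using oU by (rule interior_maximal[rotated]) (auto simp: U_def)
  have D: "(u has_derivative (\<bullet>) (g x)) (at x)" "(g has_derivative (\<lambda>h. H x *v h)) (at x)"
    if "x \<in> U" for x
    using C2_on_has_derivatives[OF assms(7) subsetD[OF U that]] by (simp_all add: g_def H_def)
  have sad: "saddle_on (\<Lambda> / 2) {x. R' \<le> norm x} u g H"
    unfolding saddle_on_def
  proof (intro conjI ballI)
    fix x :: "real ^ 2" assume x: "x \<in> {x. R' \<le> norm x}"
    then have xU: "x \<in> U" "x \<in> - ball 0 R" using R' by (auto simp: U_def)
    show "(u has_derivative (\<bullet>) (g x)) (at x)" "(g has_derivative (\<lambda>h. H x *v h)) (at x)" using D xU by auto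
    have "axis 1 1 \<bullet> (H x *v axis 2 1) = axis 2 1 \<bullet> (H x *v axis 1 1)"
      by (rule second_derivative_symmetric[OF oU xU(1) D(1) D(2)[OF xU(1)]])
    then have sym: "H x $ 1 $ 2 = H x $ 2 $ 1"
      by (simp add: inner_axis' matrix_vector_mult_basis column_def)
    have k: "0 \<le> \<kappa>\<^sub>1 x" "\<kappa>\<^sub>2 x = f (\<kappa>\<^sub>1 x)" using assms(9)[OF xU(2)] by auto
    show "elliptic_matrix (\<Lambda> / 2) (H x)" unfolding H_def
    proof (rule elliptic_matrix_of_principal_curvatures[OF assms(8)[OF xU(2)] _ _ \<open>0 < \<Lambda>\<close> k(1)])
      show "norm (gradient_within (- ball 0 R) u x) \<le> 1" using R1[of x] x R' by (simp add: g_def)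
      show "\<kappa>\<^sub>2 x \<le> - \<Lambda> * \<kappa>\<^sub>1 x" "- (1 / \<Lambda>) * \<kappa>\<^sub>1 x \<le> \<kappa>\<^sub>2 x"
        unfolding k(2) using weingarten_bounds[OF assms(1,3,4,5) k(1)] by auto
    qed (use sym in \<open>simp add: H_def\<close>)
  qed (use \<open>0 < \<Lambda>\<close> in simp)
  have "continuous_on (- ball 0 R) u"
    using assms(7) by (intro differentiable_imp_continuous_on) (simp add: C2_on_def)
  then have "continuous_on (cball 0 R' - ball 0 R) u" by (rule continuous_on_subset) auto
  then have "bounded (u ` (cball 0 R' - ball 0 R))"
    by (intro compact_imp_bounded compact_continuous_image compact_diff compact_cball open_ball)
  then have "\<exists>B. \<forall>x\<in>cball 0 R' - ball 0 R. \<bar>u x\<bar> \<le> B" by (simp add: bounded_iff)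
  then obtain B where B: "\<And>x. x \<in> cball 0 R' - ball 0 R \<Longrightarrow> \<bar>u x\<bar> \<le> B" by blast
  consider (below) M where "\<And>x. R' \<le> norm x \<Longrightarrow> M \<le> u x" | (above) M where "\<And>x. R' \<le> norm x \<Longrightarrow> u x \<le> M"
    using saddle_on_bounded_above_or_below[OF sad R'(3) g0] by blast
  then show ?thesis
  proof cases
    case below
    have "0 < u x + (\<bar>M\<bar> + B + 1)" if x: "x \<in> - ball 0 R" for x
    proof (cases "R' \<le> norm x")
      case True
      \<comment> \<open>A point of the ring is evaluated only to see that
        \<open>0 \<le> B\<close>.\<close>
      have "\<bar>u (R' *\<^sub>R axis 1 1)\<bar> \<le> B" using B[of "R' *\<^sub>R axis 1 1"] R' by simp
      then show ?thesis using below[OF True] by linarith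
    next
      case False
      then show ?thesis using B[of x] x by simp
    qed
    then show ?thesis using saddle_on_bounded_below_ereal_limit[OF sad R'(3) below] by blast
  next
    case above
    have "u x + (- (\<bar>M\<bar> + B + 1)) < 0" if x: "x \<in> - ball 0 R" for x
    proof (cases "R' \<le> norm x")
      case True
      have "\<bar>u (R' *\<^sub>R axis 1 1)\<bar> \<le> B" using B[of "R' *\<^sub>R axis 1 1"] R' by simp
      then show ?thesis using above[OF True] by linarith
    next
      case False
      then show ?thesis using B[of x] x by simp
    qed
    \<comment> \<open>For the limit, a bound from above is the previous case for
      \<open>- u\<close>.\<close>
    moreover have "- M \<le> - u x" if "R' \<le> norm x" for x using above[OF that] by simp
    then obtain L :: ereal where "((\<lambda>x. ereal (- u x)) \<longlongrightarrow> L) at_infinity"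
      using saddle_on_bounded_below_ereal_limit[OF saddle_on_uminus[OF sad] R'(3)] by blast
    then have "((\<lambda>x. - ereal (- u x)) \<longlongrightarrow> - L) at_infinity" by (rule tendsto_uminus_ereal)
    then have "((\<lambda>x. ereal (u x)) \<longlongrightarrow> - L) at_infinity" by simp
    ultimately show ?thesis by blast
  qed
qed

end
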